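(* Let $K$ be an algebraically closed field of characteristic zero. Let $I=(f_1,f_2,\ldots,f_5)\subset K[x_1,\ldots,x_5]$ be an ideal such that either $f_1,\ldots,f_5$ is a generic (regular) sequence of homogeneous polynomials of degree $2$, or $f_1,\ldots,f_5$ is a regular sequence of homogeneous polynomials of degree $2$ with $f_i\in K[x_i,\ldots,x_5]$ for $i=1,\ldots,5$. Then the generic initial ideal $J=\mathrm{Gin}(I)$ of $I$ with respect to the reverse lexicographic order is \[J=(x_1^2,\ x_1x_2,\ x_2^2,\ x_1x_3,\ x_2x_3,\ x_3^3,\ x_3^2x_4,\ x_1x_4^2,\ x_2x_4^2,\ x_3x_4^2,\ x_4^3,\] \[x_3^2x_5^2,\ x_1x_4x_5^2,\ x_2x_4x_5^2,\ x_3x_4x_5^2,\ x_4^2x_5^2,\ x_5^4x_1,\ x_5^4x_2,\ x_5^4x_3,\ x_5^4x_4,\ x_5^6).\]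
   Context: The reverse lexicographic (revlex) order is the graded reverse lexicographic order with $x_1>x_2>\cdots>x_5$. The generic initial ideal $\mathrm{Gin}(I)$ of a homogeneous ideal $I\subset S=K[x_1,\ldots,x_5]$ is the initial ideal, with respect to this order, of $g(I)$ for a generic linear change of coordinates $g$: there is a nonempty Zariski open subset of $GL_5(K)$ on which $\mathrm{in}(g(I))$ is constant, and $\mathrm{Gin}(I)$ is this common value. A property holds for a generic sequence of homogeneous polynomials of degrees $d_1,\ldots,d_m$ if there is a nonempty Zariski open subset $U\subset S_{d_1}\times\cdots\times S_{d_m}$ such that the property holds for every tuple $(f_1,\ldots,f_m)\in U$. *)

theory Defs
  imports
    "HOL-Analysis.Determinants"
    "HOL-Computational_Algebra.Polynomial"
    "HOL-Library.Numeral_Type"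
    "HOL-Library.Poly_Mapping"
begin

type_synonym 'v monom = "'v \<Rightarrow>\<^sub>0 nat"

type_synonym ('v, 'k) mpoly = "'v monom \<Rightarrow>\<^sub>0 'k"

definition Var :: "'v \<Rightarrow> ('v, 'k::comm_ring_1) mpoly"
  where "Var v = Poly_Mapping.single (Poly_Mapping.single v 1) 1"

definition Const :: "'k::comm_ring_1 \<Rightarrow> ('v, 'k) mpoly"
  where "Const c = Poly_Mapping.single 0 c"

definition deg_monom :: "'v monom \<Rightarrow> nat"
  where "deg_monom m = (\<Sum>v\<in>Poly_Mapping.keys m. Poly_Mapping.lookup m v)"

text \<open>As usual, the zero polynomial is homogeneous of every degree, so that the
  homogeneous polynomials of degree \<open>d\<close> form the vector space \<open>S\<^sub>d\<close>.\<close>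

definition homogeneous :: "nat \<Rightarrow> ('v, 'k::zero) mpoly \<Rightarrow> bool"
  where "homogeneous d p \<longleftrightarrow> (\<forall>m\<in>Poly_Mapping.keys p. deg_monom m = d)"

definition polys_in :: "'v set \<Rightarrow> ('v, 'k::zero) mpoly set"
  where "polys_in V = {p. \<forall>m\<in>Poly_Mapping.keys p. Poly_Mapping.keys m \<subseteq> V}"

text \<open>The image of \<open>p\<close> under the ring homomorphism that is \<open>\<phi>\<close> on coefficients and
  sends the variable \<open>v\<close> to \<open>a v\<close>.\<close>

definition eval_mpoly ::
    "('k::zero \<Rightarrow> 'r::comm_ring_1) \<Rightarrow> ('v \<Rightarrow> 'r) \<Rightarrow> ('v, 'k) mpoly \<Rightarrow> 'r"
  where "eval_mpoly \<phi> a p = (\<Sum>m\<in>Poly_Mapping.keys p. \<phi> (Poly_Mapping.lookup p m) * (\<Prod>v\<in>Poly_Mapping.keys m. a v ^ Poly_Mapping.lookup m v))"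

text \<open>Ideals are submodules of the ring over itself; \<open>ideal.span B\<close> is the ideal
  generated by \<open>B\<close>.\<close>

interpretation ideal: module "(*) :: 'a::comm_ring_1 \<Rightarrow> 'a \<Rightarrow> 'a"
  by unfold_locales (simp_all add: algebra_simps)

definition regular_sequence :: "('i::linorder \<Rightarrow> 'a::comm_ring_1) \<Rightarrow> bool"
  where "regular_sequence f \<longleftrightarrow>
    (\<forall>i g. g * f i \<in> ideal.span (f ` {..<i}) \<longrightarrow> g \<in> ideal.span (f ` {..<i})) \<and>
    ideal.span (range f) \<noteq> UNIV"

text \<open>A smaller index means a larger variable. Among monomials of equal degree, the
  smaller one has the larger exponent at the last variable where they differ.\<close>

definition revlex_less :: "'v::linorder monom \<Rightarrow> 'v monom \<Rightarrow> bool"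
  where "revlex_less s t \<longleftrightarrow>
    deg_monom s < deg_monom t \<or>
    deg_monom s = deg_monom t \<and>
      (\<exists>v. Poly_Mapping.lookup s v > Poly_Mapping.lookup t v \<and> (\<forall>w>v. Poly_Mapping.lookup s w = Poly_Mapping.lookup t w))"

definition is_initial_monom :: "('v::linorder, 'k::zero) mpoly \<Rightarrow> 'v monom \<Rightarrow> bool"
  where "is_initial_monom p m \<longleftrightarrow>
    m \<in> Poly_Mapping.keys p \<and> (\<forall>m'\<in>Poly_Mapping.keys p. m' \<noteq> m \<longrightarrow> revlex_less m' m)"

definition initial_ideal :: "('v::linorder, 'k::comm_ring_1) mpoly set \<Rightarrow> ('v, 'k) mpoly set"
  where "initial_ideal I =
    ideal.span {Poly_Mapping.single m 1 | m. \<exists>p\<in>I. is_initial_monom p m}"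

text \<open>The Zariski topology on a set \<open>X\<close> of points with coordinates \<open>coord x i\<close>,
  induced from affine space: \<open>U\<close> is open if it is the complement in \<open>X\<close> of the common
  zero set of a set of polynomials in the coordinates.\<close>

definition zariski_open_in :: "('x \<Rightarrow> 'i \<Rightarrow> 'k::comm_ring_1) \<Rightarrow> 'x set \<Rightarrow> 'x set \<Rightarrow> bool"
  where "zariski_open_in coord X U \<longleftrightarrow>
    (\<exists>P :: ('i, 'k) mpoly set. U = {x \<in> X. \<exists>p\<in>P. eval_mpoly (\<lambda>c. c) (coord x) p \<noteq> 0})"

definition GL :: "('k::field ^ 'n ^ 'n) set"
  where "GL = {A. invertible A}"

definition zariski_open_GL :: "('k::field ^ 'n ^ 'n) set \<Rightarrow> bool"
  where "zariski_open_GL = zariski_open_in (\<lambda>A (i, j). A $ i $ j) GL"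

definition lin_change :: "'k::comm_ring_1 ^ 'n ^ 'n \<Rightarrow> ('n, 'k) mpoly \<Rightarrow> ('n, 'k) mpoly"
  where "lin_change A = eval_mpoly Const (\<lambda>j. \<Sum>i\<in>UNIV. Const (A $ i $ j) * Var i)"

definition Gin :: "('n::{finite,linorder}, 'k::field) mpoly set \<Rightarrow> ('n, 'k) mpoly set"
  where "Gin I = (THE J. \<exists>U. zariski_open_GL U \<and> U \<noteq> {} \<and>
    (\<forall>A\<in>U. initial_ideal (lin_change A ` I) = J))"

text \<open>The coordinates of a family of polynomials are all their coefficients; on families
  with \<open>f i \<in> S\<^bsub>d i\<^esub>\<close> those outside degree \<open>d i\<close> vanish identically.\<close>

definition holds_generically ::
    "('i \<Rightarrow> nat) \<Rightarrow> (('i \<Rightarrow> ('v, 'k::field) mpoly) \<Rightarrow> bool) \<Rightarrow> bool"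
  where "holds_generically d \<Phi> \<longleftrightarrow>
    (\<exists>U. zariski_open_in (\<lambda>f (i, m). Poly_Mapping.lookup (f i) m) {f. \<forall>i. homogeneous (d i) (f i)} U \<and>
      U \<noteq> {} \<and> (\<forall>f\<in>U. \<Phi> f))"

text \<open>The type \<open>5\<close> has the elements \<open>0 < 1 < 2 < 3 < 4\<close>, hence the shift of indices.\<close>

abbreviation x1 :: "(5, 'k::comm_ring_1) mpoly" where "x1 \<equiv> Var 0"
abbreviation x2 :: "(5, 'k::comm_ring_1) mpoly" where "x2 \<equiv> Var 1"
abbreviation x3 :: "(5, 'k::comm_ring_1) mpoly" where "x3 \<equiv> Var 2"
abbreviation x4 :: "(5, 'k::comm_ring_1) mpoly" where "x4 \<equiv> Var 3"
abbreviation x5 :: "(5, 'k::comm_ring_1) mpoly" where "x5 \<equiv> Var 4"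

end

theory Submission
  imports Defs
begin

text \<open>Call a monomial standard if it does not lie in \<open>J\<close>. There are 1, 5, 10, 10, 5 and 1 standard
  monomials in the degrees from 0 to 5 and none in higher degrees, and in each degree they are the
  last ones in reverse lexicographic order (\<open>std_monom_revlex_downward\<close>).

  Because of this segment property, an ideal generated by five quadrics has initial ideal \<open>J\<close> as
  soon as the standard monomials span its quotient ring in the degrees from 2 to 6, which is the
  condition \<open>std_spanning\<close>. Spanning puts every generator of \<open>J\<close> into the initial ideal. An initial
  monomial outside \<open>J\<close> would yield a nonzero form in the ideal with standard monomials only; this is
  impossible since the relations \<open>f i * f j = f j * f i\<close> bound the dimension of the ideal, so that the
  standard monomials are also independent in the quotient (\<open>initial_ideal_eq_J\<close>).

  The spanning condition is open in every polynomial family of quadrics (\<open>std_spanning_open\<close>).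
  Applied to coordinate changes, it shows that \<open>J\<close> is the generic initial ideal as soon as the
  condition holds after one invertible change of coordinates (\<open>Gin_eq_J\<close>). Applied to all families of
  five quadrics, it reduces the first claim to one example. The example consists of the squares of
  five independent linear forms \<open>y j\<close> with \<open>x5\<close> as their sum. Modulo these squares the ring has the
  squarefree products of the \<open>y j\<close> as a basis, multiplication by powers of \<open>x5\<close> can be inverted
  explicitly, and in degree 2 a suitable choice of \<open>x3\<close> and \<open>x4\<close> suffices (\<open>std_spanning_of_squares\<close>).

  For the second claim, scale the variables with suitable powers of a parameter \<open>t\<close>. A form in the
  variables from \<open>i\<close> on then degenerates to a multiple of the square of variable \<open>i\<close>. If the coefficients
  of these squares are nonzero, the limit \<open>t = 0\<close> is the example up to a change of coordinates, and by
  openness the condition holds for some nonzero \<open>t\<close>, that is, for a linear change of the given forms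
  (\<open>triangular_forms_std_spanning\<close>). Suppose that one of these coefficients vanishes, and take the first
  such \<open>i\<close>. Over an algebraically closed field the quadrics then have a common zero other than the
  origin, found by solving one quadratic equation after another. This contradicts the Hilbert
  function of a regular sequence, by which the ideal contains all forms of degree 6
  (\<open>regular_triangular_square_coefficient\<close>).\<close>

abbreviation lookup :: "('a \<Rightarrow>\<^sub>0 'b::zero) \<Rightarrow> 'a \<Rightarrow> 'b" where "lookup \<equiv> Poly_Mapping.lookup"
abbreviation keys :: "('a \<Rightarrow>\<^sub>0 'b::zero) \<Rightarrow> 'a set" where "keys \<equiv> Poly_Mapping.keys"
abbreviation single :: "'a \<Rightarrow> 'b \<Rightarrow> ('a \<Rightarrow>\<^sub>0 'b::zero)" where "single \<equiv> Poly_Mapping.single"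

section \<open>Polynomials\<close>

lemma sum_single_keys: "(\<Sum>m\<in>keys p. single m (lookup p m)) = p"
  by (rule poly_mapping_eqI)
     (simp add: lookup_sum lookup_single when_def in_keys_iff)

lemma mpoly_induct [case_names single add]:
  fixes p :: "('v, 'k::comm_ring_1) mpoly"
  assumes "\<And>m c. P (single m c)" and "\<And>p q. P p \<Longrightarrow> P q \<Longrightarrow> P (p + q)"
  shows "P p"
proof -
  have "P (\<Sum>m\<in>F. single m (lookup p m))" if "finite F" for F
    using that
  proof (induction F rule: finite_induct)
    case empty
    show ?case using assms(1)[of 0 0] by simp
  next
    case (insert m F)
    then show ?case
      using assms(2)[OF assms(1)[of m "lookup p m"] insert(3)] by (simp only: sum.insert[OF insert(1,2)])
  qed
  from this[OF finite_keys, of p] show ?thesis by (simp only: sum_single_keys)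
qed

lemma single_eq_Const_mult: "single m c = Const c * single m 1"
  by (simp add: Const_def mult_single)

lemma lookup_Const_mult [simp]: "lookup (Const c * p) m = c * lookup p m"
proof (induction p rule: mpoly_induct)
  case (single k d)
  then show ?case by (simp add: Const_def mult_single lookup_single when_def)
next
  case (add p q)
  then show ?case by (simp add: distrib_left lookup_add)
qed

lemma Const_0 [simp]: "Const 0 = 0" and Const_1 [simp]: "Const 1 = 1"
  by (simp_all add: Const_def)

lemma Const_add: "Const (a + b) = Const a + Const b"
  and Const_mult: "Const (a * b) = Const a * Const b"
  by (simp_all add: Const_def single_add mult_single)

lemma Const_power: "Const (a ^ n) = Const a ^ n"
  by (induction n) (simp_all add: Const_mult)

lemma Const_sum: "Const (sum f A) = (\<Sum>i\<in>A. Const (f i))"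
  by (induction A rule: infinite_finite_induct) (simp_all add: Const_add)

lemma Const_of_nat: "Const (of_nat n) = of_nat n"
  by (induction n) (simp_all add: Const_add)

lemma Const_numeral [simp]: "Const (numeral n) = numeral n"
  using Const_of_nat[of "numeral n"] by simp

definition ring_map :: "('a::comm_ring_1 \<Rightarrow> 'b::comm_ring_1) \<Rightarrow> bool"
  where "ring_map h \<longleftrightarrow> h 0 = 0 \<and> h 1 = 1 \<and> (\<forall>x y. h (x + y) = h x + h y) \<and> (\<forall>x y. h (x * y) = h x * h y)"

lemma ring_mapD:
  assumes "ring_map h"
  shows "h 0 = 0" "h 1 = 1" "h (x + y) = h x + h y" "h (x * y) = h x * h y"
  using assms by (auto simp: ring_map_def)

lemma ring_map_power: "ring_map h \<Longrightarrow> h (x ^ n) = h x ^ n"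
  by (induction n) (auto simp: ring_mapD)

lemma ring_map_sum: "ring_map h \<Longrightarrow> h (sum f A) = (\<Sum>i\<in>A. h (f i))"
  by (induction A rule: infinite_finite_induct) (auto simp: ring_mapD)

lemma ring_map_prod: "ring_map h \<Longrightarrow> h (prod f A) = (\<Prod>i\<in>A. h (f i))"
  by (induction A rule: infinite_finite_induct) (auto simp: ring_mapD)

lemma ring_map_Const: "ring_map (Const :: 'k::comm_ring_1 \<Rightarrow> ('v, 'k) mpoly)"
  by (simp add: ring_map_def Const_add Const_mult)

lemma ring_map_id: "ring_map (\<lambda>c. c)"
  by (simp add: ring_map_def)

definition monom_value :: "('v \<Rightarrow> 'r::comm_ring_1) \<Rightarrow> 'v monom \<Rightarrow> 'r"
  where "monom_value a m = (\<Prod>v\<in>keys m. a v ^ lookup m v)"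

lemma monom_value_superset:
  "finite V \<Longrightarrow> keys m \<subseteq> V \<Longrightarrow> monom_value a m = (\<Prod>v\<in>V. a v ^ lookup m v)"
  unfolding monom_value_def by (rule prod.mono_neutral_left) (auto simp: in_keys_iff)

lemma monom_value_add: "monom_value a (m + n) = monom_value a m * monom_value a n"
proof -
  let ?V = "keys m \<union> keys n"
  have "keys (m + n) \<subseteq> ?V" by (rule Poly_Mapping.keys_add)
  then show ?thesis
    by (simp add: monom_value_superset[of ?V] lookup_add power_add prod.distrib)
qed

lemma monom_value_single [simp]: "monom_value a (single v k) = a v ^ k"
  by (cases "k = 0") (simp_all add: monom_value_def)

lemma monom_value_0 [simp]: "monom_value a 0 = 1"
  by (simp add: monom_value_def)

lemma eval_mpoly_superset:
  assumes "\<phi> 0 = 0" "finite F" "keys p \<subseteq> F"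
  shows "eval_mpoly \<phi> a p = (\<Sum>m\<in>F. \<phi> (lookup p m) * monom_value a m)"
  unfolding eval_mpoly_def monom_value_def
  by (rule sum.mono_neutral_left) (use assms in \<open>auto simp: in_keys_iff\<close>)

lemma eval_mpoly_single: "\<phi> 0 = 0 \<Longrightarrow> eval_mpoly \<phi> a (single m c) = \<phi> c * monom_value a m"
  by (simp add: eval_mpoly_superset[of \<phi> "{m}"])

lemma eval_mpoly_add:
  assumes "ring_map \<phi>"
  shows "eval_mpoly \<phi> a (p + q) = eval_mpoly \<phi> a p + eval_mpoly \<phi> a q"
proof -
  let ?F = "keys p \<union> keys q"
  have "keys (p + q) \<subseteq> ?F" by (rule Poly_Mapping.keys_add)
  then show ?thesis
    by (simp add: eval_mpoly_superset[of \<phi> ?F] ring_mapD[OF assms] lookup_add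
        distrib_right sum.distrib)
qed

lemma eval_mpoly_mult:
  assumes "ring_map \<phi>"
  shows "eval_mpoly \<phi> a (p * q) = eval_mpoly \<phi> a p * eval_mpoly \<phi> a q"
proof (induction p rule: mpoly_induct)
  case (single m c)
  have 0: "\<phi> 0 = 0" by (rule ring_mapD(1)[OF assms])
  show ?case
  proof (induction q rule: mpoly_induct)
    case (single n d)
    show ?case
      by (simp only: mult_single eval_mpoly_single[of \<phi>, OF 0] monom_value_add
          ring_mapD(4)[OF assms] mult.assoc mult.commute mult.left_commute)
  next
    case (add q q')
    then show ?case by (simp only: distrib_left eval_mpoly_add[OF assms])
  qed
next
  case (add p p')
  then show ?case by (simp only: distrib_right eval_mpoly_add[OF assms])
qed

lemma ring_map_eval_mpoly: "ring_map \<phi> \<Longrightarrow> ring_map (eval_mpoly \<phi> a)"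
  unfolding ring_map_def[of "eval_mpoly \<phi> a"]
  by (simp add: eval_mpoly_add eval_mpoly_mult)
     (simp add: eval_mpoly_superset[of \<phi> "{0}"] ring_mapD lookup_one)

lemma eval_mpoly_Const: "ring_map \<phi> \<Longrightarrow> eval_mpoly \<phi> a (Const c) = \<phi> c"
  by (simp add: Const_def eval_mpoly_single ring_mapD)

lemma eval_mpoly_Var: "ring_map \<phi> \<Longrightarrow> eval_mpoly \<phi> a (Var v) = a v"
  by (simp add: Var_def eval_mpoly_single ring_mapD)

lemma Var_power: "Var v ^ n = single (single v n) 1"
  by (induction n) (simp_all add: Var_def mult_single single_add[symmetric])

lemma prod_Var_power:
  "finite V \<Longrightarrow> (\<Prod>v\<in>V. Var v ^ e v) = (single (\<Sum>v\<in>V. single v (e v)) 1 :: ('v, 'k::comm_ring_1) mpoly)"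
  by (induction V rule: finite_induct) (simp_all add: Var_power mult_single)

lemma monom_value_Var: "monom_value Var m = (single m 1 :: ('v, 'k::comm_ring_1) mpoly)"
  by (simp add: monom_value_def prod_Var_power sum_single_keys)

lemma eval_mpoly_eqI:
  assumes "ring_map \<phi>" and h: "ring_map h"
    and "\<And>c. h (Const c) = \<phi> c" "\<And>v. h (Var v) = a v"
  shows "h p = eval_mpoly \<phi> a p"
proof (induction p rule: mpoly_induct)
  case (single m c)
  have "h (single m c) = h (Const c) * h (monom_value Var m)"
    unfolding single_eq_Const_mult[of m c] monom_value_Var by (rule ring_mapD(4)[OF h])
  also have "h (monom_value Var m) = monom_value a m"
    by (simp add: monom_value_def ring_map_prod[OF h] ring_map_power[OF h] assms)
  finally show ?case by (simp add: assms eval_mpoly_single ring_mapD)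
next
  case (add p q)
  then show ?case by (simp add: eval_mpoly_add assms ring_mapD)
qed

section \<open>Homogeneous components\<close>

lemma deg_monom_superset: "finite V \<Longrightarrow> keys m \<subseteq> V \<Longrightarrow> deg_monom m = (\<Sum>v\<in>V. lookup m v)"
  unfolding deg_monom_def by (rule sum.mono_neutral_left) (auto simp: in_keys_iff)

lemma deg_monom_UNIV: "deg_monom (m :: 'v::finite monom) = (\<Sum>v\<in>UNIV. lookup m v)"
  by (simp add: deg_monom_superset)

lemma deg_monom_0 [simp]: "deg_monom 0 = 0"
  by (simp add: deg_monom_def)

lemma deg_monom_single [simp]: "deg_monom (single v k) = k"
  by (simp add: deg_monom_superset[of "{v}"])

lemma deg_monom_add [simp]: "deg_monom (m + n) = deg_monom m + deg_monom n"
proof -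
  have "keys (m + n) \<subseteq> keys m \<union> keys n" by (rule Poly_Mapping.keys_add)
  then show ?thesis
    by (simp add: deg_monom_superset[of "keys m \<union> keys n"] lookup_add sum.distrib)
qed

lemma deg_monom_eq_0_iff: "deg_monom m = 0 \<longleftrightarrow> m = 0"
proof
  assume "deg_monom m = 0"
  then show "m = 0" by (intro poly_mapping_eqI) (auto simp: deg_monom_def in_keys_iff)
qed simp

lemma deg_monom_Suc:
  assumes "deg_monom m = Suc d"
  obtains v n where "m = single v 1 + n" "deg_monom n = d"
proof -
  obtain v where v: "v \<in> keys m"
    using assms by (auto simp: deg_monom_def) (metis all_not_in_conv nat.distinct(1) sum.empty)
  have "m = single v 1 + (m - single v 1)"
    using v by (intro poly_mapping_eqI) (auto simp: lookup_add lookup_minus lookup_single when_def in_keys_iff)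
  moreover from this have "deg_monom m = 1 + deg_monom (m - single v 1)"
    by (metis deg_monom_add deg_monom_single)
  ultimately show thesis using that assms by (metis plus_1_eq_Suc diff_Suc_1)
qed

lemma homogeneous_0 [simp]: "homogeneous d 0"
  by (simp add: homogeneous_def)

lemma homogeneous_single: "deg_monom m = d \<Longrightarrow> homogeneous d (single m c)"
  by (simp add: homogeneous_def)

lemma homogeneous_lookup: "homogeneous d p \<Longrightarrow> deg_monom m \<noteq> d \<Longrightarrow> lookup p m = 0"
  by (auto simp: homogeneous_def in_keys_iff)

lemma homogeneousI: "(\<And>m. deg_monom m \<noteq> d \<Longrightarrow> lookup p m = 0) \<Longrightarrow> homogeneous d p"
  by (auto simp: homogeneous_def in_keys_iff)

lemma homogeneous_add: "homogeneous d p \<Longrightarrow> homogeneous d q \<Longrightarrow> homogeneous d (p + q)"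
  by (rule homogeneousI) (simp add: lookup_add homogeneous_lookup)

lemma homogeneous_diff:
  "homogeneous d p \<Longrightarrow> homogeneous d q \<Longrightarrow> homogeneous d (p - q :: ('v, 'k::comm_ring_1) mpoly)"
  by (rule homogeneousI) (simp add: lookup_minus homogeneous_lookup)

lemma homogeneous_sum: "(\<And>i. i \<in> A \<Longrightarrow> homogeneous d (f i)) \<Longrightarrow> homogeneous d (sum f A)"
  by (induction A rule: infinite_finite_induct) (auto intro: homogeneous_add)

lemma homogeneous_mult:
  assumes "homogeneous d p" "homogeneous e q" shows "homogeneous (d + e) (p * q)"
  unfolding homogeneous_def
proof
  fix m assume "m \<in> keys (p * q)"
  then obtain a b where "m = a + b" "a \<in> keys p" "b \<in> keys q"
    using Poly_Mapping.keys_mult[of p q] by auto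
  then show "deg_monom m = d + e" using assms by (simp add: homogeneous_def)
qed

lemma homogeneous_Const: "homogeneous 0 (Const c)"
  by (simp add: Const_def homogeneous_single)

lemma homogeneous_1: "homogeneous 0 1"
  by (auto simp: homogeneous_def lookup_one in_keys_iff when_def)

lemma homogeneous_Const_mult: "homogeneous d p \<Longrightarrow> homogeneous d (Const c * p)"
  using homogeneous_mult[OF homogeneous_Const, of d p c] by simp

lemma homogeneous_Var: "homogeneous 1 (Var v)"
  by (simp add: Var_def homogeneous_single)

lemma homogeneous_power: "homogeneous d p \<Longrightarrow> homogeneous (n * d) (p ^ n)"
  by (induction n) (auto simp: homogeneous_1 intro: homogeneous_mult)

lemma homogeneous_prod:
  "finite A \<Longrightarrow> (\<And>i. i \<in> A \<Longrightarrow> homogeneous (d i) (f i)) \<Longrightarrow> homogeneous (\<Sum>i\<in>A. d i) (\<Prod>i\<in>A. f i)"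
  by (induction A rule: finite_induct)
     (auto simp: homogeneous_1 intro: homogeneous_mult)

definition hom_comp :: "nat \<Rightarrow> ('v, 'k::comm_ring_1) mpoly \<Rightarrow> ('v, 'k) mpoly"
  where "hom_comp d p = (\<Sum>m | m \<in> keys p \<and> deg_monom m = d. single m (lookup p m))"

lemma lookup_hom_comp: "lookup (hom_comp d p) m = (if deg_monom m = d then lookup p m else 0)"
proof -
  have "lookup (hom_comp d p) m = (\<Sum>n | n \<in> keys p \<and> deg_monom n = d. if n = m then lookup p n else 0)"
    by (simp add: hom_comp_def lookup_sum lookup_single when_def)
  also have "\<dots> = (if deg_monom m = d then lookup p m else 0)"
    by (subst sum.delta) (auto simp: in_keys_iff)
  finally show ?thesis .
qed

lemma homogeneous_hom_comp: "homogeneous d (hom_comp d p)"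
  by (rule homogeneousI) (simp add: lookup_hom_comp)

lemma hom_comp_homogeneous: "homogeneous e p \<Longrightarrow> hom_comp d p = (if d = e then p else 0)"
  by (rule poly_mapping_eqI) (auto simp: lookup_hom_comp homogeneous_lookup)

lemma hom_comp_add: "hom_comp d (p + q) = hom_comp d p + hom_comp d q"
  by (rule poly_mapping_eqI) (simp add: lookup_hom_comp lookup_add)

lemma hom_comp_sum: "hom_comp d (sum f A) = (\<Sum>i\<in>A. hom_comp d (f i))"
  by (rule poly_mapping_eqI) (simp add: lookup_hom_comp lookup_sum)

lemma hom_comp_mult_homogeneous:
  assumes "homogeneous e q"
  shows "hom_comp (d + e) (p * q) = hom_comp d p * q"
proof (induction p rule: mpoly_induct)
  case (single m c)
  have *: "homogeneous (deg_monom m) (single m c)" by (simp add: homogeneous_single)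
  show ?case
    by (simp add: hom_comp_homogeneous[OF *] hom_comp_homogeneous[OF homogeneous_mult[OF * assms]])
next
  case (add p p')
  then show ?case by (simp add: distrib_right hom_comp_add)
qed

lemma hom_comp_mult_homogeneous_small:
  assumes "homogeneous e q" "d < e"
  shows "hom_comp d (p * q) = 0"
proof (induction p rule: mpoly_induct)
  case (single m c)
  have "homogeneous (deg_monom m) (single m c)" by (simp add: homogeneous_single)
  from homogeneous_mult[OF this assms(1)] show ?case
    using assms(2) by (simp add: hom_comp_homogeneous)
next
  case (add p p')
  then show ?case by (simp add: distrib_right hom_comp_add)
qed

section \<open>Ideals generated by families\<close>

lemma in_ideal_span_range_iff:
  fixes f :: "'i::finite \<Rightarrow> 'a::comm_ring_1"
  shows "p \<in> ideal.span (range f) \<longleftrightarrow> (\<exists>h. p = (\<Sum>i\<in>UNIV. h i * f i))"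
proof
  assume "p \<in> ideal.span (range f)"
  then show "\<exists>h. p = (\<Sum>i\<in>UNIV. h i * f i)"
  proof (induction p rule: ideal.span_induct_alt)
    case base
    show ?case by (rule exI[of _ "\<lambda>_. 0"]) simp
  next
    case (step c x y)
    then obtain h j where h: "y = (\<Sum>i\<in>UNIV. h i * f i)" and j: "x = f j" by auto
    have "c * f j = (\<Sum>i\<in>UNIV. (if i = j then c else 0) * f i)"
      by (simp add: if_distrib[of "\<lambda>x. x * _"] cong: if_cong)
    then have "c * x + y = (\<Sum>i\<in>UNIV. (h i + (if i = j then c else 0)) * f i)"
      by (simp add: h j distrib_right sum.distrib)
    then show ?case by (intro exI[of _ "\<lambda>i. h i + (if i = j then c else 0)"])
  qed
next
  assume "\<exists>h. p = (\<Sum>i\<in>UNIV. h i * f i)"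
  then show "p \<in> ideal.span (range f)"
    by (auto intro: ideal.span_base intro!: ideal.span_sum[of UNIV] ideal.span_scale)
qed

lemma ideal_mult_left: "p \<in> ideal.span B \<Longrightarrow> q * p \<in> ideal.span B"
  by (rule ideal.span_scale)

lemma ideal_mult_right: "p \<in> ideal.span B \<Longrightarrow> p * q \<in> ideal.span B"
  using ideal.span_scale[of p B q] by (simp add: mult.commute)

text \<open>An ideal generated by forms is graded: the components of a multiple of a generator are again
  multiples of that generator.\<close>

lemma hom_comp_in_ideal:
  assumes F: "\<And>f. f \<in> F \<Longrightarrow> \<exists>e. homogeneous e f" and p: "p \<in> ideal.span F"
  shows "hom_comp d p \<in> ideal.span F"
  using p
proof (induction p rule: ideal.span_induct_alt)
  case base
  show ?case by (simp add: hom_comp_homogeneous[of 0] ideal.span_zero)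
next
  case (step c f y)
  obtain e where e: "homogeneous e f" using F step(1) by blast
  have "hom_comp d (c * f) \<in> ideal.span F"
  proof (cases "e \<le> d")
    case True
    then have "hom_comp d (c * f) = hom_comp (d - e) c * f"
      using hom_comp_mult_homogeneous[OF e, of "d - e" c] by simp
    then show ?thesis using step(1) by (simp add: ideal_mult_left ideal.span_base)
  qed (use hom_comp_mult_homogeneous_small[OF e, of d c] in \<open>simp add: ideal.span_zero\<close>)
  then show ?case using step by (simp add: hom_comp_add ideal.span_add)
qed

text \<open>A form in an ideal generated by forms of one degree has form coefficients, because the
  other components of the coefficients cancel.\<close>

lemma homogeneous_in_ideal_span_range:
  fixes f :: "'i::finite \<Rightarrow> ('v, 'k::comm_ring_1) mpoly"
  assumes f: "\<And>i. homogeneous e (f i)"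
    and p: "p \<in> ideal.span (range f)" "homogeneous (d + e) p"
  obtains h where "\<And>i. homogeneous d (h i)" "p = (\<Sum>i\<in>UNIV. h i * f i)"
proof -
  obtain h where h: "p = (\<Sum>i\<in>UNIV. h i * f i)"
    using p(1) by (auto simp: in_ideal_span_range_iff)
  have "p = hom_comp (d + e) p"
    using p(2) by (simp add: hom_comp_homogeneous)
  also have "\<dots> = (\<Sum>i\<in>UNIV. hom_comp d (h i) * f i)"
    by (simp add: h hom_comp_sum hom_comp_mult_homogeneous[OF f])
  finally show thesis
    by (rule that[rotated]) (rule homogeneous_hom_comp)
qed

lemma homogeneous_in_ideal_small:
  fixes f :: "'i::finite \<Rightarrow> ('v, 'k::comm_ring_1) mpoly"
  assumes f: "\<And>i. homogeneous e (f i)"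
    and p: "p \<in> ideal.span (range f)" "homogeneous d p" "d < e"
  shows "p = 0"
proof -
  obtain h where h: "p = (\<Sum>i\<in>UNIV. h i * f i)"
    using p(1) by (auto simp: in_ideal_span_range_iff)
  have "p = hom_comp d p"
    using p(2) by (simp add: hom_comp_homogeneous)
  also have "\<dots> = 0"
    by (simp add: h hom_comp_sum hom_comp_mult_homogeneous_small[OF f p(3)])
  finally show ?thesis .
qed

section \<open>The index type with five elements\<close>

lemma exhaust_5:
  fixes x :: 5
  shows "x = 0 \<or> x = 1 \<or> x = 2 \<or> x = 3 \<or> x = 4"
proof (induct x)
  case (of_int z)
  then have "0 \<le> z" and "z < 5" by simp_all
  then have "z = 0 \<or> z = 1 \<or> z = 2 \<or> z = 3 \<or> z = 4" by arith
  then show ?case by auto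
qed

lemma UNIV_5: "(UNIV :: 5 set) = {0, 1, 2, 3, 4}"
  using exhaust_5 by auto

lemma forall_5: "(\<forall>i::5. P i) \<longleftrightarrow> P 0 \<and> P 1 \<and> P 2 \<and> P 3 \<and> P 4"
  by (metis exhaust_5)

lemma less_5:
  "(0::5) < 1" "(0::5) < 2" "(0::5) < 3" "(0::5) < 4" "(1::5) < 2" "(1::5) < 3" "(1::5) < 4"
  "(2::5) < 3" "(2::5) < 4" "(3::5) < 4"
  by (simp_all add: less_bit1_def bit1.Rep_numeral bit1.Rep_0 bit1.Rep_1)

lemmas neq_5 = less_5[THEN less_imp_neq]

lemmas neqs_5 = neq_5 neq_5[symmetric]

lemma sum_5: "(\<Sum>i\<in>(UNIV::5 set). f i) = f 0 + f 1 + f 2 + f 3 + (f 4 :: 'a::comm_monoid_add)"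
  unfolding UNIV_5 by (simp add: add.assoc)

lemma deg_monom_5:
  "deg_monom (m :: 5 monom) = lookup m 0 + lookup m 1 + lookup m 2 + lookup m 3 + lookup m 4"
  by (simp add: deg_monom_UNIV sum_5)

lemma monom_eqI_5:
  fixes m n :: "5 monom"
  assumes "lookup m 0 = lookup n 0" "lookup m 1 = lookup n 1" "lookup m 2 = lookup n 2"
    "lookup m 3 = lookup n 3" "lookup m 4 = lookup n 4"
  shows "m = n"
proof (rule poly_mapping_eqI)
  fix i :: 5
  show "lookup m i = lookup n i" using exhaust_5[of i] assms by auto
qed

text \<open>Listing the exponents turns monomials into weak compositions of the degree.\<close>

lemma card_monoms_5: "card {m :: 5 monom. deg_monom m = d} = (d + 4) choose d"
proof -
  let ?l = "\<lambda>m :: 5 monom. [lookup m 0, lookup m 1, lookup m 2, lookup m 3, lookup m 4]"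
  have "bij_betw ?l {m. deg_monom m = d} {l. length l = 5 \<and> sum_list l = d}"
  proof (rule bij_betw_imageI)
    show "inj_on ?l {m. deg_monom m = d}"
      by (rule inj_onI) (auto intro: monom_eqI_5)
    have "l \<in> ?l ` {m. deg_monom m = d}" if "length l = 5" "sum_list l = d" for l
    proof -
      have "length l = Suc (Suc (Suc (Suc (Suc 0))))" using that(1) by simp
      then obtain a b c e g where l: "l = [a, b, c, e, g]"
        by (auto simp only: length_Suc_conv length_0_conv)
      let ?m = "single 0 a + single 1 b + single 2 c + single 3 e + single 4 g :: 5 monom"
      have "?l ?m = l" by (simp add: l lookup_add lookup_single neqs_5)
      moreover have "deg_monom ?m = d" using that(2) by (simp add: l)
      ultimately show ?thesis by (intro image_eqI[of _ _ ?m]) simp_all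
    qed
    then show "?l ` {m. deg_monom m = d} = {l. length l = 5 \<and> sum_list l = d}"
      by (auto simp: deg_monom_5)
  qed
  from bij_betw_same_card[OF this] show ?thesis
    by (simp add: card_length_sum_list add.commute)
qed

lemma finite_monoms_5: "finite {m :: 5 monom. deg_monom m = d}"
proof (rule card_ge_0_finite)
  show "0 < card {m :: 5 monom. deg_monom m = d}" by (simp add: card_monoms_5)
qed

section \<open>Polynomials as a vector space\<close>

interpretation mpv: vector_space "\<lambda>(c::'k::field) (p::('v, 'k) mpoly). Const c * p"
proof unfold_locales
  fix a b :: 'k and x y :: "('v, 'k) mpoly"
  show "Const a * (x + y) = Const a * x + Const a * y" by (rule distrib_left)
  show "Const (a + b) * x = Const a * x + Const b * x" by (simp only: Const_add distrib_right)
  show "Const a * (Const b * x) = Const (a * b) * x" by (simp only: Const_mult mult.assoc)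
  show "Const 1 * x = x" by (simp only: Const_1 mult_1_left)
qed

abbreviation monoms :: "'v monom set \<Rightarrow> ('v, 'k::field) mpoly set"
  where "monoms A \<equiv> (\<lambda>m. single m 1) ` A"

lemma in_span_monoms:
  assumes "keys p \<subseteq> A" shows "p \<in> mpv.span (monoms A)"
proof -
  have "(\<Sum>m\<in>keys p. Const (lookup p m) * single m 1) \<in> mpv.span (monoms A)"
    using assms by (intro mpv.span_sum mpv.span_scale mpv.span_base) auto
  then show ?thesis by (simp only: single_eq_Const_mult[symmetric] sum_single_keys)
qed

lemma homogeneous_in_span_monoms:
  "homogeneous d p \<Longrightarrow> p \<in> mpv.span (monoms {m. deg_monom m = d})"
  by (rule in_span_monoms) (auto simp: homogeneous_def)

lemma independent_monoms: "mpv.independent (monoms A)"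
  unfolding mpv.dependent_def
proof (safe)
  fix m assume m: "single m 1 \<in> mpv.span (monoms A - {single m 1})"
  have "lookup p m = 0" if "p \<in> mpv.span (monoms A - {single m 1})" for p
    using that
    by (induction rule: mpv.span_induct_alt)
       (auto simp: lookup_add lookup_single when_def split: if_splits)
  from this[OF m] show False by simp
qed

lemma card_monoms: "card (monoms A :: ('v, 'k::field) mpoly set) = card A"
proof (rule card_image, rule inj_onI)
  fix x y assume "(single x 1 :: ('v, 'k) mpoly) = single y 1"
  from arg_cong[OF this, of "\<lambda>p. lookup p x"] show "x = y"
    by (simp add: lookup_single when_def split: if_splits)
qed

lemma mult_in_span:
  assumes "p \<in> mpv.span X" "\<And>x. x \<in> X \<Longrightarrow> x * q \<in> mpv.span Y"
  shows "p * q \<in> mpv.span Y"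
  using assms(1)
proof (induction p rule: mpv.span_induct_alt)
  case base
  show ?case by (simp add: mpv.span_zero)
next
  case (step c x y)
  have "(Const c * x + y) * q = Const c * (x * q) + y * q"
    by (simp only: distrib_right mult.assoc)
  also have "\<dots> \<in> mpv.span Y"
    using step assms(2)[of x] by (intro mpv.span_add mpv.span_scale)
  finally show ?case .
qed

text \<open>A nonzero vector in both spans could replace some member of \<open>T\<close> in the spanning set \<open>B \<union> T\<close>; as it
  already lies in the span of \<open>B\<close>, fewer than \<open>card E\<close> vectors would then span \<open>E\<close>.\<close>

lemma (in vector_space) span_Int_trivial_by_counting:
  assumes E: "independent E" "E \<subseteq> span (B \<union> T)" and fin: "finite B" "finite T"
    and card: "card B + card T \<le> card E"
    and p: "p \<in> span B" "p \<in> span T"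
  shows "p = 0"
proof (rule ccontr)
  assume "p \<noteq> 0"
  define P where "P n \<longleftrightarrow> (\<exists>T'. T' \<subseteq> T \<and> card T' = n \<and> p \<in> span T')" for n
  have "P (card T)" using p(2) by (auto simp: P_def)
  then have "P (LEAST n. P n)" by (rule LeastI)
  then obtain T' where T': "T' \<subseteq> T" "card T' = (LEAST n. P n)" "p \<in> span T'"
    by (auto simp: P_def)
  have fin': "finite T'" using T'(1) fin(2) by (rule finite_subset)
  obtain t where t: "t \<in> T'" using \<open>p \<noteq> 0\<close> T'(3) by (cases "T' = {}") auto
  have "p \<notin> span (T' - {t})"
  proof
    assume "p \<in> span (T' - {t})"
    then have "P (card (T' - {t}))" using T'(1) unfolding P_def by blast
    then have "card T' \<le> card (T' - {t})" unfolding T'(2) by (rule Least_le)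
    then show False using card_Diff1_less[OF fin' t] by linarith
  qed
  moreover have "p \<in> span (insert t (T' - {t}))" using T'(3) t by (simp add: insert_absorb)
  ultimately have "t \<in> span (insert p (T' - {t}))" by (metis in_span_insert)
  also have "insert p (T' - {t}) \<subseteq> span (B \<union> (T - {t}))"
    using span_mono[of B "B \<union> (T - {t})"] p(1) T'(1) by (auto intro: span_base)
  then have "span (insert p (T' - {t})) \<subseteq> span (B \<union> (T - {t}))"
    by (metis span_mono span_span)
  finally have "B \<union> T \<subseteq> span (B \<union> (T - {t}))"
    by (auto intro: span_base)
  then have "E \<subseteq> span (B \<union> (T - {t}))"
    using E(2) by (metis span_mono span_span subset_trans)
  from independent_span_bound[OF _ E(1) this] fin
  have "card E \<le> card (B \<union> (T - {t}))" by simp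
  also have "\<dots> \<le> card B + card (T - {t})" by (rule card_Un_le)
  also have "\<dots> < card B + card T"
    using card_Diff1_less[OF fin(2), of t] t T'(1) by auto
  finally show False using card by simp
qed

section \<open>Standard monomials\<close>

text \<open>The last 10, 10, 5 and 1 monomials of degree 2, 3, 4 and 5 in reverse lexicographic order,
  together with everything of degree at most 1. They are described by lower bounds for the exponents
  of the small variables because such conditions pass to smaller monomials.\<close>

definition std_monom :: "5 monom \<Rightarrow> bool"
  where "std_monom m \<longleftrightarrow>
    deg_monom m \<le> 5 \<and>
    (deg_monom m = 2 \<longrightarrow> lookup m 4 \<ge> 1 \<or> lookup m 3 \<ge> 1 \<or> lookup m 2 \<ge> 2) \<and>
    (deg_monom m = 3 \<longrightarrow> lookup m 4 \<ge> 1 \<and> (lookup m 4 \<ge> 2 \<or> lookup m 3 \<ge> 1 \<or> lookup m 2 \<ge> 2)) \<and>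
    (deg_monom m = 4 \<longrightarrow> lookup m 4 \<ge> 3) \<and>
    (deg_monom m = 5 \<longrightarrow> lookup m 4 \<ge> 5)"

text \<open>Among monomials of one degree, the smaller one has the larger exponent at the last difference.
  So the lower bounds that make the larger one standard hold for the smaller one as well.\<close>

lemma std_monom_revlex_downward:
  assumes deg: "deg_monom s = deg_monom t" and less: "revlex_less s t" and std: "std_monom t"
  shows "std_monom s"
proof -
  obtain v where v: "lookup s v > lookup t v" "\<And>w. w > v \<Longrightarrow> lookup s w = lookup t w"
    using deg less by (auto simp: revlex_less_def)
  have C: "lookup s 4 > lookup t 4 \<or> lookup s 4 = lookup t 4 \<and>
      (lookup s 3 > lookup t 3 \<or> lookup s 3 = lookup t 3 \<and> lookup s 2 \<ge> lookup t 2)"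
    using exhaust_5[of v]
  proof (elim disjE)
    assume "v = 4" then show ?thesis using v(1) by simp
  next
    assume "v = 3" then show ?thesis using v less_5 by simp
  next
    assume "v = 2" then show ?thesis using v(1) v(2)[of 3] v(2)[of 4] less_5 by simp
  next
    assume "v = 1" then show ?thesis using v(2)[of 2] v(2)[of 3] v(2)[of 4] less_5 by simp
  next
    assume "v = 0" then show ?thesis using v(2)[of 2] v(2)[of 3] v(2)[of 4] less_5 by simp
  qed
  note S = std[unfolded std_monom_def, folded deg]
  have sum: "lookup s 2 + lookup s 3 + lookup s 4 \<le> deg_monom s"
    "lookup t 2 + lookup t 3 + lookup t 4 \<le> deg_monom s"
    unfolding deg_monom_5 using deg[unfolded deg_monom_5] by linarith+
  show ?thesis
    unfolding std_monom_def
  proof (intro conjI impI)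
    show "deg_monom s \<le> 5" using S by blast
  next
    assume "deg_monom s = 2"
    then show "1 \<le> lookup s 4 \<or> 1 \<le> lookup s 3 \<or> 2 \<le> lookup s 2"
      using C S by (elim disjE conjE; simp; linarith)
  next
    assume "deg_monom s = 3"
    then show "1 \<le> lookup s 4" using C S by (elim disjE conjE; simp)
  next
    assume "deg_monom s = 3"
    then show "2 \<le> lookup s 4 \<or> 1 \<le> lookup s 3 \<or> 2 \<le> lookup s 2"
      using C S sum by (elim disjE conjE; simp; linarith)
  next
    assume "deg_monom s = 4"
    then show "3 \<le> lookup s 4" using C S by (elim disjE conjE; simp)
  next
    assume "deg_monom s = 5"
    then show "5 \<le> lookup s 4" using C S by (elim disjE conjE; simp)
  qed
qed

lemma revlex_total:
  fixes s t :: "'v::{finite,linorder} monom"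
  assumes "deg_monom s = deg_monom t" "s \<noteq> t"
  shows "revlex_less s t \<or> revlex_less t s"
proof -
  let ?D = "{v. lookup s v \<noteq> lookup t v}"
  have D: "?D \<noteq> {}" using assms(2) by (auto intro: poly_mapping_eqI)
  define v where "v = Max ?D"
  have "v \<in> ?D" unfolding v_def by (rule Max_in) (use D in auto)
  moreover have "lookup s w = lookup t w" if "w > v" for w
  proof (rule ccontr)
    assume "lookup s w \<noteq> lookup t w"
    then have "w \<le> v" unfolding v_def by (intro Max_ge) auto
    then show False using that by simp
  qed
  ultimately show ?thesis
    using assms(1) by (auto simp: revlex_less_def neq_iff)
qed

lemma std_monom_less_nonstd:
  assumes "deg_monom s = deg_monom t" "std_monom s" "\<not> std_monom t"
  shows "revlex_less s t"
  using assms revlex_total[of s t] std_monom_revlex_downward[of t s] by auto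

lemma monom_split_off: "(k::nat) \<le> lookup m v \<Longrightarrow> m = single v k + (m - single v k)"
  by (rule poly_mapping_eqI) (auto simp: lookup_add lookup_minus lookup_single when_def)

lemma deg_monom_split_off: "k \<le> lookup m v \<Longrightarrow> deg_monom (m - single v k) = deg_monom m - k"
  using monom_split_off[of k m v] deg_monom_add[of "single v k" "m - single v k"] by simp

lemma monom_deg_1E:
  assumes "deg_monom m = 1" obtains i where "m = single i 1"
proof -
  from assms have "deg_monom m = Suc 0" by simp
  then obtain i n where "m = single i 1 + n" "deg_monom n = 0" by (rule deg_monom_Suc)
  then show thesis by (intro that[of i]) (simp add: deg_monom_eq_0_iff)
qed

lemma card_std_monoms:
  "card {m. deg_monom m = 2 \<and> std_monom m} \<le> 10"
  "card {m. deg_monom m = 3 \<and> std_monom m} \<le> 10"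
  "card {m. deg_monom m = 4 \<and> std_monom m} \<le> 5"
  "card {m. deg_monom m = 5 \<and> std_monom m} \<le> 1"
proof -
  let ?v = "\<lambda>i::5. single i (1::nat)"
  let ?S = "\<lambda>d. {m. deg_monom m = d \<and> std_monom m}"
  \<comment> \<open>In degree 2: the multiples of \<open>x5\<close>, the remaining multiples of \<open>x4\<close>, and \<open>x3^2\<close>.\<close>
  let ?A = "{?v 4 + ?v 0, ?v 4 + ?v 1, ?v 4 + ?v 2, ?v 4 + ?v 3, ?v 4 + ?v 4}"
  let ?B = "{?v 3 + ?v 0, ?v 3 + ?v 1, ?v 3 + ?v 2, ?v 3 + ?v 3}"
  have sub: "?S 2 \<subseteq> ?A \<union> ?B \<union> {single 2 2}"
  proof
    fix m assume "m \<in> ?S 2"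
    then have m: "deg_monom m = 2" "1 \<le> lookup m 4 \<or> 1 \<le> lookup m 3 \<or> 2 \<le> lookup m 2"
      by (simp_all add: std_monom_def)
    from m(2) show "m \<in> ?A \<union> ?B \<union> {single 2 2}"
    proof (elim disjE)
      assume 4: "1 \<le> lookup m 4"
      with m have "deg_monom (m - ?v 4) = 1" by (simp add: deg_monom_split_off)
      then obtain j where "m - ?v 4 = ?v j" by (rule monom_deg_1E)
      with monom_split_off[OF 4] have "m = ?v 4 + ?v j" by simp
      then show ?thesis using exhaust_5[of j] by (elim disjE) simp_all
    next
      assume 3: "1 \<le> lookup m 3"
      with m have "deg_monom (m - ?v 3) = 1" by (simp add: deg_monom_split_off)
      then obtain j where "m - ?v 3 = ?v j" by (rule monom_deg_1E)
      with monom_split_off[OF 3] have "m = ?v 3 + ?v j" by simp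
      then show ?thesis using exhaust_5[of j] add.commute[of "?v 3" "?v 4"] by (elim disjE) simp_all
    next
      assume 2: "2 \<le> lookup m 2"
      with m have "m - single 2 2 = 0" by (simp add: deg_monom_split_off flip: deg_monom_eq_0_iff)
      with monom_split_off[OF 2] have "m = single 2 2" by simp
      then show ?thesis by simp
    qed
  qed
  have "card ?A \<le> 5" "card ?B \<le> 4" by (simp_all add: card_insert_le_m1)
  then have "card (?A \<union> ?B \<union> {single 2 2}) \<le> 10"
    using card_Un_le[of ?A ?B] card_Un_le[of "?A \<union> ?B" "{single 2 2}"] by simp
  then show 2: "card (?S 2) \<le> 10"
    using card_mono[OF _ sub] by simp
  have "?S 3 \<subseteq> (\<lambda>n. ?v 4 + n) ` ?S 2"
  proof
    fix m assume "m \<in> ?S 3"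
    then have m: "deg_monom m = 3" "1 \<le> lookup m 4"
        "2 \<le> lookup m 4 \<or> 1 \<le> lookup m 3 \<or> 2 \<le> lookup m 2"
      by (simp_all add: std_monom_def)
    then have "m - ?v 4 \<in> ?S 2"
      by (auto simp: std_monom_def deg_monom_split_off lookup_minus lookup_single)
    then show "m \<in> (\<lambda>n. ?v 4 + n) ` ?S 2" using monom_split_off[OF m(2)] by blast
  qed
  moreover have "finite (?S 2)" by (rule finite_subset[OF _ finite_monoms_5[of 2]]) auto
  ultimately have "card (?S 3) \<le> card (?S 2)" by (rule surj_card_le[rotated])
  then show "card (?S 3) \<le> 10" using 2 by simp
  have "?S 4 \<subseteq> (\<lambda>i. single 4 3 + ?v i) ` UNIV"
  proof
    fix m assume "m \<in> ?S 4"
    then have m: "deg_monom m = 4" "3 \<le> lookup m 4" by (simp_all add: std_monom_def)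
    then have "deg_monom (m - single 4 3) = 1" by (simp add: deg_monom_split_off)
    then obtain j where "m - single 4 3 = ?v j" by (rule monom_deg_1E)
    with monom_split_off[OF m(2)] show "m \<in> (\<lambda>i. single 4 3 + ?v i) ` UNIV" by auto
  qed
  then have "card (?S 4) \<le> card (UNIV :: 5 set)" by (rule surj_card_le[rotated]) simp
  then show "card (?S 4) \<le> 5" by simp
  have "?S 5 \<subseteq> {single 4 5}"
  proof
    fix m assume "m \<in> ?S 5"
    then have m: "deg_monom m = 5" "5 \<le> lookup m 4" by (simp_all add: std_monom_def)
    then have "m - single 4 5 = 0" by (simp add: deg_monom_split_off flip: deg_monom_eq_0_iff)
    with monom_split_off[OF m(2)] show "m \<in> {single 4 5}" by simp
  qed
  then have "card (?S 5) \<le> card {single (4::5) (5::nat)}" by (rule card_mono[rotated]) simp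
  then show "card (?S 5) \<le> 1" by simp
qed

section \<open>The monomial ideal\<close>

definition J_gens :: "(5, 'k::comm_ring_1) mpoly set"
  where "J_gens =
    {x1^2, x1*x2, x2^2, x1*x3, x2*x3, x3^3, x3^2*x4, x1*x4^2, x2*x4^2, x3*x4^2, x4^3,
     x3^2*x5^2, x1*x4*x5^2, x2*x4*x5^2, x3*x4*x5^2, x4^2*x5^2,
     x5^4*x1, x5^4*x2, x5^4*x3, x5^4*x4, x5^6}"

definition power_product :: "nat \<Rightarrow> nat \<Rightarrow> nat \<Rightarrow> nat \<Rightarrow> nat \<Rightarrow> (5, 'k::comm_ring_1) mpoly"
  where "power_product a b c d e = x1^a * x2^b * x3^c * x4^d * x5^e"

definition power_exps :: "nat \<Rightarrow> nat \<Rightarrow> nat \<Rightarrow> nat \<Rightarrow> nat \<Rightarrow> 5 monom"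
  where "power_exps a b c d e = single 0 a + single 1 b + single 2 c + single 3 d + single 4 e"

lemma power_product_eq_single: "power_product a b c d e = single (power_exps a b c d e) 1"
  by (simp add: power_product_def power_exps_def Var_power mult_single)

lemma lookup_power_exps [simp]:
  "lookup (power_exps a b c d e) 0 = a" "lookup (power_exps a b c d e) 1 = b"
  "lookup (power_exps a b c d e) 2 = c" "lookup (power_exps a b c d e) 3 = d"
  "lookup (power_exps a b c d e) 4 = e"
  by (simp_all add: power_exps_def lookup_add lookup_single)

lemma deg_power_exps [simp]: "deg_monom (power_exps a b c d e) = a + b + c + d + e"
  by (simp add: deg_monom_5)

lemma monom_eq_power_exps:
  "m = power_exps (lookup m 0) (lookup m 1) (lookup m 2) (lookup m 3) (lookup m 4)"
  by (rule monom_eqI_5) simp_all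

lemma J_gens_eq_power_products:
  "(J_gens :: (5, 'k::comm_ring_1) mpoly set) = {power_product 2 0 0 0 0, power_product 1 1 0 0 0, power_product 0 2 0 0 0, power_product 1 0 1 0 0,
    power_product 0 1 1 0 0, power_product 0 0 3 0 0, power_product 0 0 2 1 0, power_product 1 0 0 2 0,
    power_product 0 1 0 2 0, power_product 0 0 1 2 0, power_product 0 0 0 3 0, power_product 0 0 2 0 2,
    power_product 1 0 0 1 2, power_product 0 1 0 1 2, power_product 0 0 1 1 2, power_product 0 0 0 2 2,
    power_product 1 0 0 0 4, power_product 0 1 0 0 4, power_product 0 0 1 0 4, power_product 0 0 0 1 4,
    power_product 0 0 0 0 6}"
  by (simp add: J_gens_def power_product_def mult.commute[of "x5 ^ 4"])

lemma J_gens_nonstd: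
  assumes "g \<in> J_gens"
  obtains m where "g = single m 1" "\<not> std_monom m" "2 \<le> deg_monom m" "deg_monom m \<le> 6"
proof -
  have "\<exists>a b c d e. g = power_product a b c d e \<and> \<not> std_monom (power_exps a b c d e) \<and>
      2 \<le> a + b + c + d + e \<and> a + b + c + d + e \<le> 6"
    using assms unfolding J_gens_eq_power_products insert_iff empty_iff
    by (elim disjE FalseE) (rule exI, rule exI, rule exI, rule exI, rule exI, rule conjI, assumption, simp add: std_monom_def)+
  then show thesis
    using that unfolding power_product_eq_single deg_power_exps[symmetric] by blast
qed

lemma power_product_in_J:
  assumes "power_product a' b' c' d' e' \<in> (J_gens :: (5, 'k::comm_ring_1) mpoly set)" "a' \<le> a" "b' \<le> b" "c' \<le> c" "d' \<le> d" "e' \<le> e"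
  shows "power_product a b c d e \<in> ideal.span (J_gens :: (5, 'k) mpoly set)"
proof -
  have "power_product a' b' c' d' e' dvd (power_product a b c d e :: (5, 'k) mpoly)"
    unfolding power_product_def using assms(2-) by (intro mult_dvd_mono le_imp_power_dvd)
  then obtain q :: "(5, 'k) mpoly"
    where "power_product a b c d e = power_product a' b' c' d' e' * q" by (rule dvdE)
  then show ?thesis using ideal_mult_right[OF ideal.span_base[OF assms(1)], of q] by simp
qed

text \<open>If no generator divides a monomial, then its part in \<open>x1, x2, x3\<close> has degree at most 1 or is
  \<open>x3^2\<close>. In each case the remaining generators bound the exponents of \<open>x4\<close> and \<open>x5\<close>, and the few
  monomials that are left are standard.\<close>

lemma nonstd_in_J:
  assumes "\<not> std_monom m"
  shows "single m 1 \<in> ideal.span (J_gens :: (5, 'k::comm_ring_1) mpoly set)"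
proof (rule ccontr)
  assume nJ: "single m 1 \<notin> ideal.span (J_gens :: (5, 'k) mpoly set)"
  define a b c d e where abcde: "a = lookup m 0" "b = lookup m 1" "c = lookup m 2" "d = lookup m 3" "e = lookup m 4"
  have nJ': "power_product a b c d e \<notin> ideal.span (J_gens :: (5, 'k) mpoly set)"
    using nJ monom_eq_power_exps[of m] by (simp add: power_product_eq_single abcde)
  have no: "\<not> (a' \<le> a \<and> b' \<le> b \<and> c' \<le> c \<and> d' \<le> d \<and> e' \<le> e)"
    if "power_product a' b' c' d' e' \<in> (J_gens :: (5, 'k) mpoly set)" for a' b' c' d' e'
    using nJ' power_product_in_J[OF that] by blast
  have mem: "power_product 2 0 0 0 0 \<in> (J_gens :: (5, 'k) mpoly set)"
    "power_product 1 1 0 0 0 \<in> (J_gens :: (5, 'k) mpoly set)"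
    "power_product 0 2 0 0 0 \<in> (J_gens :: (5, 'k) mpoly set)"
    "power_product 1 0 1 0 0 \<in> (J_gens :: (5, 'k) mpoly set)"
    "power_product 0 1 1 0 0 \<in> (J_gens :: (5, 'k) mpoly set)"
    "power_product 0 0 3 0 0 \<in> (J_gens :: (5, 'k) mpoly set)"
    "power_product 0 0 2 1 0 \<in> (J_gens :: (5, 'k) mpoly set)"
    "power_product 1 0 0 2 0 \<in> (J_gens :: (5, 'k) mpoly set)"
    "power_product 0 1 0 2 0 \<in> (J_gens :: (5, 'k) mpoly set)"
    "power_product 0 0 1 2 0 \<in> (J_gens :: (5, 'k) mpoly set)"
    "power_product 0 0 0 3 0 \<in> (J_gens :: (5, 'k) mpoly set)"
    "power_product 0 0 2 0 2 \<in> (J_gens :: (5, 'k) mpoly set)"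
    "power_product 1 0 0 1 2 \<in> (J_gens :: (5, 'k) mpoly set)"
    "power_product 0 1 0 1 2 \<in> (J_gens :: (5, 'k) mpoly set)"
    "power_product 0 0 1 1 2 \<in> (J_gens :: (5, 'k) mpoly set)"
    "power_product 0 0 0 2 2 \<in> (J_gens :: (5, 'k) mpoly set)"
    "power_product 1 0 0 0 4 \<in> (J_gens :: (5, 'k) mpoly set)"
    "power_product 0 1 0 0 4 \<in> (J_gens :: (5, 'k) mpoly set)"
    "power_product 0 0 1 0 4 \<in> (J_gens :: (5, 'k) mpoly set)"
    "power_product 0 0 0 1 4 \<in> (J_gens :: (5, 'k) mpoly set)"
    "power_product 0 0 0 0 6 \<in> (J_gens :: (5, 'k) mpoly set)"
    by (simp_all only: J_gens_eq_power_products insert_iff simp_thms)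
  note n = mem[THEN no, simplified le0 simp_thms]
  have deg: "deg_monom m = a + b + c + d + e" by (simp add: deg_monom_5 abcde)
  have "a = 0 \<or> a = 1" using n(1) by linarith
  moreover have "b = 0 \<or> b = 1" using n(3) by linarith
  moreover have "c = 0 \<or> c = 1 \<or> c = 2" using n(6) by linarith
  ultimately consider "a + b + c = 0" | "a + b + c = 1" | "a = 0" "b = 0" "c = 2"
    using n(2,4,5) by (elim disjE) simp_all
  then have "std_monom m"
    unfolding std_monom_def deg abcde(3-5)[symmetric]
  proof cases
    case 1
    have "d = 0 \<or> d = 1 \<or> d = 2" using n(11) by linarith
    then have "d = 0 \<and> e \<le> 5 \<or> d = 1 \<and> e \<le> 3 \<or> d = 2 \<and> e \<le> 1"
      using n(16,20,21) by (elim disjE) simp_all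
    then show "a + b + c + d + e \<le> 5 \<and>
      (a + b + c + d + e = 2 \<longrightarrow> 1 \<le> e \<or> 1 \<le> d \<or> 2 \<le> c) \<and>
      (a + b + c + d + e = 3 \<longrightarrow> 1 \<le> e \<and> (2 \<le> e \<or> 1 \<le> d \<or> 2 \<le> c)) \<and>
      (a + b + c + d + e = 4 \<longrightarrow> 3 \<le> e) \<and> (a + b + c + d + e = 5 \<longrightarrow> 5 \<le> e)" unfolding 1 by (elim disjE conjE) (intro conjI impI; simp)+
  next
    case 2
    then have "a = 1 \<or> b = 1 \<or> c = 1" by linarith
    then have "\<not> 2 \<le> d" "\<not> (1 \<le> d \<and> 2 \<le> e)" "\<not> 4 \<le> e"
      using n(8-10,13-15,17-19) by (elim disjE; simp)+
    then have "d = 0 \<and> e \<le> 3 \<or> d = 1 \<and> e \<le> 1" by (cases "d = 0") simp_all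
    then show "a + b + c + d + e \<le> 5 \<and>
      (a + b + c + d + e = 2 \<longrightarrow> 1 \<le> e \<or> 1 \<le> d \<or> 2 \<le> c) \<and>
      (a + b + c + d + e = 3 \<longrightarrow> 1 \<le> e \<and> (2 \<le> e \<or> 1 \<le> d \<or> 2 \<le> c)) \<and>
      (a + b + c + d + e = 4 \<longrightarrow> 3 \<le> e) \<and> (a + b + c + d + e = 5 \<longrightarrow> 5 \<le> e)" unfolding 2 by (elim disjE conjE) (intro conjI impI; simp)+
  next
    case 3
    then have "d = 0" "e \<le> 1" using n(7,12) by simp_all
    then show "a + b + c + d + e \<le> 5 \<and>
      (a + b + c + d + e = 2 \<longrightarrow> 1 \<le> e \<or> 1 \<le> d \<or> 2 \<le> c) \<and>
      (a + b + c + d + e = 3 \<longrightarrow> 1 \<le> e \<and> (2 \<le> e \<or> 1 \<le> d \<or> 2 \<le> c)) \<and>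
      (a + b + c + d + e = 4 \<longrightarrow> 3 \<le> e) \<and> (a + b + c + d + e = 5 \<longrightarrow> 5 \<le> e)" unfolding 3 by (intro conjI impI) simp_all
  qed
  with assms show False by contradiction
qed

section \<open>A criterion for the initial ideal\<close>

text \<open>The standard monomials span the quotient by \<open>I\<close> in the degrees from 2 to 6, which are the degrees
  of the generators of \<open>J\<close>. As no monomial of degree 6 is standard, this includes that \<open>I\<close> contains
  all forms of degree 6.\<close>

definition std_spanning :: "(5, 'k::field) mpoly set \<Rightarrow> bool"
  where "std_spanning I \<longleftrightarrow> (\<forall>d p. 2 \<le> d \<and> d \<le> 6 \<and> homogeneous d p \<longrightarrow>
    (\<exists>q. homogeneous d q \<and> (\<forall>m\<in>keys q. std_monom m) \<and> p - q \<in> I))"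

abbreviation std_monoms :: "nat \<Rightarrow> (5, 'k::field) mpoly set"
  where "std_monoms d \<equiv> monoms {m. deg_monom m = d \<and> std_monom m}"

definition set_prod :: "'a::times set \<Rightarrow> 'a set \<Rightarrow> 'a set"
  where "set_prod X Y = (\<lambda>(x, y). x * y) ` (X \<times> Y)"

lemma set_prodI: "x \<in> X \<Longrightarrow> y \<in> Y \<Longrightarrow> x * y \<in> set_prod X Y"
  by (auto simp: set_prod_def)

lemma finite_set_prod: "finite X \<Longrightarrow> finite Y \<Longrightarrow> finite (set_prod X Y)"
  by (simp add: set_prod_def)

lemma card_set_prod: "finite X \<Longrightarrow> finite Y \<Longrightarrow> card (set_prod X Y) \<le> card X * card Y"
  unfolding set_prod_def by (metis card_cartesian_product card_image_le finite_cartesian_product)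

lemma set_prod_Un: "set_prod (X \<union> Y) Z = set_prod X Z \<union> set_prod Y Z"
  by (auto simp: set_prod_def)

lemma set_prod_assoc: "set_prod (set_prod X Y) Z = set_prod X (set_prod Y (Z :: 'a::semigroup_mult set))"
  by (force simp: set_prod_def mult.assoc image_iff)

text \<open>Commutativity halves the off-diagonal products. This is how the Koszul relations between the
  generators enter the dimension count below.\<close>

lemma card_products_of_pairs:
  fixes f :: "5 \<Rightarrow> 'a::comm_ring_1"
  shows "card (set_prod (range f) (range f)) \<le> 15"
proof -
  let ?L = "[f 0 * f 0, f 0 * f 1, f 0 * f 2, f 0 * f 3, f 0 * f 4, f 1 * f 1, f 1 * f 2, f 1 * f 3,
     f 1 * f 4, f 2 * f 2, f 2 * f 3, f 2 * f 4, f 3 * f 3, f 3 * f 4, f 4 * f 4]"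
  have *: "f i * f j \<in> set ?L" for i j
    using exhaust_5[of i] exhaust_5[of j]
    by (elim disjE; hypsubst; simp only: list.set insert_iff mult.commute simp_thms)
  have "set_prod (range f) (range f) \<subseteq> set ?L"
  proof (intro subsetI)
    fix z assume "z \<in> set_prod (range f) (range f)"
    then obtain i j where "z = f i * f j" by (auto simp: set_prod_def)
    then show "z \<in> set ?L" using *[of i j] by (simp only:)
  qed
  then have "card (set_prod (range f) (range f)) \<le> card (set ?L)"
    by (rule card_mono[rotated]) (rule List.finite_set)
  also have "\<dots> \<le> length ?L" by (rule card_length)
  finally show ?thesis by simp
qed

lemma ideal_form_in_span:
  fixes f :: "5 \<Rightarrow> (5, 'k::field) mpoly"
  assumes f: "\<And>i. homogeneous 2 (f i)"
    and X: "\<And>h. homogeneous d h \<Longrightarrow> h \<in> mpv.span X"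
    and p: "p \<in> ideal.span (range f)" "homogeneous e p" "e = d + 2"
  shows "p \<in> mpv.span (set_prod X (range f))"
proof -
  obtain h where h: "\<And>i. homogeneous d (h i)" "p = (\<Sum>i\<in>UNIV. h i * f i)"
    using homogeneous_in_ideal_span_range[OF f p(1) p(2)[unfolded p(3)]] by blast
  have "h i * f i \<in> mpv.span (set_prod X (range f))" for i
    using X[OF h(1)] by (rule mult_in_span) (auto intro: mpv.span_base set_prodI)
  then show ?thesis unfolding h(2) by (intro mpv.span_sum)
qed

lemma std_spanning_form_in_span:
  assumes "std_spanning I" "2 \<le> d" "d \<le> 6" "homogeneous d p"
    and B: "\<And>p. p \<in> I \<Longrightarrow> homogeneous d p \<Longrightarrow> p \<in> mpv.span B"
  shows "p \<in> mpv.span (std_monoms d \<union> B)"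
proof -
  obtain q where q: "homogeneous d q" "\<forall>m\<in>keys q. std_monom m" "p - q \<in> I"
    using assms(1-4) unfolding std_spanning_def by blast
  have "q \<in> mpv.span (std_monoms d)"
    using q by (intro in_span_monoms) (auto simp: homogeneous_def)
  moreover have "p - q \<in> mpv.span B"
    using B[OF q(3)] homogeneous_diff[OF assms(4) q(1)] by blast
  ultimately have "q + (p - q) \<in> mpv.span (std_monoms d \<union> B)"
    by (intro mpv.span_add) (auto intro: subsetD[OF mpv.span_mono, rotated])
  then show ?thesis by simp
qed

text \<open>The standard monomials complete a spanning set of the degree \<open>d\<close> part of the ideal to one of
  all forms of degree \<open>d\<close>. If the sizes add up to the dimension of the latter, the sum is direct.\<close>

lemma std_Int_ideal_by_counting:
  fixes I :: "(5, 'k::field) mpoly set"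
  assumes "std_spanning I" "2 \<le> d" "d \<le> 6"
    and B: "\<And>p. p \<in> I \<Longrightarrow> homogeneous d p \<Longrightarrow> p \<in> mpv.span B" "finite B"
    and card: "card B + card {m. deg_monom m = d \<and> std_monom m} \<le> (d + 4) choose d"
    and p: "p \<in> I" "homogeneous d p" "\<forall>m\<in>keys p. std_monom m"
  shows "p = 0"
proof (rule mpv.span_Int_trivial_by_counting)
  show "mpv.independent (monoms {m. deg_monom m = d})" by (rule independent_monoms)
  show "monoms {m. deg_monom m = d} \<subseteq> mpv.span (B \<union> std_monoms d)"
    using std_spanning_form_in_span[OF assms(1-3) _ B(1)]
    by (auto simp: Un_commute intro: homogeneous_single)
  show "finite B" by fact
  have "finite {m. deg_monom m = d \<and> std_monom m}"
    by (rule finite_subset[OF _ finite_monoms_5[of d]]) auto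
  then show "finite (std_monoms d)" by simp
  show "card B + card (std_monoms d :: (5, 'k) mpoly set) \<le> card (monoms {m. deg_monom m = d} :: (5, 'k) mpoly set)"
    using card by (simp add: card_monoms card_monoms_5)
  show "p \<in> mpv.span B" using B p by blast
  show "p \<in> mpv.span (std_monoms d)"
    using p by (intro in_span_monoms) (auto simp: homogeneous_def)
qed

text \<open>It remains to bound the dimension of the ideal \<open>I\<close> by 5, 25, 65 and 125 in the degrees 2, 3, 4
  and 5. A spanning set in degree \<open>d + 2\<close> arises by multiplying the five generators with a spanning
  set of the forms of degree \<open>d\<close>. For \<open>d = 2\<close> and \<open>d = 3\<close> the latter consists of 10 standard monomials
  and of members of \<open>I\<close>. The standard monomials contribute 50 products. The members of \<open>I\<close> contribute
  the 15 products of two generators, for \<open>d = 3\<close> multiplied with the 5 variables.\<close>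

lemma std_Int_ideal_trivial:
  fixes f :: "5 \<Rightarrow> (5, 'k::field) mpoly"
  assumes f: "\<And>i. homogeneous 2 (f i)" and S: "std_spanning (ideal.span (range f))"
    and p: "p \<in> ideal.span (range f)" "homogeneous d p" "\<forall>m\<in>keys p. std_monom m"
  shows "p = 0"
proof -
  let ?I = "ideal.span (range f)" and ?R = "range f"
  define X0 X1 :: "(5, 'k) mpoly set"
    where "X0 = monoms {m. deg_monom m = 0}" and "X1 = monoms {m. deg_monom m = 1}"
  define B2 B3 where "B2 = set_prod X0 ?R" and "B3 = set_prod X1 ?R"
  define B4 B5 where "B4 = set_prod (std_monoms 2 \<union> B2) ?R" and "B5 = set_prod (std_monoms 3 \<union> B3) ?R"
  have X0: "h \<in> mpv.span X0" if "homogeneous 0 h" for h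
    using homogeneous_in_span_monoms[OF that] by (simp add: X0_def)
  have X1: "h \<in> mpv.span X1" if "homogeneous 1 h" for h
    using homogeneous_in_span_monoms[OF that] by (simp add: X1_def)
  have B2: "p \<in> mpv.span B2" if "p \<in> ?I" "homogeneous 2 p" for p
    unfolding B2_def
    by (rule ideal_form_in_span[where e = 2, OF f X0]) (use that in simp_all)
  have B3: "p \<in> mpv.span B3" if "p \<in> ?I" "homogeneous 3 p" for p
    unfolding B3_def
    by (rule ideal_form_in_span[where e = 3, OF f X1]) (use that in simp_all)
  have B4: "p \<in> mpv.span B4" if "p \<in> ?I" "homogeneous 4 p" for p
    unfolding B4_def
    by (rule ideal_form_in_span[where e = 4, OF f std_spanning_form_in_span[OF S _ _ _ B2]]) (use that in simp_all)
  have B5: "p \<in> mpv.span B5" if "p \<in> ?I" "homogeneous 5 p" for p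
    unfolding B5_def
    by (rule ideal_form_in_span[where e = 5, OF f std_spanning_form_in_span[OF S _ _ _ B3]]) (use that in simp_all)
  have finR: "finite ?R" by simp
  have finT: "finite (std_monoms d :: (5, 'k) mpoly set)" for d
    by (rule finite_imageI, rule finite_subset[OF _ finite_monoms_5[of d]]) auto
  have finX: "finite X0" "finite X1" by (simp_all add: X0_def X1_def finite_monoms_5 del: One_nat_def)
  note fin = finR finT finX finite_set_prod finite_UnI
  have cR: "card ?R \<le> 5" using card_image_le[of "UNIV :: 5 set" f] by simp
  have cX: "card X0 = 1" "card X1 = 5" by (simp_all only: X0_def X1_def card_monoms card_monoms_5) simp_all
  have cT: "card (std_monoms 2 :: (5, 'k) mpoly set) \<le> 10" "card (std_monoms 3 :: (5, 'k) mpoly set) \<le> 10"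
    by (simp_all only: card_monoms card_std_monoms)
  have c2: "card B2 \<le> 5"
    using card_set_prod[OF finX(1) finR] cR unfolding B2_def cX by linarith
  have c3: "card B3 \<le> 25"
    using card_set_prod[OF finX(2) finR] cR unfolding B3_def cX by linarith
  have T: "card (set_prod (std_monoms d :: (5, 'k) mpoly set) ?R) \<le> 50"
    if "card (std_monoms d :: (5, 'k) mpoly set) \<le> 10" for d
    using le_trans[OF card_set_prod[OF finT finR] mult_le_mono[OF that cR]] by simp
  have RR: "card (set_prod X (set_prod ?R ?R)) \<le> card X * 15" if "finite X" for X
    using le_trans[OF card_set_prod[OF that finite_set_prod[OF finR finR]]
        mult_le_mono[OF order_refl card_products_of_pairs[of f]]] .
  have "card B4 \<le> card (set_prod (std_monoms 2) ?R) + card (set_prod X0 (set_prod ?R ?R))"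
    unfolding B4_def B2_def set_prod_Un set_prod_assoc by (rule card_Un_le)
  then have c4: "card B4 \<le> 65"
    using T[OF cT(1)] RR[OF finX(1)] unfolding cX by linarith
  have "card B5 \<le> card (set_prod (std_monoms 3) ?R) + card (set_prod X1 (set_prod ?R ?R))"
    unfolding B5_def B3_def set_prod_Un set_prod_assoc by (rule card_Un_le)
  then have c5: "card B5 \<le> 125"
    using T[OF cT(2)] RR[OF finX(2)] unfolding cX by linarith
  have finB: "finite B2" "finite B3" "finite B4" "finite B5"
    unfolding B2_def B3_def B4_def B5_def by (intro fin)+
  have binom: "(6::nat) choose 2 = 15" "(7::nat) choose 3 = 35" "(8::nat) choose 4 = 70" "(9::nat) choose 5 = 126"
    by (simp_all add: eval_nat_numeral)
  consider "d < 2" | "d = 2" | "d = 3" | "d = 4" | "d = 5" | "d \<ge> 6" by linarith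
  then show ?thesis
  proof cases
    case 1
    then show ?thesis using homogeneous_in_ideal_small[OF f p(1,2)] by blast
  next
    case 2
    show ?thesis
      by (rule std_Int_ideal_by_counting[OF S, of 2 B2])
        (use B2 finB c2 card_std_monoms p binom 2 in simp_all)
  next
    case 3
    show ?thesis
      by (rule std_Int_ideal_by_counting[OF S, of 3 B3])
        (use B3 finB c3 card_std_monoms p binom 3 in simp_all)
  next
    case 4
    show ?thesis
      by (rule std_Int_ideal_by_counting[OF S, of 4 B4])
        (use B4 finB c4 card_std_monoms p binom 4 in simp_all)
  next
    case 5
    show ?thesis
      by (rule std_Int_ideal_by_counting[OF S, of 5 B5])
        (use B5 finB c5 card_std_monoms p binom 5 in simp_all)
  next
    case 6
    have "m \<notin> keys p" for m
      using p(2,3) 6 by (auto simp: homogeneous_def std_monom_def)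
    then have "lookup p m = 0" for m by (simp add: in_keys_iff)
    then show ?thesis by (intro poly_mapping_eqI) simp
  qed
qed

text \<open>A generator of \<open>J\<close> minus its standard representative lies in the ideal, and the generator is its
  initial monomial since standard monomials are smaller. Conversely, an element of the ideal with
  a standard initial monomial would have a leading form with standard monomials only.\<close>

lemma initial_ideal_eq_J:
  fixes f :: "5 \<Rightarrow> (5, 'k::field) mpoly"
  assumes f: "\<And>i. homogeneous 2 (f i)" and S: "std_spanning (ideal.span (range f))"
  shows "initial_ideal (ideal.span (range f)) = ideal.span J_gens"
proof -
  let ?I = "ideal.span (range f)"
  let ?M = "{single m (1::'k) | m. \<exists>p\<in>?I. is_initial_monom p m}"
  have "J_gens \<subseteq> ?M"
  proof
    fix g :: "(5, 'k) mpoly" assume "g \<in> J_gens"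
    then obtain m where m: "g = single m 1" "\<not> std_monom m" "2 \<le> deg_monom m" "deg_monom m \<le> 6"
      by (rule J_gens_nonstd)
    have "homogeneous (deg_monom m) g" unfolding m(1) by (simp add: homogeneous_single)
    then obtain q where q: "homogeneous (deg_monom m) q" "\<forall>m\<in>keys q. std_monom m" "g - q \<in> ?I"
      using S m(3,4) unfolding std_spanning_def by blast
    have keys: "m' = m \<or> m' \<in> keys q" if "m' \<in> keys (g - q)" for m'
      using that unfolding m(1) by (auto simp: in_keys_iff lookup_minus lookup_single when_def split: if_splits)
    have "m \<notin> keys q" using q(2) m(2) by blast
    then have "lookup (g - q) m = 1" unfolding m(1) by (simp add: lookup_minus in_keys_iff)
    then have "m \<in> keys (g - q)" by (simp add: in_keys_iff)
    moreover have "revlex_less m' m" if "m' \<in> keys (g - q)" "m' \<noteq> m" for m'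
      using keys[OF that(1)] that(2) q(1,2) m(2)
      by (intro std_monom_less_nonstd) (auto simp: homogeneous_def)
    ultimately have "is_initial_monom (g - q) m" by (auto simp: is_initial_monom_def)
    then show "g \<in> ?M" using q(3) m(1) by blast
  qed
  then have 1: "ideal.span J_gens \<subseteq> ideal.span ?M" by (rule ideal.span_mono)
  have "?M \<subseteq> ideal.span J_gens"
  proof safe
    fix p m assume p: "p \<in> ?I" "is_initial_monom p m"
    let ?d = "deg_monom m"
    have "\<not> std_monom m"
    proof
      assume std: "std_monom m"
      have "hom_comp ?d p = 0"
      proof (rule std_Int_ideal_trivial[OF f S _ homogeneous_hom_comp])
        show "hom_comp ?d p \<in> ?I" by (rule hom_comp_in_ideal[OF _ p(1)]) (use f in blast)
        show "\<forall>m'\<in>keys (hom_comp ?d p). std_monom m'"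
        proof
          fix m' assume "m' \<in> keys (hom_comp ?d p)"
          then have m': "deg_monom m' = ?d" "m' \<in> keys p"
            by (auto simp: in_keys_iff lookup_hom_comp split: if_splits)
          then show "std_monom m'"
            using p(2) std std_monom_revlex_downward[of m' m]
            by (cases "m' = m") (auto simp: is_initial_monom_def)
        qed
      qed
      then have "lookup (hom_comp ?d p) m = 0" by simp
      then show False using p(2) by (simp add: lookup_hom_comp is_initial_monom_def in_keys_iff)
    qed
    then show "single m 1 \<in> ideal.span J_gens" by (rule nonstd_in_J)
  qed
  then have 2: "ideal.span ?M \<subseteq> ideal.span J_gens"
    by (intro ideal.span_minimal ideal.subspace_span)
  show ?thesis unfolding initial_ideal_def using 1 2 by (rule equalityI[rotated])
qed

section \<open>Polynomial functions\<close>

text \<open>Regular functions on a space of points with coordinates: the Zariski open sets are the unions of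
  their nonvanishing sets.\<close>

definition poly_fun :: "('x \<Rightarrow> 'i \<Rightarrow> 'k::comm_ring_1) \<Rightarrow> ('x \<Rightarrow> 'k) \<Rightarrow> bool"
  where "poly_fun coord g \<longleftrightarrow> (\<exists>p. \<forall>x. g x = eval_mpoly (\<lambda>c. c) (coord x) p)"

lemma poly_fun_const: "poly_fun coord (\<lambda>x. c)"
  unfolding poly_fun_def by (intro exI[of _ "Const c"]) (simp add: eval_mpoly_Const[OF ring_map_id])

lemma poly_fun_coord: "poly_fun coord (\<lambda>x. coord x i)"
  unfolding poly_fun_def by (intro exI[of _ "Var i"]) (simp add: eval_mpoly_Var[OF ring_map_id])

lemma poly_fun_add:
  assumes "poly_fun coord g" "poly_fun coord h" shows "poly_fun coord (\<lambda>x. g x + h x)"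
proof -
  obtain p q where "\<forall>x. g x = eval_mpoly (\<lambda>c. c) (coord x) p" "\<forall>x. h x = eval_mpoly (\<lambda>c. c) (coord x) q"
    using assms unfolding poly_fun_def by blast
  then show ?thesis
    unfolding poly_fun_def by (intro exI[of _ "p + q"]) (simp add: eval_mpoly_add[OF ring_map_id])
qed

lemma poly_fun_mult:
  assumes "poly_fun coord g" "poly_fun coord h" shows "poly_fun coord (\<lambda>x. g x * h x)"
proof -
  obtain p q where "\<forall>x. g x = eval_mpoly (\<lambda>c. c) (coord x) p" "\<forall>x. h x = eval_mpoly (\<lambda>c. c) (coord x) q"
    using assms unfolding poly_fun_def by blast
  then show ?thesis
    unfolding poly_fun_def by (intro exI[of _ "p * q"]) (simp add: eval_mpoly_mult[OF ring_map_id])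
qed

lemma poly_fun_diff:
  assumes "poly_fun coord g" "poly_fun coord h" shows "poly_fun coord (\<lambda>x. g x - h x)"
  using poly_fun_add[OF assms(1) poly_fun_mult[OF poly_fun_const[of coord "- 1"] assms(2)]] by simp

lemma poly_fun_sum:
  "(\<And>i. i \<in> A \<Longrightarrow> poly_fun coord (g i)) \<Longrightarrow> poly_fun coord (\<lambda>x. \<Sum>i\<in>A. g i x)"
  by (induction A rule: infinite_finite_induct) (auto intro: poly_fun_const poly_fun_add)

lemma poly_fun_power: "poly_fun coord g \<Longrightarrow> poly_fun coord (\<lambda>x. g x ^ n)"
  by (induction n) (auto intro: poly_fun_const poly_fun_mult)

lemma zariski_open_nonvanishing:
  assumes "poly_fun coord g" shows "zariski_open_in coord X {x \<in> X. g x \<noteq> 0}"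
proof -
  obtain p where "\<forall>x. g x = eval_mpoly (\<lambda>c. c) (coord x) p"
    using assms unfolding poly_fun_def by blast
  then show ?thesis unfolding zariski_open_in_def by (intro exI[of _ "{p}"]) simp
qed

lemma zariski_open_nonvanishingE:
  assumes "zariski_open_in coord X U" "x \<in> U"
  obtains g where "poly_fun coord g" "g x \<noteq> 0" "\<And>y. y \<in> X \<Longrightarrow> g y \<noteq> 0 \<Longrightarrow> y \<in> U"
proof -
  obtain P where U: "U = {x \<in> X. \<exists>p\<in>P. eval_mpoly (\<lambda>c. c) (coord x) p \<noteq> 0}"
    using assms(1) unfolding zariski_open_in_def by blast
  then obtain p where "p \<in> P" "eval_mpoly (\<lambda>c. c) (coord x) p \<noteq> 0" using assms(2) by blast
  then show thesis
    by (intro that[of "\<lambda>x. eval_mpoly (\<lambda>c. c) (coord x) p"]) (auto simp: poly_fun_def U)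
qed

text \<open>On a curve with a polynomial parametrization, nonvanishing becomes a question about the finitely
  many roots of a polynomial in one variable.\<close>

lemma poly_fun_along_curve:
  fixes coord :: "'x \<Rightarrow> 'i \<Rightarrow> 'k::comm_ring_1"
  assumes "poly_fun coord g" and curve: "\<And>i. \<exists>q. \<forall>t. coord (\<gamma> t) i = poly q t"
  shows "\<exists>q. \<forall>t. g (\<gamma> t) = poly q t"
proof -
  obtain p where p: "\<forall>x. g x = eval_mpoly (\<lambda>c. c) (coord x) p"
    using assms(1) unfolding poly_fun_def by blast
  obtain Q where Q: "\<And>i t. coord (\<gamma> t) i = poly (Q i) t" using curve by metis
  have "g (\<gamma> t) = poly (eval_mpoly (\<lambda>c. [:c:]) Q p) t" for t
    by (simp add: p eval_mpoly_def Q poly_sum poly_prod)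
  then show ?thesis by blast
qed

lemma lookup_mult_pairs:
  fixes p q :: "('v::finite, 'k::comm_ring_1) mpoly"
  shows "lookup (p * q) m = (\<Sum>(a, b) | a + b = m. lookup p a * lookup q b)"
    and "finite {(a, b). a + b = (m :: 'v monom)}"
proof -
  let ?D = "{a :: 'v monom. \<forall>v. lookup a v \<le> lookup m v}"
  have "lookup ` ?D \<subseteq> PiE UNIV (\<lambda>v. {..lookup m v})" by auto
  then have "finite (lookup ` ?D)" by (rule finite_subset) (simp add: finite_PiE)
  then have D: "finite ?D" by (rule finite_imageD) (auto intro: inj_onI poly_mapping_eqI)
  have "{(a, b). a + b = m} \<subseteq> ?D \<times> ?D" by (auto simp: lookup_add)
  then show fin: "finite {(a, b). a + b = m}" by (rule finite_subset) (simp add: D)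
  show "lookup (p * q) m = (\<Sum>(a, b) | a + b = m. lookup p a * lookup q b)"
  proof (induction p rule: mpoly_induct)
    case (single k c)
    show ?case
    proof (induction q rule: mpoly_induct)
      case (single l d)
      have "(\<Sum>(a, b) | a + b = m. lookup (single k c) a * lookup (single l d) b)
        = (\<Sum>x | fst x + snd x = m. if x = (k, l) then c * d else 0)"
        by (intro sum.cong) (auto simp: lookup_single when_def split: if_splits)
      also have "\<dots> = (if k + l = m then c * d else 0)"
        using fin unfolding case_prod_unfold by (subst sum.delta) simp_all
      also have "\<dots> = lookup (single k c * single l d) m"
        by (simp add: mult_single lookup_single when_def)
      finally show ?case by (rule sym)
    next
      case (add p q)
      then show ?case
        by (simp only: distrib_left lookup_add sum.distrib[symmetric] case_prod_beta)
    qed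
  next
    case (add p p')
    then show ?case
      by (simp only: distrib_right lookup_add sum.distrib[symmetric] case_prod_beta)
  qed
qed

definition poly_family :: "('x \<Rightarrow> 'i \<Rightarrow> 'k::comm_ring_1) \<Rightarrow> ('x \<Rightarrow> ('v, 'k) mpoly) \<Rightarrow> bool"
  where "poly_family coord P \<longleftrightarrow> (\<forall>m. poly_fun coord (\<lambda>x. lookup (P x) m))"

lemma poly_family_const: "poly_family coord (\<lambda>x. p)"
  by (simp add: poly_family_def poly_fun_const)

lemma poly_family_Const: "poly_fun coord g \<Longrightarrow> poly_family coord (\<lambda>x. Const (g x))"
  unfolding poly_family_def Const_def lookup_single when_def
  by (rule allI, case_tac "0 = m") (simp_all add: poly_fun_const)

lemma poly_family_sum:
  "(\<And>i. i \<in> A \<Longrightarrow> poly_family coord (P i)) \<Longrightarrow> poly_family coord (\<lambda>x. \<Sum>i\<in>A. P i x)"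
  by (simp add: poly_family_def lookup_sum poly_fun_sum)

lemma poly_family_mult:
  fixes P Q :: "'x \<Rightarrow> ('v::finite, 'k::comm_ring_1) mpoly"
  assumes "poly_family coord P" "poly_family coord Q"
  shows "poly_family coord (\<lambda>x. P x * Q x)"
  using assms unfolding poly_family_def lookup_mult_pairs case_prod_beta
  by (intro allI poly_fun_sum poly_fun_mult) simp_all

lemma poly_family_power:
  fixes P :: "'x \<Rightarrow> ('v::finite, 'k::comm_ring_1) mpoly"
  shows "poly_family coord P \<Longrightarrow> poly_family coord (\<lambda>x. P x ^ n)"
  by (induction n) (auto intro: poly_family_const poly_family_mult)

lemma poly_family_prod:
  fixes P :: "'j \<Rightarrow> 'x \<Rightarrow> ('v::finite, 'k::comm_ring_1) mpoly"
  shows "(\<And>i. i \<in> A \<Longrightarrow> poly_family coord (P i)) \<Longrightarrow> poly_family coord (\<lambda>x. \<Prod>i\<in>A. P i x)"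
  by (induction A rule: infinite_finite_induct) (auto intro: poly_family_const poly_family_mult)

section \<open>Openness of the criterion\<close>

text \<open>Gaussian elimination over the ring of polynomial functions, with \<open>g\<close> the product of the pivots.
  Elimination by cross-multiplication keeps the entries polynomial, and it turns the identity matrix
  at \<open>x0\<close> into a smaller identity matrix, so all pivots are 1 there.\<close>

lemma generic_solvability:
  fixes w :: "'m \<Rightarrow> 'm \<Rightarrow> 'x \<Rightarrow> 'k::field"
  assumes "finite M" "\<And>a b. a \<in> M \<Longrightarrow> b \<in> M \<Longrightarrow> poly_fun coord (w a b)"
    and "\<And>a b. a \<in> M \<Longrightarrow> b \<in> M \<Longrightarrow> w a b x0 = (if a = b then 1 else 0)"
  shows "\<exists>g. poly_fun coord g \<and> g x0 \<noteq> 0 \<and>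
    (\<forall>x t. g x \<noteq> 0 \<longrightarrow> (\<exists>c. \<forall>b\<in>M. (\<Sum>a\<in>M. c a * w a b x) = t b))"
  using assms
proof (induction M arbitrary: w rule: finite_induct)
  case empty
  show ?case by (intro exI[of _ "\<lambda>_. 1"]) (simp add: poly_fun_const)
next
  case (insert m M)
  define w' where "w' a b x = w m m x * w a b x - w a m x * w m b x" for a b x
  have "\<exists>g. poly_fun coord g \<and> g x0 \<noteq> 0 \<and>
    (\<forall>x t. g x \<noteq> 0 \<longrightarrow> (\<exists>c. \<forall>b\<in>M. (\<Sum>a\<in>M. c a * w' a b x) = t b))"
  proof (rule insert.IH)
    fix a b assume ab: "a \<in> M" "b \<in> M"
    show "poly_fun coord (w' a b)"
      unfolding w'_def[abs_def] by (intro poly_fun_diff poly_fun_mult insert.prems) (use ab in auto)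
    have "w m m x0 = 1" "w a m x0 = 0" "w a b x0 = (if a = b then 1 else 0)"
      using ab insert.hyps(2) insert.prems(2)[of m m] insert.prems(2)[of a m] insert.prems(2)[of a b]
      by auto
    then show "w' a b x0 = (if a = b then 1 else 0)"
      by (simp only: w'_def) simp
  qed
  then obtain g where g: "poly_fun coord g" "g x0 \<noteq> 0"
    "\<And>x t. g x \<noteq> 0 \<Longrightarrow> \<exists>c. \<forall>b\<in>M. (\<Sum>a\<in>M. c a * w' a b x) = t b" by blast
  show ?case
  proof (intro exI[of _ "\<lambda>x. w m m x * g x"] conjI allI impI)
    show "poly_fun coord (\<lambda>x. w m m x * g x)"
      by (intro poly_fun_mult g insert.prems) auto
    show "w m m x0 * g x0 \<noteq> 0" using g(2) insert.prems(2)[of m m] by simp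
    fix x t assume nz: "w m m x * g x \<noteq> 0"
    then obtain c where c: "\<And>b. b \<in> M \<Longrightarrow> (\<Sum>a\<in>M. c a * w' a b x) = t b - t m / w m m x * w m b x"
      using g(3)[of x "\<lambda>b. t b - t m / w m m x * w m b x"] by auto
    \<comment> \<open>Solve the reduced system for the rows in \<open>M\<close>, then let the pivot row supply what entry \<open>m\<close> still lacks.\<close>
    define c' where "c' a = (if a = m then t m / w m m x - (\<Sum>a\<in>M. c a * w a m x) else c a * w m m x)" for a
    have sum: "(\<Sum>a\<in>insert m M. c' a * w a b x) = t m / w m m x * w m b x + (\<Sum>a\<in>M. c a * w' a b x)" for b
    proof -
      have "(\<Sum>a\<in>M. c' a * w a b x) = (\<Sum>a\<in>M. c a * w m m x * w a b x)"
      proof (intro sum.cong refl)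
        fix a assume "a \<in> M"
        then have "a \<noteq> m" using insert.hyps(2) by blast
        then show "c' a * w a b x = c a * w m m x * w a b x" by (simp only: c'_def if_False)
      qed
      moreover have "(\<Sum>a\<in>M. c a * w' a b x) = (\<Sum>a\<in>M. c a * w m m x * w a b x) - (\<Sum>a\<in>M. c a * w a m x) * w m b x"
        unfolding w'_def sum_distrib_right sum_subtractf[symmetric]
        by (intro sum.cong refl) (simp only: right_diff_distrib mult.assoc)
      moreover have "c' m = t m / w m m x - (\<Sum>a\<in>M. c a * w a m x)" by (simp add: c'_def)
      ultimately show ?thesis
        by (simp only: sum.insert[OF insert.hyps] left_diff_distrib) simp
    qed
    show "\<exists>c. \<forall>b\<in>insert m M. (\<Sum>a\<in>insert m M. c a * w a b x) = t b"
    proof (intro exI[of _ c'] ballI)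
      fix b assume b: "b \<in> insert m M"
      show "(\<Sum>a\<in>insert m M. c' a * w a b x) = t b"
      proof (cases "b = m")
        case True
        have "(\<Sum>a\<in>M. c a * w' a m x) = 0" by (simp add: w'_def mult.commute)
        then show ?thesis using nz unfolding sum True by simp
      next
        case False
        then show ?thesis using b c[of b] unfolding sum by simp
      qed
    qed
  qed
qed

text \<open>At \<open>x0\<close> choose, for every nonstandard \<open>m\<close>, coefficients that represent \<open>m\<close> minus standard terms by
  the generators. Keep these coefficients while \<open>x\<close> varies: the nonstandard parts of the resulting
  elements of the ideal form a matrix of polynomial functions that is the identity at \<open>x0\<close>. Wherever
  it can be solved for any right-hand side, the nonstandard part of any form can be cancelled.\<close>

lemma std_spanning_open:
  fixes F :: "'x \<Rightarrow> 5 \<Rightarrow> (5, 'k::field) mpoly"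
  assumes F: "\<And>i. poly_family coord (\<lambda>x. F x i)" and S: "std_spanning (ideal.span (range (F x0)))"
  shows "\<exists>g. poly_fun coord g \<and> g x0 \<noteq> 0 \<and>
    (\<forall>x. g x \<noteq> 0 \<longrightarrow> (\<forall>i. homogeneous 2 (F x i)) \<longrightarrow> std_spanning (ideal.span (range (F x))))"
proof -
  define M where "M = {m :: 5 monom. \<not> std_monom m \<and> 2 \<le> deg_monom m \<and> deg_monom m \<le> 6}"
  have "M \<subseteq> (\<Union>d\<in>{..6}. {m. deg_monom m = d})" by (auto simp: M_def)
  then have finM: "finite M" by (rule finite_subset) (simp add: finite_monoms_5)
  have "\<exists>h. \<forall>b\<in>M. lookup (\<Sum>i\<in>UNIV. h i * F x0 i) b = (if m = b then 1 else 0)" if m: "m \<in> M" for m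
  proof -
    have hom: "homogeneous (deg_monom m) (single m (1::'k))" by (simp add: homogeneous_single)
    have deg: "2 \<le> deg_monom m" "deg_monom m \<le> 6" using m by (simp_all add: M_def)
    obtain q where q: "\<forall>n\<in>keys q. std_monom n" "single m 1 - q \<in> ideal.span (range (F x0))"
      using S[unfolded std_spanning_def, rule_format, OF conjI[OF deg(1) conjI[OF deg(2) hom]]] by blast
    obtain h where h: "single m 1 - q = (\<Sum>i\<in>UNIV. h i * F x0 i)"
      using q(2) unfolding in_ideal_span_range_iff by blast
    have "lookup (single m 1 - q) b = (if m = b then 1 else 0)" if "b \<in> M" for b
    proof -
      have "lookup q b = 0" using q(1) that by (auto simp: M_def in_keys_iff)
      then show ?thesis by (simp add: lookup_minus lookup_single when_def)
    qed
    then show ?thesis unfolding h by blast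
  qed
  then have "\<forall>m\<in>M. \<exists>h. \<forall>b\<in>M. lookup (\<Sum>i\<in>UNIV. h i * F x0 i) b = (if m = b then 1 else 0)"
    by (rule ballI)
  from bchoice[OF this] obtain h
    where h: "\<forall>m\<in>M. \<forall>b\<in>M. lookup (\<Sum>i\<in>UNIV. h m i * F x0 i) b = (if m = b then 1 else 0)" ..
  define W where "W m x = (\<Sum>i\<in>UNIV. h m i * F x i)" for m x
  have W: "W m x \<in> ideal.span (range (F x))" for m x
    unfolding W_def in_ideal_span_range_iff by blast
  have "\<exists>g. poly_fun coord g \<and> g x0 \<noteq> 0 \<and>
    (\<forall>x t. g x \<noteq> 0 \<longrightarrow> (\<exists>c. \<forall>b\<in>M. (\<Sum>a\<in>M. c a * lookup (W a x) b) = t b))"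
  proof (rule generic_solvability[OF finM])
    fix a b assume ab: "a \<in> M" "b \<in> M"
    have "poly_family coord (W a)"
      unfolding W_def[abs_def] by (intro poly_family_sum poly_family_mult poly_family_const F)
    then show "poly_fun coord (\<lambda>x. lookup (W a x) b)" by (simp add: poly_family_def)
    show "lookup (W a x0) b = (if a = b then 1 else 0)"
      unfolding W_def using h[rule_format, OF ab] .
  qed
  then obtain g where g: "poly_fun coord g" "g x0 \<noteq> 0"
    "\<And>x t. g x \<noteq> 0 \<Longrightarrow> \<exists>c. \<forall>b\<in>M. (\<Sum>a\<in>M. c a * lookup (W a x) b) = t b" by blast
  have "std_spanning (ideal.span (range (F x)))" if x: "g x \<noteq> 0" and hom: "\<forall>i. homogeneous 2 (F x i)" for x
    unfolding std_spanning_def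
  proof (intro allI impI, elim conjE)
    fix d and p :: "(5, 'k) mpoly"
    assume d: "2 \<le> d" "d \<le> 6" and p: "homogeneous d p"
    obtain c where c: "\<And>b. b \<in> M \<Longrightarrow> (\<Sum>a\<in>M. c a * lookup (W a x) b) = lookup p b"
      using g(3)[OF x, of "lookup p"] by blast
    define r where "r = hom_comp d (\<Sum>a\<in>M. Const (c a) * W a x)"
    have "(\<Sum>a\<in>M. Const (c a) * W a x) \<in> ideal.span (range (F x))"
      by (intro ideal.span_sum ideal.span_scale W)
    then have r: "r \<in> ideal.span (range (F x))"
      unfolding r_def by (rule hom_comp_in_ideal[rotated]) (use hom in blast)
    show "\<exists>q. homogeneous d q \<and> (\<forall>m\<in>keys q. std_monom m) \<and> p - q \<in> ideal.span (range (F x))"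
    proof (intro exI[of _ "p - r"] conjI)
      show hom': "homogeneous d (p - r)"
        using p by (simp add: r_def homogeneous_diff homogeneous_hom_comp)
      show "\<forall>m\<in>keys (p - r). std_monom m"
      proof (rule ballI, rule ccontr)
        fix m assume m: "m \<in> keys (p - r)" "\<not> std_monom m"
        then have deg: "deg_monom m = d" using hom' by (auto simp: homogeneous_def)
        then have "m \<in> M" using m d by (simp add: M_def)
        from c[OF this] have "lookup (p - r) m = 0"
          by (simp add: lookup_minus r_def lookup_hom_comp deg lookup_sum)
        then show False using m by (simp add: in_keys_iff)
      qed
      show "p - (p - r) \<in> ideal.span (range (F x))" using r by simp
    qed
  qed
  then show ?thesis using g by blast
qed

section \<open>Linear changes of coordinates\<close>

lemma ring_map_lin_change: "ring_map (lin_change A)"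
  unfolding lin_change_def by (rule ring_map_eval_mpoly[OF ring_map_Const])

lemma lin_change_Const: "lin_change A (Const c) = Const c"
  by (simp add: lin_change_def eval_mpoly_Const[OF ring_map_Const])

lemma lin_change_Var: "lin_change A (Var j) = (\<Sum>i\<in>UNIV. Const (A $ i $ j) * Var i)"
  by (simp add: lin_change_def eval_mpoly_Var[OF ring_map_Const])

lemma lin_change_compose: "lin_change A (lin_change B p) = lin_change (A ** B) p"
proof -
  have "(lin_change A \<circ> lin_change B) p
      = eval_mpoly Const (\<lambda>j. \<Sum>i\<in>UNIV. Const ((A ** B) $ i $ j) * Var i) p"
  proof (rule eval_mpoly_eqI[OF ring_map_Const])
    show "ring_map (lin_change A \<circ> lin_change B)"
      using ring_map_lin_change[of A] ring_map_lin_change[of B] by (simp add: ring_map_def)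
    show "(lin_change A \<circ> lin_change B) (Const c) = Const c" for c
      by (simp add: lin_change_Const)
    fix j
    have "(lin_change A \<circ> lin_change B) (Var j)
        = (\<Sum>k\<in>UNIV. Const (B $ k $ j) * (\<Sum>i\<in>UNIV. Const (A $ i $ k) * Var i))"
      by (simp only: o_apply lin_change_Var ring_map_sum[OF ring_map_lin_change]
          ring_mapD(4)[OF ring_map_lin_change] lin_change_Const)
    also have "\<dots> = (\<Sum>i\<in>UNIV. \<Sum>k\<in>UNIV. Const (B $ k $ j) * (Const (A $ i $ k) * Var i))"
      by (subst sum.swap) (simp only: sum_distrib_left)
    also have "\<dots> = (\<Sum>i\<in>UNIV. \<Sum>k\<in>UNIV. Const (A $ i $ k * B $ k $ j) * Var i)"
      by (intro sum.cong refl) (simp only: Const_mult mult.assoc mult.left_commute)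
    also have "\<dots> = (\<Sum>i\<in>UNIV. Const ((A ** B) $ i $ j) * Var i)"
      by (simp only: matrix_matrix_mult_def vec_lambda_beta Const_sum sum_distrib_right)
    finally show "(lin_change A \<circ> lin_change B) (Var j) = (\<Sum>i\<in>UNIV. Const ((A ** B) $ i $ j) * Var i)" .
  qed
  then show ?thesis by (simp add: lin_change_def)
qed

lemma lin_change_mat_1: "lin_change (mat 1) p = p"
proof -
  have "(\<lambda>p. p) p = eval_mpoly Const (\<lambda>j. \<Sum>i\<in>UNIV. Const (mat 1 $ i $ j) * Var i) p"
  proof (rule eval_mpoly_eqI[OF ring_map_Const ring_map_id])
    fix j
    have "(\<Sum>i\<in>UNIV. Const (mat 1 $ i $ j) * Var i) = (\<Sum>i\<in>UNIV. if i = j then Var i else 0)"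
      by (intro sum.cong) (auto simp: mat_def)
    also have "\<dots> = Var j" by simp
    finally show "Var j = (\<Sum>i\<in>UNIV. Const (mat 1 $ i $ j) * Var i)" by (rule sym)
  qed simp
  then show ?thesis by (simp add: lin_change_def)
qed

lemma lin_change_expand:
  "lin_change A p = (\<Sum>m\<in>keys p. Const (lookup p m) *
    (\<Prod>v\<in>UNIV. (\<Sum>i\<in>UNIV. Const (A $ i $ v) * Var i) ^ lookup m v))"
  unfolding lin_change_def
  by (simp add: eval_mpoly_superset[of Const "keys p"] monom_value_superset[of UNIV])

lemma homogeneous_lin_change:
  assumes "homogeneous d p" shows "homogeneous d (lin_change A p)"
  unfolding lin_change_expand
proof (intro homogeneous_sum homogeneous_Const_mult)
  fix m assume "m \<in> keys p"
  then have "(\<Sum>v\<in>UNIV. lookup m v * 1) = d"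
    using assms by (simp add: homogeneous_def deg_monom_UNIV)
  moreover have "homogeneous (\<Sum>v\<in>UNIV. lookup m v * 1)
      (\<Prod>v\<in>UNIV. (\<Sum>i\<in>UNIV. Const (A $ i $ v) * Var i) ^ lookup m v)"
    by (intro homogeneous_prod homogeneous_power homogeneous_sum homogeneous_Const_mult homogeneous_Var) simp
  ultimately show "homogeneous d (\<Prod>v\<in>UNIV. (\<Sum>i\<in>UNIV. Const (A $ i $ v) * Var i) ^ lookup m v)"
    by simp
qed

lemma lin_change_ideal:
  fixes f :: "'i::finite \<Rightarrow> ('n::finite, 'k::field) mpoly"
  assumes "invertible A"
  shows "lin_change A ` ideal.span (range f) = ideal.span (range (\<lambda>i. lin_change A (f i)))"
proof -
  obtain B where "A ** B = mat 1" using assms by (auto simp: invertible_def)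
  then have surj: "lin_change A (lin_change B q) = q" for q :: "('n, 'k) mpoly"
    by (simp add: lin_change_compose lin_change_mat_1)
  have hom: "lin_change A (\<Sum>i\<in>UNIV. h i * f i) = (\<Sum>i\<in>UNIV. lin_change A (h i) * lin_change A (f i))" for h
    by (simp add: ring_map_sum[OF ring_map_lin_change] ring_mapD(4)[OF ring_map_lin_change])
  show ?thesis
  proof (intro equalityI subsetI)
    fix q assume "q \<in> lin_change A ` ideal.span (range f)"
    then obtain h where "q = lin_change A (\<Sum>i\<in>UNIV. h i * f i)"
      unfolding image_iff Bex_def in_ideal_span_range_iff by blast
    then show "q \<in> ideal.span (range (\<lambda>i. lin_change A (f i)))"
      unfolding in_ideal_span_range_iff hom by (intro exI[of _ "\<lambda>i. lin_change A (h i)"])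
  next
    fix q assume "q \<in> ideal.span (range (\<lambda>i. lin_change A (f i)))"
    then obtain h where "q = (\<Sum>i\<in>UNIV. h i * lin_change A (f i))"
      unfolding in_ideal_span_range_iff by blast
    then have "q = lin_change A (\<Sum>i\<in>UNIV. lin_change B (h i) * f i)"
      unfolding hom surj .
    moreover have "(\<Sum>i\<in>UNIV. lin_change B (h i) * f i) \<in> ideal.span (range f)"
      unfolding in_ideal_span_range_iff by (rule exI[of _ "\<lambda>i. lin_change B (h i)"]) (rule refl)
    ultimately show "q \<in> lin_change A ` ideal.span (range f)" by (rule image_eqI)
  qed
qed

abbreviation matrix_coord :: "'k ^ 'n ^ 'n \<Rightarrow> 'n \<times> 'n \<Rightarrow> 'k"
  where "matrix_coord \<equiv> \<lambda>A (i, j). A $ i $ j"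

lemma poly_fun_entry: "poly_fun matrix_coord (\<lambda>A. A $ i $ j)"
  using poly_fun_coord[of matrix_coord "(i, j)"] by simp

lemma poly_family_lin_change: "poly_family matrix_coord (\<lambda>A. lin_change A p)"
  unfolding lin_change_expand
  by (intro poly_family_sum poly_family_mult poly_family_const poly_family_prod poly_family_power
      poly_family_Const poly_fun_entry)

lemma poly_fun_prod:
  "(\<And>i. i \<in> A \<Longrightarrow> poly_fun coord (g i)) \<Longrightarrow> poly_fun coord (\<lambda>x. \<Prod>i\<in>A. g i x)"
  by (induction A rule: infinite_finite_induct) (auto intro: poly_fun_const poly_fun_mult)

lemma poly_fun_det: "poly_fun matrix_coord det"
  unfolding det_def[abs_def]
  by (intro poly_fun_sum poly_fun_mult poly_fun_const poly_fun_prod poly_fun_entry)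

text \<open>On the line through \<open>A\<close> and \<open>B\<close> each of \<open>g\<close>, \<open>h\<close> and the determinant is a nonzero polynomial in the
  parameter, and an infinite field has a point outside their roots.\<close>

lemma GL_irreducible:
  fixes A B :: "'k::field_char_0 ^ 'n ^ 'n"
  assumes g: "poly_fun matrix_coord g" "A \<in> GL" "g A \<noteq> 0"
    and h: "poly_fun matrix_coord h" "B \<in> GL" "h B \<noteq> 0"
  shows "\<exists>C\<in>GL. g C \<noteq> 0 \<and> h C \<noteq> 0"
proof -
  define \<gamma> where "\<gamma> t = (\<chi> i j. A $ i $ j + t * (B $ i $ j - A $ i $ j))" for t
  have line: "\<exists>q. \<forall>t. matrix_coord (\<gamma> t) ij = poly q t" for ij
    by (cases ij) (auto simp: \<gamma>_def intro!: exI[of _ "[: A $ fst ij $ snd ij, B $ fst ij $ snd ij - A $ fst ij $ snd ij :]"])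
  obtain p where p: "\<And>t. g (\<gamma> t) = poly p t" using poly_fun_along_curve[OF g(1) line] by blast
  obtain q where q: "\<And>t. h (\<gamma> t) = poly q t" using poly_fun_along_curve[OF h(1) line] by blast
  obtain r where r: "\<And>t. det (\<gamma> t) = poly r t" using poly_fun_along_curve[OF poly_fun_det line] by blast
  have \<gamma>: "\<gamma> 0 = A" "\<gamma> 1 = B" by (simp_all add: \<gamma>_def vec_eq_iff)
  have "poly p 0 \<noteq> 0" "poly q 1 \<noteq> 0" "poly r 0 \<noteq> 0"
    using g(2,3) h(3) by (simp_all add: p[symmetric] q[symmetric] r[symmetric] \<gamma> GL_def invertible_det_nz)
  then have "p * q * r \<noteq> 0" by auto
  then have "finite {t. poly (p * q * r) t = 0}" by (rule poly_roots_finite)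
  then have "{t. poly (p * q * r) t = 0} \<noteq> UNIV" using infinite_UNIV_char_0[where 'a = 'k] by metis
  then obtain t where "poly (p * q * r) t \<noteq> 0" by auto
  then have "g (\<gamma> t) \<noteq> 0" "h (\<gamma> t) \<noteq> 0" "det (\<gamma> t) \<noteq> 0" by (simp_all add: p q r)
  then show ?thesis by (intro bexI[of _ "\<gamma> t"]) (simp_all add: GL_def invertible_det_nz)
qed

text \<open>Openness yields a nonempty open set of coordinate changes with initial ideal \<open>J\<close>; any other
  nonempty open set meets it, so the constant value is unique.\<close>

lemma Gin_eq_J:
  fixes f :: "5 \<Rightarrow> (5, 'k::field_char_0) mpoly"
  assumes f: "\<And>i. homogeneous 2 (f i)" and A: "invertible A"
    and S: "std_spanning (ideal.span (range (\<lambda>i. lin_change A (f i))))"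
  shows "Gin (ideal.span (range f)) = ideal.span J_gens"
proof -
  let ?I = "ideal.span (range f)"
  obtain g where g: "poly_fun matrix_coord g" "g A \<noteq> 0"
    "\<And>B. g B \<noteq> 0 \<Longrightarrow> std_spanning (ideal.span (range (\<lambda>i. lin_change B (f i))))"
    using std_spanning_open[of matrix_coord "\<lambda>B i. lin_change B (f i)" A, OF poly_family_lin_change S]
      homogeneous_lin_change[OF f] by blast
  have J: "initial_ideal (lin_change B ` ?I) = ideal.span J_gens" if "B \<in> GL" "g B \<noteq> 0" for B
    using initial_ideal_eq_J[OF homogeneous_lin_change[OF f] g(3)[OF that(2)]]
      lin_change_ideal[of B f] that(1) by (simp add: GL_def)
  show ?thesis
    unfolding Gin_def
  proof (rule the_equality)
    show "\<exists>U. zariski_open_GL U \<and> U \<noteq> {} \<and> (\<forall>B\<in>U. initial_ideal (lin_change B ` ?I) = ideal.span J_gens)"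
    proof (intro exI[of _ "{B \<in> GL. g B \<noteq> 0}"] conjI ballI)
      show "zariski_open_GL {B \<in> GL. g B \<noteq> 0}"
        unfolding zariski_open_GL_def by (rule zariski_open_nonvanishing[OF g(1)])
      show "{B \<in> GL. g B \<noteq> 0} \<noteq> {}" using A g(2) by (auto simp: GL_def)
    qed (use J in simp)
  next
    fix J' assume "\<exists>U. zariski_open_GL U \<and> U \<noteq> {} \<and> (\<forall>B\<in>U. initial_ideal (lin_change B ` ?I) = J')"
    then obtain U B where U: "zariski_open_GL U" "B \<in> U" "\<forall>B\<in>U. initial_ideal (lin_change B ` ?I) = J'"
      by blast
    obtain h where h: "poly_fun matrix_coord h" "h B \<noteq> 0" "\<And>C. C \<in> GL \<Longrightarrow> h C \<noteq> 0 \<Longrightarrow> C \<in> U"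
      using zariski_open_nonvanishingE[OF U(1)[unfolded zariski_open_GL_def] U(2)] by blast
    have "B \<in> GL" using U(1,2) by (auto simp: zariski_open_GL_def zariski_open_in_def)
    then obtain C where "C \<in> GL" "g C \<noteq> 0" "h C \<noteq> 0"
      using GL_irreducible[OF g(1) _ g(2) h(1) _ h(2)] A by (auto simp: GL_def)
    then show "J' = ideal.span J_gens" using J h(3) U(3) by blast
  qed
qed

section \<open>Squares of five linear forms\<close>

lemma homogeneous_uminus: "homogeneous d p \<Longrightarrow> homogeneous d (- p :: ('v, 'k::comm_ring_1) mpoly)"
  using homogeneous_diff[OF homogeneous_0] by fastforce

lemma homogeneous_numeral_mult:
  "homogeneous d p \<Longrightarrow> homogeneous d (numeral k * p :: ('v, 'k::comm_ring_1) mpoly)"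
  using homogeneous_Const_mult[of d p "numeral k"] by simp

lemma subspace_cancel_numeral:
  assumes "mpv.subspace T" "numeral k * p \<in> T"
  shows "(p :: ('v, 'k::field_char_0) mpoly) \<in> T"
proof -
  have "Const (1 / numeral k) * (numeral k * p) \<in> T" using assms by (rule mpv.subspace_scale)
  also have "Const (1 / numeral k) * (numeral k * p) = Const (1 / numeral k * numeral k) * p"
    unfolding Const_mult Const_numeral by (simp only: mult.assoc)
  finally show ?thesis by simp
qed

text \<open>A monomial of degree \<open>d + 1\<close> is a variable times a monomial of degree \<open>d\<close>, and the variable is a
  combination of the \<open>y j\<close>.\<close>

lemma forms_Suc_in_subspace:
  fixes y :: "5 \<Rightarrow> (5, 'k::field) mpoly"
  assumes T: "mpv.subspace T" and basis: "\<And>v. Var v \<in> mpv.span (range y)"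
    and y: "\<And>j q. homogeneous d q \<Longrightarrow> y j * q \<in> T"
    and p: "homogeneous (Suc d) p"
  shows "p \<in> T"
proof -
  have single: "single m 1 \<in> T" if deg: "deg_monom m = Suc d" for m
  proof -
    obtain v n where m: "m = single v 1 + n" "deg_monom n = d" using deg_monom_Suc[OF deg] .
    have "Var v * single n (1::'k) \<in> mpv.span T"
    proof (rule mult_in_span[OF basis])
      fix x assume "x \<in> range y"
      then show "x * single n 1 \<in> mpv.span T"
        using y[OF homogeneous_single[OF m(2), of 1]] by (auto intro: mpv.span_base)
    qed
    then show ?thesis using T by (simp add: m(1) Var_def mult_single mpv.span_eq_iff[THEN iffD2])
  qed
  have "p \<in> mpv.span (monoms {m. deg_monom m = Suc d})" by (rule homogeneous_in_span_monoms[OF p])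
  also have "\<dots> \<subseteq> T" using single by (intro mpv.span_minimal T) auto
  finally show ?thesis .
qed

lemma subspace_ideal: "mpv.subspace (ideal.span B)"
  unfolding mpv.subspace_def by (simp add: ideal.span_zero ideal.span_add ideal_mult_left)

lemma subspace_mult_preimage: "mpv.subspace T \<Longrightarrow> mpv.subspace {p. u * p \<in> T}"
  unfolding mpv.subspace_def mem_Collect_eq
  by (simp only: distrib_left mult.left_commute[of u] mult_zero_right) blast

text \<open>The preimage in the polynomial ring of \<open>u\<close> times the forms of degree \<open>e\<close> in the quotient by \<open>I\<close>.\<close>

definition multiples_mod :: "('v, 'k::comm_ring_1) mpoly set \<Rightarrow> ('v, 'k) mpoly \<Rightarrow> nat \<Rightarrow> ('v, 'k) mpoly set"
  where "multiples_mod I u e = {p. \<exists>s. homogeneous e s \<and> p - u * s \<in> I}"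

lemma subspace_multiples_mod:
  "mpv.subspace (multiples_mod (ideal.span B) u e :: ('v, 'k::field) mpoly set)"
  unfolding mpv.subspace_def
proof (intro conjI ballI allI)
  let ?I = "ideal.span B"
  show "0 \<in> multiples_mod ?I u e"
    unfolding multiples_mod_def by (auto intro!: exI[of _ 0] simp: ideal.span_zero)
  fix p q assume "p \<in> multiples_mod ?I u e" "q \<in> multiples_mod ?I u e"
  then obtain s t where s: "homogeneous e s" "p - u * s \<in> ?I" and t: "homogeneous e t" "q - u * t \<in> ?I"
    unfolding multiples_mod_def by blast
  have "p + q - u * (s + t) = (p - u * s) + (q - u * t)" by (simp add: distrib_left)
  then show "p + q \<in> multiples_mod ?I u e"
    unfolding multiples_mod_def mem_Collect_eq using s t
    by (intro exI[of _ "s + t"]) (simp only: homogeneous_add ideal.span_add simp_thms)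
next
  let ?I = "ideal.span B"
  fix c p assume "p \<in> multiples_mod ?I u e"
  then obtain s where s: "homogeneous e s" "p - u * s \<in> ?I" unfolding multiples_mod_def by blast
  have "Const c * p - u * (Const c * s) = Const c * (p - u * s)"
    by (simp only: right_diff_distrib mult.left_commute)
  then show "Const c * p \<in> multiples_mod ?I u e"
    unfolding multiples_mod_def mem_Collect_eq using s
    by (intro exI[of _ "Const c * s"]) (simp only: homogeneous_Const_mult ideal_mult_left simp_thms)
qed

lemma multiples_modI: "homogeneous e s \<Longrightarrow> r \<in> ideal.span B \<Longrightarrow> p = u * s + r \<Longrightarrow> p \<in> multiples_mod (ideal.span B) u e"
  unfolding multiples_mod_def by (auto intro!: exI[of _ s])

lemma multiples_modE:
  assumes "p \<in> multiples_mod (ideal.span B) u e"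
  obtains s r where "homogeneous e s" "r \<in> ideal.span B" "p = u * s + r"
  using assms that[of _ "p - u * _"] unfolding multiples_mod_def by force

lemma multiples_mod_mult:
  fixes p :: "('v, 'k::field) mpoly"
  assumes p: "p \<in> multiples_mod (ideal.span B) u e"
    and s: "\<And>s. homogeneous e s \<Longrightarrow> w * (u * s) \<in> multiples_mod (ideal.span B) u' e'"
  shows "w * p \<in> multiples_mod (ideal.span B) u' e'"
proof -
  obtain t r where t: "homogeneous e t" "r \<in> ideal.span B" "p = u * t + r" using p by (rule multiples_modE)
  have "w * r \<in> multiples_mod (ideal.span B) u' e'"
    by (rule multiples_modI[OF homogeneous_0 ideal_mult_left[OF t(2), of w]]) simp
  from mpv.subspace_add[OF subspace_multiples_mod s[OF t(1)] this] show ?thesis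
    by (simp only: t(3) distrib_left)
qed

lemma homogeneous_0_Const:
  assumes "homogeneous 0 p" shows "p = Const (lookup p 0)"
  by (rule poly_mapping_eqI)
     (use homogeneous_lookup[OF assms] in \<open>auto simp: Const_def lookup_single when_def deg_monom_eq_0_iff\<close>)

lemma complement_3:
  fixes j k l :: 5
  assumes "j \<noteq> k" "j \<noteq> l" "k \<noteq> l"
  obtains m n where "UNIV = {j, k, l, m, n}" "distinct [j, k, l, m, n]"
proof -
  have "card (UNIV - {j, k, l}) = 2" using assms by (subst card_Diff_subset) simp_all
  then obtain m n where mn: "UNIV - {j, k, l} = {m, n}" "m \<noteq> n" by (auto simp: card_2_iff)
  then have "UNIV = {j, k, l, m, n}" by blast
  moreover have "m \<notin> {j, k, l}" "n \<notin> {j, k, l}" using mn by blast+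
  then have "distinct [j, k, l, m, n]" using mn(2) assms by auto
  ultimately show thesis by (rule that)
qed

lemma complement_2:
  fixes j k :: 5
  assumes "j \<noteq> k"
  obtains l m n where "UNIV = {j, k, l, m, n}" "distinct [j, k, l, m, n]"
proof -
  have "card {j, k} < card (UNIV :: 5 set)" using assms by simp
  then obtain l where "l \<notin> {j, k}" by (metis UNIV_eq_I nless_le)
  then have l: "j \<noteq> l" "k \<noteq> l" by auto
  show thesis using complement_3[OF assms l] that by metis
qed

text \<open>A product of \<open>n + 1\<close> elements taken from \<open>n\<close> elements with square zero vanishes, so the \<open>n + 1\<close>st
  power of their sum does; the terms are added one at a time.\<close>

lemma nilpotent_sums:
  fixes a b c d :: "'a::idom"
  assumes "a^2 \<in> ideal.span B" "b^2 \<in> ideal.span B" "c^2 \<in> ideal.span B"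
  shows "(a + b + c)^4 \<in> ideal.span B"
    and "d^2 \<in> ideal.span B \<Longrightarrow> (a + b + c + d)^5 \<in> ideal.span B"
proof -
  have "(a + b)^3 = (a + 3 * b) * a^2 + (3 * a + b) * b^2" by algebra
  then have 3: "(a + b)^3 \<in> ideal.span B" using assms by (simp only: ideal.span_add ideal_mult_left)
  have "(v + c)^4 = (v + 4 * c) * v^3 + (6 * v^2 + 4 * v * c + c^2) * c^2" for v :: 'a by algebra
  from this[of "a + b"] show 4: "(a + b + c)^4 \<in> ideal.span B"
    using 3 assms by (simp only: ideal.span_add ideal_mult_left)
  assume d: "d^2 \<in> ideal.span B"
  have "(v + d)^5 = (v + 5 * d) * v^4 + (10 * v^3 + 10 * v^2 * d + 5 * v * d^2 + d^3) * d^2" for v :: 'a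
    by algebra
  from this[of "a + b + c"] show "(a + b + c + d)^5 \<in> ideal.span B"
    using 4 d by (simp only: ideal.span_add ideal_mult_left)
qed

text \<open>Modulo the squares only squarefree products survive. In characteristic zero multiplication by \<open>s\<close>
  then maps degree 2 to degree 3 bijectively, and its cofactor here is the preimage of \<open>6 * (a * (b * c))\<close>.\<close>

lemma boolean_cubes:
  fixes a b c d e s :: "'a::idom"
  assumes "a^2 \<in> ideal.span B" "b^2 \<in> ideal.span B" "c^2 \<in> ideal.span B" "d^2 \<in> ideal.span B" "e^2 \<in> ideal.span B"
    and s: "s = a + b + c + d + e"
  shows "6 * (a * (b * c)) - s * (2 * (a * b + a * c + b * c) - (a + b + c) * (d + e) + 2 * (d * e)) \<in> ideal.span B"
proof -
  have "6 * (a * (b * c)) - s * (2 * (a * b + a * c + b * c) - (a + b + c) * (d + e) + 2 * (d * e))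
    = (- 2 * b - 2 * c + d + e) * a^2 + (- 2 * a - 2 * c + d + e) * b^2 + (- 2 * a - 2 * b + d + e) * c^2
      + (a + b + c - 2 * e) * d^2 + (a + b + c - 2 * d) * e^2"
    unfolding s by algebra
  then show ?thesis using assms(1-5) by (simp only: ideal.span_add ideal_mult_left)
qed

text \<open>Modulo \<open>a^2\<close> and \<open>b^2\<close>, multiplication by \<open>s\<close> and by \<open>t\<close> agree on multiples of \<open>a * b\<close>. Expanding
  the powers of \<open>(a + b) + t\<close> then leaves only few terms, because \<open>t^4\<close> and \<open>(a + b)^3\<close> vanish too.\<close>

lemma boolean_powers:
  fixes a b t s :: "'a::idom"
  assumes a: "a^2 \<in> ideal.span B" and b: "b^2 \<in> ideal.span B" and t: "t^4 \<in> ideal.span B" and s: "s = a + b + t"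
  shows "12 * (s^2 * (a * b)) - s^3 * (3 * a + 3 * b - t) \<in> ideal.span B"
    and "20 * (s^3 * (a * b)) - s^5 \<in> ideal.span B"
proof -
  have "12 * (s^2 * (a * b)) - s^3 * (3 * a + 3 * b - t)
    = (- 3 * a^2 - 8 * a * t + 6 * b^2 - 6 * t^2) * a^2 + (- 3 * b^2 - 8 * b * t - 6 * t^2) * b^2 + 1 * t^4"
    unfolding s by algebra
  then show "12 * (s^2 * (a * b)) - s^3 * (3 * a + 3 * b - t) \<in> ideal.span B"
    using a b t by (simp only: ideal.span_add ideal_mult_left)
  have "20 * (s^3 * (a * b)) - s^5
    = (- (a^3) + 15 * a^2 * b - 5 * a^2 * t + 50 * a * b^2 + 40 * a * b * t - 10 * a * t^2 + 50 * b^3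
        + 90 * b^2 * t + 30 * b * t^2 - 10 * t^3) * a^2
      + (15 * a * b^2 + 40 * a * b * t + 30 * a * t^2 - b^3 - 5 * b^2 * t - 10 * b * t^2 - 10 * t^3) * b^2
      + (- 5 * a - 5 * b - t) * t^4"
    unfolding s by algebra
  then show "20 * (s^3 * (a * b)) - s^5 \<in> ideal.span B"
    using a b t by (simp only: ideal.span_add ideal_mult_left)
qed

text \<open>Modulo \<open>a^2\<close>, multiplication by \<open>s\<close> and by \<open>w\<close> agree on multiples of \<open>a\<close>.\<close>

lemma boolean_socle:
  fixes a w s :: "'a::idom"
  assumes a: "a^2 \<in> ideal.span B" and w: "w^5 \<in> ideal.span B" and s: "s = a + w"
  shows "s^5 * a \<in> ideal.span B"
proof -
  have "s^5 * a = (a^4 + 5 * a^3 * w + 10 * a^2 * w^2 + 10 * a * w^3 + 5 * w^4) * a^2 + a * w^5"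
    unfolding s by algebra
  then show ?thesis using a w by (simp only: ideal.span_add ideal_mult_left)
qed

lemma homogeneous_mult_1_1: "homogeneous 1 p \<Longrightarrow> homogeneous 1 q \<Longrightarrow> homogeneous 2 (p * q)"
  using homogeneous_mult[of 1 p 1 q] by (simp add: numeral_2_eq_2)

lemma keys_monom_mult_std:
  assumes "homogeneous e (l :: (5, 'k::comm_ring_1) mpoly)" "\<And>n. deg_monom n = e \<Longrightarrow> std_monom (u + n)"
  shows "\<forall>m\<in>keys (single u 1 * l). std_monom m"
proof
  fix m assume "m \<in> keys (single u 1 * l)"
  then obtain n where "m = u + n" "n \<in> keys l" using Poly_Mapping.keys_mult[of "single u 1" l] by auto
  then show "std_monom m" using assms by (auto simp: homogeneous_def)
qed

context
  fixes y :: "5 \<Rightarrow> (5, 'k::field_char_0) mpoly" and B :: "(5, 'k) mpoly set"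
  assumes hom: "\<And>j. homogeneous 1 (y j)"
    and basis: "\<And>v. Var v \<in> mpv.span (range y)"
    and sq: "\<And>j. y j ^ 2 \<in> ideal.span B"
begin

lemma forms_2_in_subspace:
  assumes T: "mpv.subspace T" and y: "\<And>j k. y j * y k \<in> T" and p: "homogeneous 2 p"
  shows "p \<in> T"
proof -
  have 1: "y j * q \<in> T" if q: "homogeneous (Suc 0) q" for j q
  proof -
    have "q \<in> {q. y j * q \<in> T}"
    proof (rule forms_Suc_in_subspace[OF subspace_mult_preimage[OF T] basis _ q])
      fix k r assume "homogeneous 0 (r :: (5, 'k) mpoly)"
      then obtain c where "r = Const c" using homogeneous_0_Const by blast
      then have eq: "y j * (y k * r) = Const c * (y j * y k)" by (simp only: mult.commute mult.left_commute)
      show "y k * r \<in> {q. y j * q \<in> T}"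
        unfolding mem_Collect_eq eq by (rule mpv.subspace_scale[OF T y])
    qed
    then show ?thesis by simp
  qed
  show ?thesis
    by (rule forms_Suc_in_subspace[OF T basis 1]) (use p in \<open>simp_all add: numeral_2_eq_2\<close>)
qed

lemma forms_3_in_subspace:
  assumes T: "mpv.subspace T" and y: "\<And>j k l. y j * (y k * y l) \<in> T" and p: "homogeneous 3 p"
  shows "p \<in> T"
proof -
  have 2: "y j * q \<in> T" if q: "homogeneous 2 q" for j q
    using forms_2_in_subspace[OF subspace_mult_preimage[OF T] _ q, of "y j"] y by blast
  show ?thesis
    by (rule forms_Suc_in_subspace[OF T basis 2]) (use p in \<open>simp_all add: numeral_3_eq_3 numeral_2_eq_2\<close>)
qed

lemma ideal_in_multiples_mod: "r \<in> ideal.span B \<Longrightarrow> r \<in> multiples_mod (ideal.span B) u e"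
  by (rule multiples_modI[OF homogeneous_0]) simp_all

lemma square_in_ideal: "y j * (y j * q) \<in> ideal.span B" "y j * (q * y j) \<in> ideal.span B"
proof -
  have "y j * (y j * q) = q * y j ^ 2" "y j * (q * y j) = q * y j ^ 2" by algebra+
  then show "y j * (y j * q) \<in> ideal.span B" "y j * (q * y j) \<in> ideal.span B"
    using sq by (simp_all only: ideal_mult_left)
qed

context
  assumes sum: "x5 = (\<Sum>j\<in>UNIV. y j)"
begin

lemma x5_eq:
  assumes "UNIV = {j, k, l, m, n}" "distinct [j, k, l, m, n]"
  shows "x5 = y j + y k + y l + y m + y n"
  unfolding sum assms(1) using assms(2) by (simp add: add.assoc)

lemma cubes_multiples_x5: "y j * (y k * y l) \<in> multiples_mod (ideal.span B) x5 2"
proof (cases "j = k \<or> j = l \<or> k = l")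
  case True
  have "y j * (y k * y k) \<in> ideal.span B" using ideal_mult_left[OF sq[of k], of "y j"] by (simp only: power2_eq_square)
  then have "y j * (y k * y l) \<in> ideal.span B" using True square_in_ideal by metis
  then show ?thesis by (rule ideal_in_multiples_mod)
next
  case False
  then obtain m n where mn: "UNIV = {j, k, l, m, n}" "distinct [j, k, l, m, n]" using complement_3 by metis
  have "6 * (y j * (y k * y l)) \<in> multiples_mod (ideal.span B) x5 2"
  proof (rule multiples_modI[OF _ boolean_cubes[OF sq sq sq sq sq x5_eq[OF mn]]])
    show "homogeneous 2 (2 * (y j * y k + y j * y l + y k * y l) - (y j + y k + y l) * (y m + y n) + 2 * (y m * y n))"
      by (intro homogeneous_add homogeneous_diff homogeneous_numeral_mult homogeneous_mult_1_1 hom)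
  qed simp
  then show ?thesis by (rule subspace_cancel_numeral[OF subspace_multiples_mod])
qed

lemma x5_powers_multiples:
  shows "x5^2 * (y j * y k) \<in> multiples_mod (ideal.span B) (x5^3) 1"
    and "x5^3 * (y j * y k) \<in> multiples_mod (ideal.span B) (x5^5) 0"
proof -
  have "x5^2 * (y j * y k) \<in> multiples_mod (ideal.span B) (x5^3) 1
      \<and> x5^3 * (y j * y k) \<in> multiples_mod (ideal.span B) (x5^5) 0"
  proof (cases "j = k")
    case True
    have "w * (y j * y k) \<in> ideal.span B" for w
      using ideal_mult_left[OF sq[of k], of w] unfolding True by (simp only: power2_eq_square)
    then show ?thesis using ideal_in_multiples_mod by blast
  next
    case False
    then obtain l m n where lmn: "UNIV = {j, k, l, m, n}" "distinct [j, k, l, m, n]" using complement_2 by metis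
    have s: "x5 = y j + y k + (y l + y m + y n)" using x5_eq[OF lmn] by (simp only: add.assoc)
    note powers = boolean_powers[OF sq sq nilpotent_sums(1)[OF sq sq sq] s]
    have "12 * (x5^2 * (y j * y k)) \<in> multiples_mod (ideal.span B) (x5^3) 1"
    proof (rule multiples_modI[OF _ powers(1)])
      show "homogeneous 1 (3 * y j + 3 * y k - (y l + y m + y n))"
        by (intro homogeneous_add homogeneous_diff homogeneous_numeral_mult hom)
    qed simp
    moreover have "20 * (x5^3 * (y j * y k)) \<in> multiples_mod (ideal.span B) (x5^5) 0"
      by (rule multiples_modI[OF homogeneous_1 powers(2)]) simp
    ultimately show ?thesis by (blast intro: subspace_cancel_numeral[OF subspace_multiples_mod])
  qed
  then show "x5^2 * (y j * y k) \<in> multiples_mod (ideal.span B) (x5^3) 1"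
    "x5^3 * (y j * y k) \<in> multiples_mod (ideal.span B) (x5^5) 0" by blast+
qed

lemma x5_socle: "y j * x5^5 \<in> ideal.span B"
proof -
  have "card {j} < card (UNIV :: 5 set)" by simp
  then obtain k where "k \<notin> {j}" by (metis UNIV_eq_I nless_le)
  then obtain l m n where lmn: "UNIV = {j, k, l, m, n}" "distinct [j, k, l, m, n]" using complement_2[of j k] by auto
  have "x5 = y j + (y k + y l + y m + y n)" using x5_eq[OF lmn] by (simp only: add.assoc)
  from boolean_socle[OF sq nilpotent_sums(2)[OF sq sq sq sq] this] show ?thesis by (simp only: mult.commute)
qed

text \<open>The strong Lefschetz property of the squarefree algebra, in the form used here: powers of \<open>x5\<close> map
  degree 2 onto degree 3, degree 1 onto degree 4 and degree 0 onto degree 5 of the quotient. Each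
  later case builds on the preceding one, which leaves only products of two \<open>y j\<close> to be treated.\<close>

lemma forms_3: "homogeneous 3 p \<Longrightarrow> p \<in> multiples_mod (ideal.span B) x5 2"
  by (rule forms_3_in_subspace[OF subspace_multiples_mod cubes_multiples_x5])

lemma forms_4:
  assumes p: "homogeneous 4 p" shows "p \<in> multiples_mod (ideal.span B) (x5^3) 1"
proof (rule forms_Suc_in_subspace[OF subspace_multiples_mod basis, of 3])
  fix j and q :: "(5, 'k) mpoly" assume q: "homogeneous 3 q"
  show "y j * q \<in> multiples_mod (ideal.span B) (x5^3) 1"
  proof (rule multiples_mod_mult[OF forms_3[OF q]])
    fix s :: "(5, 'k) mpoly" assume s: "homogeneous 2 s"
    have "homogeneous 3 (y j * s)" using homogeneous_mult[OF hom s, of j] by (simp add: numeral_3_eq_3)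
    then have "x5 * (y j * s) \<in> multiples_mod (ideal.span B) (x5^3) 1"
    proof (rule multiples_mod_mult[OF forms_3])
      fix s' :: "(5, 'k) mpoly" assume s': "homogeneous 2 s'"
      have "s' \<in> {s. x5^2 * s \<in> multiples_mod (ideal.span B) (x5^3) 1}"
        using forms_2_in_subspace[OF subspace_mult_preimage[OF subspace_multiples_mod] _ s']
          x5_powers_multiples(1) by blast
      then show "x5 * (x5 * s') \<in> multiples_mod (ideal.span B) (x5^3) 1"
        by (simp only: mem_Collect_eq power2_eq_square mult.assoc)
    qed
    then show "y j * (x5 * s) \<in> multiples_mod (ideal.span B) (x5^3) 1" by (simp only: mult.left_commute)
  qed
qed (use p in simp)

lemma forms_5:
  assumes p: "homogeneous 5 p" shows "p \<in> multiples_mod (ideal.span B) (x5^5) 0"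
proof (rule forms_Suc_in_subspace[OF subspace_multiples_mod basis, of 4])
  fix j and q :: "(5, 'k) mpoly" assume q: "homogeneous 4 q"
  show "y j * q \<in> multiples_mod (ideal.span B) (x5^5) 0"
  proof (rule multiples_mod_mult[OF forms_4[OF q]])
    fix s :: "(5, 'k) mpoly" assume s: "homogeneous 1 s"
    have "y j * s \<in> {s. x5^3 * s \<in> multiples_mod (ideal.span B) (x5^5) 0}"
      using forms_2_in_subspace[OF subspace_mult_preimage[OF subspace_multiples_mod] _ homogeneous_mult_1_1[OF hom s]]
        x5_powers_multiples(2) by blast
    then show "y j * (x5^3 * s) \<in> multiples_mod (ideal.span B) (x5^5) 0"
      by (simp only: mem_Collect_eq mult.left_commute)
  qed
qed (use p in simp)

lemma forms_6:
  assumes p: "homogeneous 6 p" shows "p \<in> ideal.span B"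
proof (rule forms_Suc_in_subspace[OF subspace_ideal basis, of 5])
  fix j and q :: "(5, 'k) mpoly" assume "homogeneous 5 q"
  then obtain s r where s: "r \<in> ideal.span B" "q = x5^5 * s + r" using forms_5 multiples_modE by metis
  have "y j * q = s * (y j * x5^5) + y j * r" unfolding s(2) by (simp only: distrib_left mult.commute mult.left_commute)
  then show "y j * q \<in> ideal.span B"
    using x5_socle s(1) by (simp only: ideal.span_add ideal_mult_left)
qed (use p in simp)

end

end

lemma Const_uminus: "Const (- a) = - Const a"
  by (simp add: Const_def single_uminus)

text \<open>In the degrees 3, 4 and 5 the standard monomials are \<open>x5\<close> times those of degree 2, \<open>x5^3\<close> times a
  variable, and \<open>x5^5\<close>, so the Lefschetz property reduces everything to degree 2. There the standard
  monomials span \<open>x3^2\<close> and the multiples of \<open>x4\<close> and \<open>x5\<close>. The forms \<open>x3\<close> and \<open>x4\<close> are a sparse choice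
  of sums of the \<open>y j\<close> for which these generate all products \<open>y j * y k\<close>.\<close>

lemma std_spanning_of_squares:
  fixes y :: "5 \<Rightarrow> (5, 'k::field_char_0) mpoly"
  assumes hom: "\<And>j. homogeneous 1 (y j)"
    and basis: "\<And>v. Var v \<in> mpv.span (range y)"
    and sq: "\<And>j. y j ^ 2 \<in> ideal.span B"
    and x5: "x5 = (\<Sum>j\<in>UNIV. y j)" and x4: "x4 = y 0 + y 1 - y 2" and x3: "x3 = y 0 + y 3"
  shows "std_spanning (ideal.span B)"
proof -
  let ?I = "ideal.span B"
  define R where "R d = {p. \<exists>q. homogeneous d q \<and> (\<forall>m\<in>keys q. std_monom m) \<and> p - q \<in> ?I}" for d
  have RI: "p \<in> R d" if "homogeneous d q" "\<forall>m\<in>keys q. std_monom m" "r \<in> ?I" "p = q + r" for d p q r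
    using that unfolding R_def by auto
  have I_R: "r \<in> R d" if "r \<in> ?I" for r d
    by (rule RI[of d 0 r]) (use that in auto)
  have R: "mpv.subspace (R 2)"
    unfolding mpv.subspace_def
  proof (intro conjI ballI allI)
    show "0 \<in> R 2" by (rule I_R[OF ideal.span_zero])
    fix p q assume "p \<in> R 2" "q \<in> R 2"
    then obtain p' q' where p': "homogeneous 2 p'" "\<forall>m\<in>keys p'. std_monom m" "p - p' \<in> ?I"
      and q': "homogeneous 2 q'" "\<forall>m\<in>keys q'. std_monom m" "q - q' \<in> ?I"
      unfolding R_def by blast
    have "\<forall>m\<in>keys (p' + q'). std_monom m" using Poly_Mapping.keys_add[of p' q'] p'(2) q'(2) by blast
    then show "p + q \<in> R 2"
      by (rule RI[OF homogeneous_add[OF p'(1) q'(1)] _ ideal.span_add[OF p'(3) q'(3)]]) simp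
  next
    fix c p assume "p \<in> R 2"
    then obtain p' where p': "homogeneous 2 p'" "\<forall>m\<in>keys p'. std_monom m" "p - p' \<in> ?I"
      unfolding R_def by blast
    have "\<forall>m\<in>keys (Const c * p'). std_monom m" using p'(2) by (auto simp: in_keys_iff)
    moreover have "Const c * p = Const c * p' + Const c * (p - p')" by (simp only: right_diff_distrib) simp
    ultimately show "Const c * p \<in> R 2"
      by (intro RI[OF homogeneous_Const_mult[OF p'(1)] _ ideal_mult_left[OF p'(3)]])
  qed
  have x4l: "x4 * l \<in> R 2" if l: "homogeneous 1 l" for l
  proof (rule RI[OF homogeneous_mult_1_1[OF homogeneous_Var l] _ ideal.span_zero])
    show "\<forall>m\<in>keys (x4 * l). std_monom m"
      unfolding Var_def by (rule keys_monom_mult_std[OF l]) (simp add: std_monom_def lookup_add)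
  qed simp
  have x5l: "x5 * l \<in> R 2" if l: "homogeneous 1 l" for l
  proof (rule RI[OF homogeneous_mult_1_1[OF homogeneous_Var l] _ ideal.span_zero])
    show "\<forall>m\<in>keys (x5 * l). std_monom m"
      unfolding Var_def by (rule keys_monom_mult_std[OF l]) (simp add: std_monom_def lookup_add)
  qed simp
  have x3x3: "Const c * x3^2 \<in> R 2" for c
  proof (rule RI[OF homogeneous_Const_mult _ ideal.span_zero])
    show "homogeneous 2 (x3^2)" using homogeneous_power[OF homogeneous_Var, of 2] by simp
    show "\<forall>m\<in>keys (Const c * x3^2). std_monom m"
    proof
      fix m assume "m \<in> keys (Const c * x3^2)"
      then have "m = single 2 2"
        unfolding Var_power in_keys_iff by (simp add: lookup_single when_def split: if_splits)
      then show "std_monom m" by (simp add: std_monom_def)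
    qed
  qed simp
  define a b c d e where abcde: "a = y 0" "b = y 1" "c = y 2" "d = y 3" "e = y 4"
  have x: "x5 = a + b + c + d + e" "x4 = a + b - c" "x3 = a + d"
    unfolding abcde using x5 x4 x3 by (simp_all add: sum_5)
  have combine: "p \<in> R 2"
    if "numeral N * p = k * (a + d)^2 + (a + b - c) * l + (a + b + c + d + e) * l' + r"
      "k \<in> range Const" "homogeneous 1 l" "homogeneous 1 l'" "r \<in> ?I" for N p k l l' r
  proof -
    have kx: "k * x3^2 \<in> R 2" using that(2) x3x3 by blast
    have "numeral N * p \<in> R 2"
      unfolding that(1) x(3)[symmetric] x(2)[symmetric] x(1)[symmetric]
      by (rule mpv.subspace_add[OF R mpv.subspace_add[OF R mpv.subspace_add[OF R kx x4l[OF that(3)]]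
            x5l[OF that(4)]] I_R[OF that(5)]])
    then show ?thesis by (rule subspace_cancel_numeral[OF R])
  qed
  have "homogeneous 1 a" "homogeneous 1 b" "homogeneous 1 c" "homogeneous 1 d" "homogeneous 1 e"
    unfolding abcde by (rule hom)+
  note hintros = homogeneous_0 homogeneous_add homogeneous_diff homogeneous_uminus homogeneous_numeral_mult this
  have "a^2 \<in> ?I" "b^2 \<in> ?I" "c^2 \<in> ?I" "d^2 \<in> ?I" "e^2 \<in> ?I"
    unfolding abcde by (rule sq)+
  note sintros = ideal.span_zero ideal.span_add ideal.span_diff ideal.span_neg ideal_mult_left[of _ _ "numeral _"] this
  have kintros: "0 \<in> range Const" "1 \<in> range Const" "2 \<in> range Const" "- 1 \<in> range Const" "- 2 \<in> range Const"
    using Const_0 Const_1 Const_numeral Const_uminus by (metis rangeI)+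
  \<comment> \<open>The coefficients come from solving a linear system for each product.\<close>
  have pairs:
    "y 0 * y 1 \<in> R 2"
    "y 0 * y 2 \<in> R 2"
    "y 0 * y 3 \<in> R 2"
    "y 0 * y 4 \<in> R 2"
    "y 1 * y 2 \<in> R 2"
    "y 1 * y 3 \<in> R 2"
    "y 1 * y 4 \<in> R 2"
    "y 2 * y 3 \<in> R 2"
    "y 2 * y 4 \<in> R 2"
    "y 3 * y 4 \<in> R 2"
  proof -
    have "2 * (a * b) = 0 * (a + d)^2 + (a + b - c) * (a + b + c) + (a + b + c + d + e) * (0) + (c^2 - a^2 - b^2)"
      by algebra
    then show "y 0 * y 1 \<in> R 2"
      unfolding abcde[symmetric] by (rule combine; (intro hintros sintros kintros))
    have "2 * (a * c) = 0 * (a + d)^2 + (a + b - c) * (b + c - a) + (a + b + c + d + e) * (0) + (a^2 + c^2 - b^2)"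
      by algebra
    then show "y 0 * y 2 \<in> R 2"
      unfolding abcde[symmetric] by (rule combine; (intro hintros sintros kintros))
    have "2 * (a * d) = 1 * (a + d)^2 + (a + b - c) * (0) + (a + b + c + d + e) * (0) + (- (a^2) - d^2)"
      by algebra
    then show "y 0 * y 3 \<in> R 2"
      unfolding abcde[symmetric] by (rule combine; (intro hintros sintros kintros))
    have "2 * (a * e) = (- 1) * (a + d)^2 + (a + b - c) * (- (2 * b) - 2 * c) + (a + b + c + d + e) * (2 * a) + (2 * b^2 + d^2 - a^2 - 2 * c^2)"
      by algebra
    then show "y 0 * y 4 \<in> R 2"
      unfolding abcde[symmetric] by (rule combine; (intro hintros sintros kintros))
    have "2 * (b * c) = 0 * (a + d)^2 + (a + b - c) * (a + c - b) + (a + b + c + d + e) * (0) + (b^2 + c^2 - a^2)"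
      by algebra
    then show "y 1 * y 2 \<in> R 2"
      unfolding abcde[symmetric] by (rule combine; (intro hintros sintros kintros))
    have "4 * (b * d) = (- 2) * (a + d)^2 + (a + b - c) * (d - 2 * a - 2 * b - 4 * c - e) + (a + b + c + d + e) * (2 * a + 2 * b + d - e) + (2 * a^2 + d^2 + e^2 - 4 * c^2)"
      by algebra
    then show "y 1 * y 3 \<in> R 2"
      unfolding abcde[symmetric] by (rule combine; (intro hintros sintros kintros))
    have "4 * (b * e) = 2 * (a + d)^2 + (a + b - c) * (2 * b + e - 2 * a - d) + (a + b + c + d + e) * (2 * b + e - 2 * a - d) + (2 * a^2 - 4 * b^2 - d^2 - e^2)"
      by algebra
    then show "y 1 * y 4 \<in> R 2"
      unfolding abcde[symmetric] by (rule combine; (intro hintros sintros kintros))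
    have "4 * (c * d) = 0 * (a + d)^2 + (a + b - c) * (- (2 * a) - 2 * b - 4 * c - 3 * d - e) + (a + b + c + d + e) * (2 * a + 2 * b + d - e) + (e^2 - 4 * c^2 - d^2)"
      by algebra
    then show "y 2 * y 3 \<in> R 2"
      unfolding abcde[symmetric] by (rule combine; (intro hintros sintros kintros))
    have "4 * (c * e) = 0 * (a + d)^2 + (a + b - c) * (- (2 * a) - 2 * b - 4 * c - d - 3 * e) + (a + b + c + d + e) * (2 * a + 2 * b + e - d) + (d^2 - 4 * c^2 - e^2)"
      by algebra
    then show "y 2 * y 4 \<in> R 2"
      unfolding abcde[symmetric] by (rule combine; (intro hintros sintros kintros))
    have "2 * (d * e) = 0 * (a + d)^2 + (a + b - c) * (2 * a + 2 * b + 4 * c + d + e) + (a + b + c + d + e) * (d + e - 2 * a - 2 * b) + (4 * c^2 - d^2 - e^2)"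
      by algebra
    then show "y 3 * y 4 \<in> R 2"
      unfolding abcde[symmetric] by (rule combine; (intro hintros sintros kintros))
  qed
  have sym: "y j * y k \<in> R 2" if "y k * y j \<in> R 2" for j k using that by (simp only: mult.commute)
  have squares: "y j * y j \<in> R 2" for j
    using I_R[OF sq[of j]] by (simp only: power2_eq_square)
  have all: "y j * y k \<in> R 2" for j k
    using exhaust_5[of j] exhaust_5[of k]
    by (elim disjE; hypsubst) (rule squares | rule pairs | rule sym, rule pairs)+
  have d2: "p \<in> R 2" if "homogeneous 2 p" for p
    by (rule forms_2_in_subspace[OF hom basis sq R all that])
  have "\<exists>q. homogeneous n q \<and> (\<forall>m\<in>keys q. std_monom m) \<and> p - q \<in> ?I"
    if n: "2 \<le> n" "n \<le> 6" and p: "homogeneous n p" for n p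
  proof -
    consider "n = 2" | "n = 3" | "n = 4" | "n = 5" | "n = 6" using n by linarith
    then have "p \<in> R n"
    proof cases
      case 1
      then show ?thesis using d2 p by simp
    next
      case 2
      then obtain s r where s: "homogeneous 2 s" "r \<in> ?I" "p = x5 * s + r"
        using forms_3[OF hom basis sq x5, of p] p by (auto elim: multiples_modE)
      obtain q where q: "homogeneous 2 q" "\<forall>m\<in>keys q. std_monom m" "s - q \<in> ?I"
        using d2[OF s(1)] unfolding R_def by blast
      show ?thesis unfolding 2
      proof (rule RI[OF _ _ ideal.span_add[OF ideal_mult_left[OF q(3)] s(2)]])
        show "homogeneous 3 (x5 * q)"
          using homogeneous_mult[OF homogeneous_Var q(1)] by (simp add: numeral_3_eq_3)
        show "\<forall>m\<in>keys (x5 * q). std_monom m"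
        proof
          fix m assume "m \<in> keys (x5 * q)"
          then obtain m' where m': "m = single 4 1 + m'" "m' \<in> keys q"
            using Poly_Mapping.keys_mult[of "x5 :: (5, 'k) mpoly" q] unfolding Var_def by auto
          then have "std_monom m'" "deg_monom m' = 2" using q by (auto simp: homogeneous_def)
          then show "std_monom m" unfolding m'(1) by (auto simp: std_monom_def lookup_add lookup_single)
        qed
        show "p = x5 * q + (x5 * (s - q) + r)" unfolding s(3) by (simp only: right_diff_distrib) simp
      qed
    next
      case 3
      then obtain s r where s: "homogeneous 1 s" "r \<in> ?I" "p = x5^3 * s + r"
        using forms_4[OF hom basis sq x5, of p] p by (auto elim: multiples_modE)
      show ?thesis unfolding 3
      proof (rule RI[OF _ _ s(2,3)])
        show "homogeneous 4 (x5^3 * s)"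
          using homogeneous_mult[OF homogeneous_power[OF homogeneous_Var, of 3] s(1)] by simp
        show "\<forall>m\<in>keys (x5^3 * s). std_monom m"
          unfolding Var_power by (rule keys_monom_mult_std[OF s(1)]) (simp add: std_monom_def lookup_add)
      qed
    next
      case 4
      then obtain s r where s: "homogeneous 0 s" "r \<in> ?I" "p = x5^5 * s + r"
        using forms_5[OF hom basis sq x5, of p] p by (auto elim: multiples_modE)
      show ?thesis unfolding 4
      proof (rule RI[OF _ _ s(2,3)])
        show "homogeneous 5 (x5^5 * s)"
          using homogeneous_mult[OF homogeneous_power[OF homogeneous_Var, of 5] s(1)] by simp
        show "\<forall>m\<in>keys (x5^5 * s). std_monom m"
          unfolding Var_power by (rule keys_monom_mult_std[OF s(1)]) (simp add: std_monom_def lookup_add)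
      qed
    next
      case 5
      then show ?thesis using forms_6[OF hom basis sq x5, of p] p by (intro I_R) simp
    qed
    then show ?thesis by (simp add: R_def)
  qed
  then show ?thesis unfolding std_spanning_def by blast
qed

definition tuple5 :: "'a \<Rightarrow> 'a \<Rightarrow> 'a \<Rightarrow> 'a \<Rightarrow> 'a \<Rightarrow> 5 \<Rightarrow> 'a"
  where "tuple5 a b c d e i = (if i = 0 then a else if i = 1 then b else if i = 2 then c else if i = 3 then d else e)"

lemma tuple5_simps [simp]:
  "tuple5 a b c d e 0 = a" "tuple5 a b c d e 1 = b" "tuple5 a b c d e 2 = c"
  "tuple5 a b c d e 3 = d" "tuple5 a b c d e 4 = e"
  by (simp_all add: tuple5_def)

text \<open>The columns express five forms \<open>y 0, ..., y 4\<close> by the variables. They are determined by \<open>x1 = y 0\<close>,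
  \<open>x2 = y 1\<close>, \<open>x3 = y 0 + y 3\<close>, \<open>x4 = y 0 + y 1 - y 2\<close> and \<open>x5 = y 0 + y 1 + y 2 + y 3 + y 4\<close>.\<close>

definition good_matrix :: "'k::field ^ 5 ^ 5"
  where "good_matrix = (\<chi> i j. tuple5
    (tuple5 1 0 1 (-1) (-1))
    (tuple5 0 1 1 0 (-2))
    (tuple5 0 0 0 1 (-1))
    (tuple5 0 0 (-1) 0 1)
    (tuple5 0 0 0 0 1) i j)"

definition good_matrix_inv :: "'k::field ^ 5 ^ 5"
  where "good_matrix_inv = (\<chi> i j. tuple5
    (tuple5 1 0 1 1 1)
    (tuple5 0 1 0 1 1)
    (tuple5 0 0 0 (-1) 1)
    (tuple5 0 0 1 0 1)
    (tuple5 0 0 0 0 1) i j)"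

lemma good_matrix_inverse:
  "good_matrix ** good_matrix_inv = mat 1" "good_matrix_inv ** good_matrix = mat 1"
  by (simp_all add: vec_eq_iff forall_5 matrix_matrix_mult_def sum_5 good_matrix_def good_matrix_inv_def mat_def)

lemma invertible_good_matrix: "invertible good_matrix"
  using good_matrix_inverse by (auto simp: invertible_def)

lemma good_forms:
  "lin_change good_matrix (Var 0) = x1" "lin_change good_matrix (Var 1) = x2"
  "lin_change good_matrix (Var 2) = x1 + x2 - x4" "lin_change good_matrix (Var 3) = x3 - x1"
  "lin_change good_matrix (Var 4) = x5 + x4 - x3 - x1 - 2 * x2"
  by (simp_all add: lin_change_Var sum_5 good_matrix_def Const_uminus)

lemma std_spanning_good_squares:
  fixes B :: "(5, 'k::field_char_0) mpoly set"
  assumes "\<And>j. lin_change good_matrix (Var j) ^ 2 \<in> ideal.span B"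
  shows "std_spanning (ideal.span B)"
proof (rule std_spanning_of_squares[where y = "\<lambda>j. lin_change good_matrix (Var j)"])
  show "homogeneous 1 (lin_change good_matrix (Var j))" for j
    by (rule homogeneous_lin_change[OF homogeneous_Var])
  show "Var v \<in> mpv.span (range (\<lambda>j. lin_change good_matrix (Var j)))" for v
  proof -
    have "Var v = lin_change good_matrix (lin_change good_matrix_inv (Var v))"
      by (simp only: lin_change_compose good_matrix_inverse lin_change_mat_1)
    also have "\<dots> = (\<Sum>j\<in>UNIV. Const (good_matrix_inv $ j $ v) * lin_change good_matrix (Var j))"
      unfolding lin_change_Var[of good_matrix_inv]
      by (simp only: ring_map_sum[OF ring_map_lin_change] ring_mapD(4)[OF ring_map_lin_change] lin_change_Const)
    also have "\<dots> \<in> mpv.span (range (\<lambda>j. lin_change good_matrix (Var j)))"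
      by (intro mpv.span_sum mpv.span_scale mpv.span_base rangeI)
    finally show ?thesis .
  qed
  show "lin_change good_matrix (Var j) ^ 2 \<in> ideal.span B" for j by (rule assms)
  show "x5 = (\<Sum>j\<in>UNIV. lin_change good_matrix (Var j))"
    unfolding sum_5 good_forms by simp
  show "x4 = lin_change good_matrix (Var 0) + lin_change good_matrix (Var 1) - lin_change good_matrix (Var 2)"
    unfolding good_forms by simp
  show "x3 = lin_change good_matrix (Var 0) + lin_change good_matrix (Var 3)"
    unfolding good_forms by simp
qed

section \<open>Degeneration to the squares of the variables\<close>

definition rank_below :: "'v::{finite,linorder} \<Rightarrow> nat"
  where "rank_below v = card {..<v}"

text \<open>The exponent of \<open>t\<close> that a monomial acquires when each variable is scaled by \<open>t\<close> to the number of
  preceding variables.\<close>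

definition weight :: "'v::{finite,linorder} monom \<Rightarrow> nat"
  where "weight m = (\<Sum>v\<in>UNIV. rank_below v * lookup m v)"

lemma rank_below_strict_mono: "v < w \<Longrightarrow> rank_below v < rank_below w"
  unfolding rank_below_def by (rule psubset_card_mono) auto

text \<open>Later variables have larger weight, so the pure power of the first variable is the unique monomial
  of least weight. This isolates it in the limit \<open>t = 0\<close>.\<close>

lemma weight_lower_bound:
  assumes m: "keys m \<subseteq> {i..}"
  shows "rank_below i * deg_monom m \<le> weight m"
    and "rank_below i * deg_monom m = weight m \<Longrightarrow> m = single i (deg_monom m)"
proof -
  have le: "rank_below i * lookup m v \<le> rank_below v * lookup m v" for v
  proof (cases "lookup m v = 0")
    case False
    then have "v \<in> keys m" by (simp add: in_keys_iff)
    then have "i \<le> v" using m by auto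
    then have "rank_below i \<le> rank_below v" using rank_below_strict_mono[of i v] by (auto simp: le_less)
    then show ?thesis by simp
  qed simp
  have deg: "rank_below i * deg_monom m = (\<Sum>v\<in>UNIV. rank_below i * lookup m v)"
    by (simp only: deg_monom_UNIV sum_distrib_left)
  show "rank_below i * deg_monom m \<le> weight m"
    unfolding deg weight_def by (rule sum_mono[OF le])
  assume eq: "rank_below i * deg_monom m = weight m"
  have "lookup m v = 0" if "v \<noteq> i" for v
  proof (rule ccontr)
    assume nz: "lookup m v \<noteq> 0"
    then have "v \<in> keys m" by (simp add: in_keys_iff)
    then have "i < v" using m that by force
    then have "rank_below i * lookup m v < rank_below v * lookup m v"
      using rank_below_strict_mono nz by simp
    then have "(\<Sum>v\<in>UNIV. rank_below i * lookup m v) < (\<Sum>v\<in>UNIV. rank_below v * lookup m v)"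
      using le by (intro sum_strict_mono_ex1) auto
    then show False using eq unfolding deg weight_def by simp
  qed
  then have m': "m = single i (lookup m i)"
    by (intro poly_mapping_eqI) (auto simp: lookup_single when_def)
  then have "deg_monom m = lookup m i" by (metis deg_monom_single)
  then show "m = single i (deg_monom m)" using m' by simp
qed

definition scaling_matrix :: "'k::field \<Rightarrow> 'k ^ 'n::{finite,linorder} ^ 'n::{finite,linorder}"
  where "scaling_matrix t = (\<chi> i j. if i = j then t ^ rank_below i else 0)"

lemma invertible_scaling_matrix: "t \<noteq> 0 \<Longrightarrow> invertible (scaling_matrix t)"
  unfolding invertible_det_nz by (subst det_diagonal) (auto simp: scaling_matrix_def)

lemma lin_change_monom:
  "lin_change A (single m 1) = (\<Prod>v\<in>UNIV. lin_change A (Var v) ^ lookup m v)"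
  unfolding monom_value_Var[symmetric] monom_value_superset[OF finite subset_UNIV]
  by (simp only: ring_map_prod[OF ring_map_lin_change] ring_map_power[OF ring_map_lin_change])

lemma lin_change_scaling_monom:
  "lin_change (scaling_matrix t) (single m 1) = Const (t ^ weight m) * single m 1"
proof -
  have Var: "lin_change (scaling_matrix t) (Var v) = Const (t ^ rank_below v) * Var v" for v :: 'a
  proof -
    have "lin_change (scaling_matrix t) (Var v) = (\<Sum>i\<in>UNIV. if i = v then Const (t ^ rank_below v) * Var v else 0)"
      unfolding lin_change_Var scaling_matrix_def by (intro sum.cong) auto
    then show ?thesis by simp
  qed
  have "lin_change (scaling_matrix t) (single m 1)
      = (\<Prod>v\<in>UNIV. Const (t ^ (rank_below v * lookup m v)) * Var v ^ lookup m v)"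
    unfolding lin_change_monom Var by (simp only: power_mult_distrib Const_power[symmetric] power_mult[symmetric])
  also have "\<dots> = (\<Prod>v\<in>UNIV. Const (t ^ (rank_below v * lookup m v))) * single m 1"
    unfolding prod.distrib monom_value_Var[symmetric] monom_value_superset[OF finite subset_UNIV] ..
  also have "(\<Prod>v\<in>UNIV. Const (t ^ (rank_below v * lookup m v))) = Const (t ^ weight m)"
    unfolding weight_def power_sum by (rule ring_map_prod[OF ring_map_Const, symmetric])
  finally show ?thesis .
qed

lemma std_spanning_mono: "std_spanning I \<Longrightarrow> I \<subseteq> I' \<Longrightarrow> std_spanning I'"
  unfolding std_spanning_def by blast

text \<open>Scale the variables and divide the form \<open>f i\<close> by the power of \<open>t\<close> that belongs to the square of
  variable \<open>i\<close>. By the weight bound the result is polynomial in \<open>t\<close>, and at \<open>t = 0\<close> only a multiple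
  of this square remains. After the change of coordinates given by \<open>good_matrix\<close> the limit satisfies the
  criterion, hence so does the family at some \<open>t\<close> other than 0, where it generates the same ideal as a
  linear change of the \<open>f i\<close>.\<close>

lemma triangular_forms_std_spanning:
  fixes f :: "5 \<Rightarrow> (5, 'k::field_char_0) mpoly"
  assumes f: "\<And>i. homogeneous 2 (f i)" "\<And>i. f i \<in> polys_in {i..}"
    and nz: "\<And>i. lookup (f i) (single i 2) \<noteq> 0"
  shows "\<exists>A. invertible A \<and> std_spanning (ideal.span (range (\<lambda>i. lin_change A (f i))))"
proof -
  let ?A = "good_matrix :: 'k ^ 5 ^ 5"
  let ?y = "\<lambda>m. lin_change ?A (single m 1)"
  \<comment> \<open>The truncated subtraction is harmless: monomials of \<open>f i\<close> have at least the weight of the square of variable \<open>i\<close>.\<close>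
  define F where "F t i = (\<Sum>m\<in>keys (f i). Const (lookup (f i) m * t ^ (weight m - rank_below i * 2)) * ?y m)" for t i
  have m: "deg_monom m = 2" "keys m \<subseteq> {i..}" if "m \<in> keys (f i)" for m i
    using that f by (auto simp: homogeneous_def polys_in_def)
  have homF: "homogeneous 2 (F t i)" for t i
    unfolding F_def
    by (intro homogeneous_sum homogeneous_Const_mult homogeneous_lin_change homogeneous_single m(1))
  have F0: "F 0 i = Const (lookup (f i) (single i 2)) * lin_change ?A (Var i) ^ 2" for i
  proof -
    have key: "single i 2 \<in> keys (f i)" using nz by (simp add: in_keys_iff)
    have z: "weight m - rank_below i * 2 \<noteq> 0" if "m \<in> keys (f i) - {single i 2}" for m
      using weight_lower_bound[OF m(2), of m i] m(1)[of m i] that by force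
    have "F 0 i = Const (lookup (f i) (single i 2) * 0 ^ (weight (single i 2 :: 5 monom) - rank_below i * 2)) * ?y (single i 2)
        + (\<Sum>m\<in>keys (f i) - {single i 2}. Const (lookup (f i) m * 0 ^ (weight m - rank_below i * 2)) * ?y m)"
      unfolding F_def using key by (intro sum.remove) simp_all
    also have "(\<Sum>m\<in>keys (f i) - {single i 2}. Const (lookup (f i) m * 0 ^ (weight m - rank_below i * 2)) * ?y m) = 0"
      by (intro sum.neutral ballI) (simp only: power_0_left z if_False mult_zero_right Const_0 mult_zero_left)
    also have "weight (single i 2 :: 5 monom) - rank_below i * 2 = 0"
      by (simp add: weight_def lookup_single when_def if_distrib cong: if_cong)
    also have "?y (single i 2) = lin_change ?A (Var i) ^ 2"
      by (simp only: Var_power[symmetric] ring_map_power[OF ring_map_lin_change])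
    finally show ?thesis by simp
  qed
  have "std_spanning (ideal.span (range (F 0)))"
  proof (rule std_spanning_good_squares)
    fix i
    have "Const (1 / lookup (f i) (single i 2)) * F 0 i
        = Const (1 / lookup (f i) (single i 2) * lookup (f i) (single i 2)) * lin_change ?A (Var i) ^ 2"
      unfolding F0 Const_mult by (simp only: mult.assoc)
    also have "\<dots> = lin_change ?A (Var i) ^ 2" using nz[of i] by simp
    finally show "lin_change ?A (Var i) ^ 2 \<in> ideal.span (range (F 0))"
      using ideal_mult_left[OF ideal.span_base[OF rangeI]] by metis
  qed
  moreover have "poly_family (\<lambda>t (u::unit). t) (\<lambda>t. F t i)" for i
    unfolding F_def
    by (intro poly_family_sum poly_family_mult poly_family_Const poly_family_const poly_fun_mult
        poly_fun_const poly_fun_power poly_fun_coord[of "\<lambda>t (u::unit). t" "()"])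
  ultimately obtain g where g: "poly_fun (\<lambda>t (u::unit). t) g" "g 0 \<noteq> 0"
    "\<And>t. g t \<noteq> 0 \<Longrightarrow> std_spanning (ideal.span (range (F t)))"
    using std_spanning_open[of "\<lambda>t (u::unit). t" F 0] homF by blast
  have "\<exists>q. \<forall>t. g t = poly q t"
    by (rule poly_fun_along_curve[OF g(1), of "\<lambda>t. t"]) (auto intro!: exI[of _ "[:0, 1:]"])
  then obtain q where q: "\<And>t. g t = poly q t" by blast
  have "q \<noteq> 0" using g(2) q by auto
  then have "finite (insert 0 {t. poly q t = 0})" by (simp add: poly_roots_finite)
  then obtain t where t: "t \<noteq> 0" "g t \<noteq> 0"
    using ex_new_if_finite[OF infinite_UNIV_char_0] q by force
  let ?M = "?A ** scaling_matrix t"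
  have F: "F t i = Const (1 / t ^ (rank_below i * 2)) * lin_change ?M (f i)" for i
  proof -
    have "lin_change ?M (f i) = lin_change ?A (lin_change (scaling_matrix t) (\<Sum>m\<in>keys (f i). Const (lookup (f i) m) * single m 1))"
      by (simp only: lin_change_compose single_eq_Const_mult[symmetric] sum_single_keys)
    also have "\<dots> = (\<Sum>m\<in>keys (f i). Const (lookup (f i) m) * (Const (t ^ weight m) * ?y m))"
      by (simp only: ring_map_sum[OF ring_map_lin_change] ring_mapD(4)[OF ring_map_lin_change]
          lin_change_Const lin_change_scaling_monom)
    finally have *: "lin_change ?M (f i) = (\<Sum>m\<in>keys (f i). Const (lookup (f i) m) * (Const (t ^ weight m) * ?y m))" .
    show ?thesis
      unfolding F_def * sum_distrib_left
    proof (intro sum.cong refl)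
      fix m' assume m': "m' \<in> keys (f i)"
      have "rank_below i * 2 \<le> weight m'"
        using weight_lower_bound(1)[OF m(2)[OF m']] m(1)[OF m'] by simp
      then have "lookup (f i) m' * t ^ (weight m' - rank_below i * 2)
          = 1 / t ^ (rank_below i * 2) * (lookup (f i) m' * t ^ weight m')"
        using t(1) by (simp add: power_diff)
      then show "Const (lookup (f i) m' * t ^ (weight m' - rank_below i * 2)) * ?y m'
          = Const (1 / t ^ (rank_below i * 2)) * (Const (lookup (f i) m') * (Const (t ^ weight m') * ?y m'))"
        by (simp only: Const_mult mult.assoc)
    qed
  qed
  have "range (F t) \<subseteq> ideal.span (range (\<lambda>i. lin_change ?M (f i)))"
    unfolding F by (auto intro!: ideal_mult_left intro: ideal.span_base)
  then have "ideal.span (range (F t)) \<subseteq> ideal.span (range (\<lambda>i. lin_change ?M (f i)))"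
    by (intro ideal.span_minimal ideal.subspace_span)
  from std_spanning_mono[OF g(3)[OF t(2)] this]
  have "std_spanning (ideal.span (range (\<lambda>i. lin_change ?M (f i))))" .
  moreover have "invertible ?M"
    by (rule invertible_mult[OF invertible_good_matrix invertible_scaling_matrix[OF t(1)]])
  ultimately show ?thesis by blast
qed

section \<open>The Hilbert function of a regular sequence of quadrics\<close>

definition forms_of :: "('v, 'k::field) mpoly set \<Rightarrow> nat \<Rightarrow> ('v, 'k) mpoly set"
  where "forms_of I n = {p \<in> I. homogeneous n p}"

definition form_dim :: "(5, 'k::field) mpoly set \<Rightarrow> nat \<Rightarrow> nat"
  where "form_dim I n = mpv.dim (forms_of I n)"

lemma independent_forms_bound:
  fixes D :: "(5, 'k::field) mpoly set"
  assumes "mpv.independent D" "\<And>p. p \<in> D \<Longrightarrow> homogeneous n p"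
  shows "finite D \<and> card D \<le> (n + 4) choose n"
proof -
  have "D \<subseteq> mpv.span (monoms {m. deg_monom m = n})"
    using homogeneous_in_span_monoms assms(2) by blast
  from mpv.independent_span_bound[OF _ assms(1) this] show ?thesis
    by (simp add: finite_monoms_5 card_monoms card_monoms_5)
qed

lemma form_basisE:
  fixes I :: "(5, 'k::field) mpoly set"
  obtains D where "D \<subseteq> forms_of I n" "mpv.independent D" "forms_of I n \<subseteq> mpv.span D"
    "card D = form_dim I n" "finite D"
proof -
  obtain D where D: "D \<subseteq> forms_of I n" "mpv.independent D" "forms_of I n \<subseteq> mpv.span D"
    "card D = mpv.dim (forms_of I n)" by (rule mpv.basis_exists)
  moreover have "finite D"
    using independent_forms_bound[OF D(2), of n] D(1) by (auto simp: forms_of_def)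
  ultimately show thesis using that by (simp add: form_dim_def)
qed

lemma form_dim_UNIV: "form_dim (UNIV :: (5, 'k::field) mpoly set) n = (n + 4) choose n"
proof -
  have "card (monoms {m :: 5 monom. deg_monom m = n} :: (5, 'k) mpoly set)
      = mpv.dim (forms_of (UNIV :: (5, 'k) mpoly set) n)"
    by (rule mpv.basis_card_eq_dim)
       (auto simp: forms_of_def homogeneous_single independent_monoms homogeneous_in_span_monoms)
  then show ?thesis by (simp add: form_dim_def card_monoms card_monoms_5)
qed

lemma form_dim_full:
  fixes I :: "(5, 'k::field) mpoly set"
  assumes I: "mpv.subspace I" and full: "form_dim I n = (n + 4) choose n" and p: "homogeneous n p"
  shows "p \<in> I"
proof -
  obtain D where D: "D \<subseteq> forms_of I n" "mpv.independent D" "card D = form_dim I n" "finite D"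
    by (rule form_basisE)
  have homD: "homogeneous n q" if "q \<in> D" for q using D(1) that by (auto simp: forms_of_def)
  have "p \<in> mpv.span D"
  proof (rule ccontr)
    assume np: "p \<notin> mpv.span D"
    then have "p \<notin> D" using mpv.span_base by blast
    have "mpv.independent (insert p D)" by (rule mpv.independent_insertI[OF np D(2)])
    from independent_forms_bound[OF this, of n] have "card (insert p D) \<le> (n + 4) choose n"
      using p homD by blast
    then show False using \<open>p \<notin> D\<close> D(3,4) full by simp
  qed
  moreover have "mpv.span D \<subseteq> I" using D(1) by (intro mpv.span_minimal I) (auto simp: forms_of_def)
  ultimately show ?thesis by blast
qed

text \<open>Multiplication by \<open>h\<close> is injective on the quotient by the ideal \<open>I\<close> generated by \<open>F\<close>. So a basis of the
  degree \<open>n + 2\<close> part of \<open>I\<close>, together with the multiples by \<open>h\<close> of a basis of a complement of \<open>I\<close> in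
  degree \<open>n\<close>, is a basis of the enlarged ideal in degree \<open>n + 2\<close>.\<close>

lemma form_dim_step:
  fixes F :: "(5, 'k::field) mpoly set"
  assumes F: "\<And>f. f \<in> F \<Longrightarrow> \<exists>e. homogeneous e f" and h: "homogeneous 2 h" "h \<noteq> 0"
    and reg: "\<And>g. g * h \<in> ideal.span F \<Longrightarrow> g \<in> ideal.span F"
  shows "form_dim (ideal.span (insert h F)) (n + 2) + form_dim (ideal.span F) n
    = form_dim (ideal.span F) (n + 2) + ((n + 4) choose n)"
proof -
  let ?I = "ideal.span F" and ?J = "ideal.span (insert h F)"
  obtain B' where B': "B' \<subseteq> forms_of ?I n" "mpv.independent B'" "forms_of ?I n \<subseteq> mpv.span B'"
    "card B' = form_dim ?I n" "finite B'" by (rule form_basisE)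
  have "B' \<subseteq> forms_of UNIV n" using B'(1) by (auto simp: forms_of_def)
  then obtain B where B: "B' \<subseteq> B" "B \<subseteq> forms_of UNIV n" "mpv.independent B" "forms_of UNIV n \<subseteq> mpv.span B"
    using mpv.maximal_independent_subset_extend[OF _ B'(2)] by metis
  have cardB: "card B = (n + 4) choose n"
    using mpv.basis_card_eq_dim[OF B(2,4,3)] form_dim_UNIV[of n, where 'k = 'k] by (simp add: form_dim_def)
  have finB: "finite B" using independent_forms_bound[OF B(3), of n] B(2) by (auto simp: forms_of_def)
  \<comment> \<open>A basis of a complement of the ideal in degree \<open>n\<close>.\<close>
  define C where "C = B - B'"
  have cardC: "card C + card B' = card B"
    using B(1) finB B'(5) by (simp add: C_def card_Diff_subset card_mono)
  have finC: "finite C" using finB by (simp add: C_def)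
  have indC: "mpv.independent C" using B(3) by (rule mpv.independent_mono) (simp add: C_def)
  obtain D where D: "D \<subseteq> forms_of ?I (n + 2)" "mpv.independent D" "forms_of ?I (n + 2) \<subseteq> mpv.span D"
    "card D = form_dim ?I (n + 2)" "finite D" by (rule form_basisE)
  have span_C: "w \<in> mpv.span C \<Longrightarrow> w \<in> ?I \<Longrightarrow> w = 0" for w
  proof -
    assume w: "w \<in> mpv.span C" "w \<in> ?I"
    have "mpv.span C \<subseteq> {p. homogeneous n p}"
      using B(2) by (intro mpv.span_minimal)
        (auto simp: mpv.subspace_def C_def forms_of_def intro: homogeneous_add homogeneous_Const_mult)
    then have "w \<in> forms_of ?I n" using w by (auto simp: forms_of_def)
    then have "w \<in> mpv.span B'" using B'(3) by blast
    moreover have "B \<subseteq> mpv.span (B' \<union> C)" by (auto simp: C_def intro: mpv.span_base)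
    ultimately show "w = 0"
      using mpv.span_Int_trivial_by_counting[OF B(3) _ B'(5) finC _ _ w(1)] cardC by simp
  qed
  let ?E = "D \<union> (\<lambda>c. c * h) ` C"
  have inj: "inj_on (\<lambda>c. c * h) C" using h(2) by (auto intro: inj_onI)
  have disj: "D \<inter> (\<lambda>c. c * h) ` C = {}"
  proof (rule ccontr)
    assume "D \<inter> (\<lambda>c. c * h) ` C \<noteq> {}"
    then obtain c where c: "c \<in> C" "c * h \<in> D" by auto
    then have "c \<in> ?I" using D(1) reg by (auto simp: forms_of_def)
    then have "c = 0" using span_C[OF mpv.span_base[OF c(1)]] by blast
    then show False using indC c(1) mpv.dependent_zero by blast
  qed
  have "mpv.independent ?E"
  proof (rule mpv.independent_if_scalars_zero)
    show "finite ?E" using D(5) finC by simp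
    fix u x assume sum: "(\<Sum>x\<in>?E. Const (u x) * x) = 0" and x: "x \<in> ?E"
    define w where "w = (\<Sum>c\<in>C. Const (u (c * h)) * c)"
    have "(\<Sum>x\<in>?E. Const (u x) * x) = (\<Sum>x\<in>D. Const (u x) * x) + (\<Sum>x\<in>(\<lambda>c. c * h) ` C. Const (u x) * x)"
      by (rule sum.union_disjoint) (use D(5) finC disj in auto)
    also have "(\<Sum>x\<in>(\<lambda>c. c * h) ` C. Const (u x) * x) = w * h"
      unfolding w_def sum_distrib_right by (subst sum.reindex[OF inj]) (intro sum.cong refl, simp only: o_apply mult.assoc)
    finally have eq: "(\<Sum>x\<in>D. Const (u x) * x) + w * h = 0" using sum by simp
    have DI: "(\<Sum>x\<in>D. Const (u x) * x) \<in> ?I"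
      by (intro ideal.span_sum ideal_mult_left) (use D(1) in \<open>auto simp: forms_of_def\<close>)
    have "w * h = - (\<Sum>x\<in>D. Const (u x) * x)" using eq by (simp only: add_eq_0_iff)
    then have "w * h \<in> ?I" using ideal.span_neg[OF DI] by simp
    then have "w \<in> ?I" by (rule reg)
    moreover have "w \<in> mpv.span C" unfolding w_def by (intro mpv.span_sum mpv.span_scale mpv.span_base)
    ultimately have w0: "w = 0" using span_C by blast
    have "u (c * h) = 0" if "c \<in> C" for c
      using mpv.independentD[OF indC finC order_refl w0[unfolded w_def] that] .
    moreover have "u x = 0" if "x \<in> D" for x
      by (rule mpv.independentD[OF D(2) D(5) order_refl _ that]) (use eq w0 in simp)
    ultimately show "u x = 0" using x by auto
  qed
  moreover have "?E \<subseteq> forms_of ?J (n + 2)"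
  proof -
    have "?I \<subseteq> ?J" by (intro ideal.span_mono) auto
    moreover have "homogeneous (n + 2) (c * h)" if "c \<in> C" for c
      using B(2) that by (intro homogeneous_mult[OF _ h(1)]) (auto simp: C_def forms_of_def)
    moreover have "c * h \<in> ?J" for c by (intro ideal_mult_left ideal.span_base) simp
    ultimately show ?thesis using D(1) by (auto simp: forms_of_def)
  qed
  moreover have "forms_of ?J (n + 2) \<subseteq> mpv.span ?E"
  proof
    fix p assume "p \<in> forms_of ?J (n + 2)"
    then have p: "p \<in> ?J" "homogeneous (n + 2) p" by (auto simp: forms_of_def)
    obtain g where g: "p - g * h \<in> ?I" using p(1) unfolding ideal.span_insert by blast
    have "p = hom_comp (n + 2) ((p - g * h) + g * h)" using p(2) by (simp add: hom_comp_homogeneous)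
    also have "\<dots> = hom_comp (n + 2) (p - g * h) + hom_comp n g * h"
      by (simp only: hom_comp_add hom_comp_mult_homogeneous[OF h(1)])
    also have "\<dots> \<in> mpv.span ?E"
    proof (rule mpv.span_add)
      have "hom_comp (n + 2) (p - g * h) \<in> forms_of ?I (n + 2)"
        using hom_comp_in_ideal[OF F g] by (simp add: forms_of_def homogeneous_hom_comp)
      then show "hom_comp (n + 2) (p - g * h) \<in> mpv.span ?E"
        using D(3) mpv.span_mono[of D ?E] by blast
      have "hom_comp n g \<in> mpv.span B" using B(4) by (auto simp: forms_of_def homogeneous_hom_comp)
      then show "hom_comp n g * h \<in> mpv.span ?E"
      proof (rule mult_in_span)
        fix x assume x: "x \<in> B"
        show "x * h \<in> mpv.span ?E"
        proof (cases "x \<in> B'")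
          case True
          then have "x \<in> ?I" "homogeneous n x" using B'(1) by (auto simp: forms_of_def)
          then have "x * h \<in> forms_of ?I (n + 2)"
            using homogeneous_mult[OF _ h(1), of n x] by (simp add: forms_of_def ideal_mult_right)
          then show ?thesis using D(3) mpv.span_mono[of D ?E] by blast
        next
          case False
          then show ?thesis using x by (intro mpv.span_base) (auto simp: C_def)
        qed
      qed
    qed
    finally show "p \<in> mpv.span ?E" .
  qed
  ultimately have "card ?E = form_dim ?J (n + 2)"
    unfolding form_dim_def by (intro mpv.basis_card_eq_dim)
  moreover have "card ?E = card D + card C"
    using D(5) finC disj by (simp add: card_Un_disjoint card_image[OF inj])
  ultimately show ?thesis using cardC cardB B'(4) D(4) by linarith
qed

lemma form_dim_0_eq_0:
  assumes F: "\<And>f. f \<in> F \<Longrightarrow> homogeneous 2 f"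
  shows "form_dim (ideal.span F) 0 = 0"
proof -
  have comp: "hom_comp 0 p = 0" if "p \<in> ideal.span F" for p
    using that
  proof (induction p rule: ideal.span_induct_alt)
    case base
    show ?case by (simp add: hom_comp_homogeneous[of 0])
  next
    case (step c f y)
    then show ?case
      using hom_comp_mult_homogeneous_small[OF F[OF step(1)], of 0 c] by (simp add: hom_comp_add)
  qed
  have "p = 0" if "p \<in> forms_of (ideal.span F) 0" for p
    using that comp[of p] by (auto simp: forms_of_def hom_comp_homogeneous)
  then have "forms_of (ideal.span F) 0 \<subseteq> mpv.span {}" by auto
  from mpv.dim_le_card[OF this] show ?thesis by (simp add: form_dim_def)
qed

text \<open>The Hilbert series of the quotient is \<open>(1 + T)^5\<close>, which has no term of degree 6. Each quadric
  shifts degrees by 2, so the recursion stays within the degrees 0, 2, 4 and 6.\<close>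

lemma regular_quadrics_socle_bound:
  fixes f :: "5 \<Rightarrow> (5, 'k::field) mpoly"
  assumes f: "\<And>i. homogeneous 2 (f i)" and reg: "regular_sequence f" and p: "homogeneous 6 p"
  shows "p \<in> ideal.span (range f)"
proof -
  have one: "1 \<notin> ideal.span (range f)"
  proof
    assume "1 \<in> ideal.span (range f)"
    then have "q \<in> ideal.span (range f)" for q using ideal_mult_left[of 1 "range f" q] by simp
    then show False using reg by (auto simp: regular_sequence_def)
  qed
  have regD: "g \<in> ideal.span (f ` {..<i})" if "g * f i \<in> ideal.span (f ` {..<i})" for g i
    using reg that by (auto simp: regular_sequence_def)
  have nz: "f i \<noteq> 0" for i
  proof
    assume "f i = 0"
    then have "1 \<in> ideal.span (f ` {..<i})" using regD[of 1 i] by (simp add: ideal.span_zero)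
    then show False using one ideal.span_mono[of "f ` {..<i}" "range f"] by blast
  qed
  have step: "form_dim (ideal.span (insert (f i) (f ` {..<i}))) m + form_dim (ideal.span (f ` {..<i})) n
    = form_dim (ideal.span (f ` {..<i})) m + ((n + 4) choose n)" if "m = n + 2" for i m n
    unfolding that by (rule form_dim_step[OF _ f nz regD]) (use f in auto)
  let ?d = "\<lambda>A n. form_dim (ideal.span (f ` A)) n"
  have sets: "{..<0} = ({} :: 5 set)" "{..<1::5} = insert 0 {..<0}" "{..<2::5} = insert 1 {..<1}"
    "{..<3::5} = insert 2 {..<2}" "{..<4::5} = insert 3 {..<3}" "(UNIV :: 5 set) = insert 4 {..<4}"
    by (simp_all add: set_eq_iff forall_5 less_5 less_5[THEN less_not_sym])
  have d0: "?d A 0 = 0" for A by (rule form_dim_0_eq_0) (use f in auto)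
  have E: "?d {} n = 0" for n
  proof -
    have "forms_of (ideal.span (f ` {})) n \<subseteq> mpv.span {}" by (auto simp: forms_of_def)
    from mpv.dim_le_card[OF this] show ?thesis by (simp add: form_dim_def)
  qed
  have binom: "(4::nat) choose 0 = 1" "(6::nat) choose 2 = 15" "(8::nat) choose 4 = 70" "(10::nat) choose 6 = 210"
    by (simp_all add: eval_nat_numeral)
  have s: "?d (insert i {..<i}) 2 = ?d {..<i} 2 + 1"
    "?d (insert i {..<i}) 4 + ?d {..<i} 2 = ?d {..<i} 4 + 15"
    "?d (insert i {..<i}) 6 + ?d {..<i} 4 = ?d {..<i} 6 + 70" for i
    using step[of 2 0 i] step[of 4 2 i] step[of 6 4 i] d0[of "{..<i}"] binom by simp_all
  have 1: "?d {..<1} 2 = 1" "?d {..<1} 4 = 15" "?d {..<1} 6 = 70"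
    using s[of 0] E unfolding sets(2) sets(1) by simp_all
  have 2: "?d {..<2} 2 = 2" "?d {..<2} 4 = 29" "?d {..<2} 6 = 125"
    using s[of 1] 1 unfolding sets(3) by simp_all
  have 3: "?d {..<3} 2 = 3" "?d {..<3} 4 = 42" "?d {..<3} 6 = 166"
    using s[of 2] 2 unfolding sets(4) by simp_all
  have 4: "?d {..<4} 2 = 4" "?d {..<4} 4 = 54" "?d {..<4} 6 = 194"
    using s[of 3] 3 unfolding sets(5) by simp_all
  \<comment> \<open>210 is the number of all monomials of degree 6.\<close>
  have "?d UNIV 6 = 210"
    using s[of 4] 4 unfolding sets(6) by simp
  then show ?thesis
    using form_dim_full[OF subspace_ideal _ p] binom by simp
qed

section \<open>Regular sequences of triangular quadrics\<close>

lemma eval_mpoly_expand: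
  fixes q :: "('v::finite, 'k::comm_ring_1) mpoly"
  shows "eval_mpoly (\<lambda>c. c) p q = (\<Sum>m\<in>keys q. lookup q m * (\<Prod>v\<in>UNIV. p v ^ lookup m v))"
  by (simp add: eval_mpoly_superset[of _ "keys q"] monom_value_superset[of UNIV])

text \<open>As a function of the coordinate \<open>b\<close>, a quadric is a polynomial of degree 2 whose leading
  coefficient is that of the square of the variable \<open>b\<close>.\<close>

lemma eval_quadric_poly_in_variable:
  fixes q :: "('v::finite, 'k::alg_closed_field) mpoly"
  assumes q: "homogeneous 2 q" and nz: "lookup q (single b 2) \<noteq> 0"
  obtains t where "eval_mpoly (\<lambda>c. c) (p(b := t)) q = 0"
proof -
  \<comment> \<open>The coefficient of \<open>t ^ k\<close> in the value at \<open>p(b := t)\<close>.\<close>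
  define g where "g k = (\<Sum>m | m \<in> keys q \<and> lookup m b = k. lookup q m * (\<Prod>v\<in>UNIV - {b}. p v ^ lookup m v))" for k
  have deg: "(\<Sum>v\<in>UNIV. lookup m v) = 2" if "m \<in> keys q" for m
    using q that by (simp add: homogeneous_def deg_monom_UNIV)
  have top: "m = single b 2" if m: "m \<in> keys q" "lookup m b = 2" for m
  proof -
    have "(\<Sum>v\<in>UNIV - {b}. lookup m v) = 0"
      using deg[OF m(1)] sum.remove[of UNIV b "lookup m"] m(2) by simp
    then have "lookup m v = 0" if "v \<noteq> b" for v using that by simp
    then show ?thesis using m(2) by (intro poly_mapping_eqI) (auto simp: lookup_single when_def)
  qed
  have "{m. m \<in> keys q \<and> lookup m b = 2} = {single b 2}"
  proof (intro equalityI subsetI)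
    fix m assume "m \<in> {m. m \<in> keys q \<and> lookup m b = 2}"
    then show "m \<in> {single b 2}" using top by blast
  next
    fix m assume "m \<in> {single b (2::nat)}"
    then show "m \<in> {m. m \<in> keys q \<and> lookup m b = 2}" using nz by (simp add: in_keys_iff)
  qed
  then have "g 2 = lookup q (single b 2) * (\<Prod>v\<in>UNIV - {b}. p v ^ lookup (single b 2) v)"
    unfolding g_def by simp
  also have "(\<Prod>v\<in>UNIV - {b}. p v ^ lookup (single b 2) v) = 1"
    by (intro prod.neutral) (auto simp: lookup_single when_def)
  finally have "g 2 \<noteq> 0" using nz by simp
  then have "\<exists>t. (\<Sum>k\<le>2. g k * t ^ k) = 0" by (rule alg_closed[rotated]) simp
  then obtain t where t: "(\<Sum>k\<le>2. g k * t ^ k) = 0" ..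
  have "eval_mpoly (\<lambda>c. c) (p(b := t)) q
      = (\<Sum>m\<in>keys q. lookup q m * (\<Prod>v\<in>UNIV - {b}. p v ^ lookup m v) * t ^ lookup m b)"
    unfolding eval_mpoly_expand
  proof (intro sum.cong refl)
    fix m
    have "(\<Prod>v\<in>UNIV. (p(b := t)) v ^ lookup m v) = t ^ lookup m b * (\<Prod>v\<in>UNIV - {b}. (p(b := t)) v ^ lookup m v)"
      by (subst prod.remove[of UNIV b]) simp_all
    also have "(\<Prod>v\<in>UNIV - {b}. (p(b := t)) v ^ lookup m v) = (\<Prod>v\<in>UNIV - {b}. p v ^ lookup m v)"
      by (intro prod.cong) auto
    finally show "lookup q m * (\<Prod>v\<in>UNIV. (p(b := t)) v ^ lookup m v)
        = lookup q m * (\<Prod>v\<in>UNIV - {b}. p v ^ lookup m v) * t ^ lookup m b"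
      by (simp only: mult.assoc mult.commute mult.left_commute)
  qed
  also have "\<dots> = (\<Sum>k\<le>2. \<Sum>m | m \<in> keys q \<and> lookup m b = k.
      lookup q m * (\<Prod>v\<in>UNIV - {b}. p v ^ lookup m v) * t ^ lookup m b)"
  proof (rule sum.group[symmetric])
    show "(\<lambda>m. lookup m b) ` keys q \<subseteq> {..2}"
    proof safe
      fix m assume "m \<in> keys q"
      then show "lookup m b \<le> 2" using deg[of m] member_le_sum[of b UNIV "lookup m"] by simp
    qed
  qed simp_all
  also have "\<dots> = (\<Sum>k\<le>2. g k * t ^ k)"
    unfolding g_def sum_distrib_right by (intro sum.cong refl) auto
  finally show thesis using t that by simp
qed

lemma eval_mpoly_cong_polys_in:
  fixes q :: "('v::finite, 'k::comm_ring_1) mpoly"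
  assumes "q \<in> polys_in V" "\<And>v. v \<in> V \<Longrightarrow> p v = p' v"
  shows "eval_mpoly (\<lambda>c. c) p q = eval_mpoly (\<lambda>c. c) p' q"
  unfolding eval_mpoly_expand
proof (intro sum.cong refl arg_cong2[of _ _ _ _ "(*)"] prod.cong)
  fix m v assume "m \<in> keys q"
  then have "keys m \<subseteq> V" using assms(1) by (simp add: polys_in_def)
  then have "lookup m v = 0 \<or> v \<in> V" by (cases "v \<in> keys m") (auto simp: in_keys_iff)
  then show "p v ^ lookup m v = p' v ^ lookup m v" using assms(2) by auto
qed

text \<open>The coordinates below \<open>i\<close> are chosen in descending order. The equation \<open>f j\<close> does not contain
  variables before \<open>j\<close>, so solving \<open>f b\<close> for the coordinate \<open>b\<close> keeps the later equations valid.\<close>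

lemma common_zero:
  fixes f :: "'v::{finite,linorder} \<Rightarrow> ('v, 'k::alg_closed_field) mpoly"
  assumes f: "\<And>i. homogeneous 2 (f i)" "\<And>i. f i \<in> polys_in {i..}"
    and nz: "\<And>j. j < i \<Longrightarrow> lookup (f j) (single j 2) \<noteq> 0"
    and A: "finite A" "A \<subseteq> {..<i}"
  shows "\<exists>p. p i = 1 \<and> (\<forall>j>i. p j = 0) \<and> (\<forall>j\<in>A. eval_mpoly (\<lambda>c. c) p (f j) = 0)"
  using A
proof (induction A rule: finite_linorder_min_induct)
  case empty
  show ?case by (intro exI[of _ "\<lambda>j. if j = i then 1 else 0"]) auto
next
  case (insert b A)
  then obtain p where p: "p i = 1" "\<forall>j>i. p j = 0" "\<forall>j\<in>A. eval_mpoly (\<lambda>c. c) p (f j) = 0" by auto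
  have "b < i" using insert.prems by simp
  obtain t where t: "eval_mpoly (\<lambda>c. c) (p(b := t)) (f b) = 0"
    using eval_quadric_poly_in_variable[OF f(1) nz[OF \<open>b < i\<close>]] by blast
  have "eval_mpoly (\<lambda>c. c) (p(b := t)) (f j) = 0" if j: "j \<in> A" for j
  proof -
    have "eval_mpoly (\<lambda>c. c) (p(b := t)) (f j) = eval_mpoly (\<lambda>c. c) p (f j)"
      by (rule eval_mpoly_cong_polys_in[OF f(2)]) (use insert.hyps(2) j in auto)
    then show ?thesis using p(3) j by (simp only:)
  qed
  then have "\<forall>j\<in>insert b A. eval_mpoly (\<lambda>c. c) (p(b := t)) (f j) = 0" using t by blast
  moreover have "(p(b := t)) i = 1" "\<forall>j>i. (p(b := t)) j = 0" using p(1,2) \<open>b < i\<close> by auto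
  ultimately show ?case by blast
qed

lemma eval_mpoly_ideal_zero:
  assumes "q \<in> ideal.span (range (f :: 'i::finite \<Rightarrow> ('v, 'k::comm_ring_1) mpoly))"
    and "\<And>i. eval_mpoly (\<lambda>c. c) p (f i) = 0"
  shows "eval_mpoly (\<lambda>c. c) p q = 0"
proof -
  obtain h where "q = (\<Sum>i\<in>UNIV. h i * f i)" using assms(1) unfolding in_ideal_span_range_iff by blast
  then show ?thesis
    by (simp add: ring_map_sum[OF ring_map_eval_mpoly[OF ring_map_id]] eval_mpoly_mult[OF ring_map_id] assms(2))
qed

text \<open>At the first \<open>i\<close> where the coefficient vanishes, take the point of the preceding lemma with
  coordinate \<open>i\<close> equal to 1 and later coordinates 0. The forms before \<open>f i\<close> vanish there by
  construction, \<open>f i\<close> because its only monomial with nonzero value is absent, and the later ones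
  because they involve only later variables. But the sixth power of the variable \<open>i\<close> lies in the ideal,
  and its value is 1.\<close>

lemma regular_triangular_square_coefficient:
  fixes f :: "5 \<Rightarrow> (5, 'k::alg_closed_field) mpoly"
  assumes f: "\<And>i. homogeneous 2 (f i)" "\<And>i. f i \<in> polys_in {i..}" and reg: "regular_sequence f"
  shows "lookup (f i) (single i 2) \<noteq> 0"
proof (induction i rule: less_induct)
  case (less i)
  show ?case
  proof
    assume z: "lookup (f i) (single i 2) = 0"
    have "\<exists>p. p i = 1 \<and> (\<forall>j>i. p j = 0) \<and> (\<forall>j\<in>{..<i}. eval_mpoly (\<lambda>c. c) p (f j) = 0)"
      by (rule common_zero[OF f less]) simp_all
    then obtain p where p: "p i = 1" "\<forall>j>i. p j = 0" "\<forall>j\<in>{..<i}. eval_mpoly (\<lambda>c. c) p (f j) = 0"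
      by (elim exE conjE)
    have "eval_mpoly (\<lambda>c. c) p (f j) = 0" for j
    proof (cases "j < i")
      case False
      show ?thesis
        unfolding eval_mpoly_expand
      proof (intro sum.neutral ballI)
        fix m assume m: "m \<in> keys (f j)"
        have deg: "deg_monom m = 2" using f(1) m by (simp add: homogeneous_def)
        have supp: "keys m \<subseteq> {j..}" using f(2) m by (auto simp: polys_in_def)
        have "\<exists>v>i. v \<in> keys m"
        proof (rule ccontr)
          assume no: "\<not> (\<exists>v>i. v \<in> keys m)"
          have only: "v = i \<and> j = i" if "v \<in> keys m" for v
          proof -
            have "j \<le> v" using that supp by auto
            moreover have "v \<le> i" using that no by (meson not_less)
            moreover have "i \<le> j" using False by simp
            ultimately have "j = i" "v = i" by order+
            then show ?thesis by simp
          qed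
          have "keys m \<noteq> {}" using deg by (auto simp: deg_monom_def)
          then obtain v where "v \<in> keys m" by blast
          from only[OF this] have "j = i" by (rule conjunct2)
          have "lookup m v = 0" if "v \<noteq> i" for v
          proof -
            have "v \<notin> keys m" using only[of v] that by blast
            then show ?thesis by (simp add: in_keys_iff)
          qed
          then have "m = single i (lookup m i)"
            by (intro poly_mapping_eqI) (auto simp: lookup_single when_def)
          then have "m = single i 2" using deg by (metis deg_monom_single)
          then show False using m z \<open>j = i\<close> by (simp add: in_keys_iff)
        qed
        then obtain v where v: "v > i" "v \<in> keys m" by (elim exE conjE)
        have "p v = 0" using p(2) v(1) by blast
        moreover have "lookup m v \<noteq> 0" using v(2) by (simp add: in_keys_iff)
        ultimately have "p v ^ lookup m v = 0" by simp
        then have "(\<Prod>v\<in>UNIV. p v ^ lookup m v) = 0"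
          by (intro prod_zero[OF finite] bexI[of _ v]) simp_all
        then show "lookup (f j) m * (\<Prod>v\<in>UNIV. p v ^ lookup m v) = 0" by simp
      qed
    qed (use p(3) in simp)
    moreover have "Var i ^ 6 \<in> ideal.span (range f)"
      using homogeneous_power[OF homogeneous_Var, of 6 i]
      by (intro regular_quadrics_socle_bound[OF f(1) reg]) simp
    ultimately have "eval_mpoly (\<lambda>c. c) p (Var i ^ 6) = 0" by (rule eval_mpoly_ideal_zero[rotated])
    then show False
      using p(1) by (simp add: ring_map_power[OF ring_map_eval_mpoly[OF ring_map_id]] eval_mpoly_Var[OF ring_map_id])
  qed
qed

section \<open>The generic initial ideal\<close>

text \<open>The quadrics themselves form the polynomial family, so one example is enough. Since the squares of
  the forms given by \<open>good_matrix\<close> satisfy the criterion without a further change of coordinates, the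
  identity matrix serves for the quadrics near this example.\<close>

lemma Gin_eq_J_generic:
  "holds_generically (\<lambda>i::5. 2) (\<lambda>f :: 5 \<Rightarrow> (5, 'k::field_char_0) mpoly. Gin (ideal.span (range f)) = ideal.span J_gens)"
proof -
  let ?coord = "\<lambda>f (i, m). lookup (f i) m :: 'k"
  let ?f0 = "\<lambda>i. lin_change good_matrix (Var i) ^ 2 :: (5, 'k) mpoly"
  have S: "std_spanning (ideal.span (range ?f0))"
    by (rule std_spanning_good_squares) (intro ideal.span_base rangeI)
  have fam: "poly_family ?coord (\<lambda>f. f i)" for i :: 5
    unfolding poly_family_def
  proof (rule allI)
    fix m show "poly_fun ?coord (\<lambda>f. lookup (f i) m)" using poly_fun_coord[of ?coord "(i, m)"] by simp
  qed
  from std_spanning_open[of ?coord "\<lambda>f. f" ?f0, OF fam S] obtain g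
    where "poly_fun ?coord g \<and> g ?f0 \<noteq> 0 \<and>
      (\<forall>f. g f \<noteq> 0 \<longrightarrow> (\<forall>i. homogeneous 2 (f i)) \<longrightarrow> std_spanning (ideal.span (range f)))" ..
  then have g: "poly_fun ?coord g" "g ?f0 \<noteq> 0"
    "\<And>f. g f \<noteq> 0 \<Longrightarrow> \<forall>i. homogeneous 2 (f i) \<Longrightarrow> std_spanning (ideal.span (range f))"
    by simp_all
  have hom0: "homogeneous 2 (?f0 i)" for i
    using homogeneous_power[OF homogeneous_lin_change[OF homogeneous_Var], of 2] by simp
  show ?thesis
    unfolding holds_generically_def
  proof (intro exI[of _ "{f \<in> {f. \<forall>i. homogeneous 2 (f i)}. g f \<noteq> 0}"] conjI ballI)
    show "zariski_open_in ?coord {f. \<forall>i. homogeneous 2 (f i)} {f \<in> {f. \<forall>i. homogeneous 2 (f i)}. g f \<noteq> 0}"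
      by (rule zariski_open_nonvanishing[OF g(1)])
    have "?f0 \<in> {f \<in> {f. \<forall>i. homogeneous 2 (f i)}. g f \<noteq> 0}" using hom0 g(2) by simp
    then show "{f \<in> {f. \<forall>i. homogeneous 2 (f i)}. g f \<noteq> 0} \<noteq> {}" by (rule ex_in_conv[THEN iffD1, OF exI])
    fix f assume "f \<in> {f \<in> {f. \<forall>i. homogeneous 2 (f i)}. g f \<noteq> 0}"
    then have f: "\<And>i. homogeneous 2 (f i)" "g f \<noteq> 0" by simp_all
    have "invertible (mat 1 :: 'k ^ 5 ^ 5)" by (auto simp: invertible_def)
    moreover have "std_spanning (ideal.span (range (\<lambda>i. lin_change (mat 1) (f i))))"
      unfolding lin_change_mat_1 using g(3)[OF f(2)] f(1) by simp
    ultimately show "Gin (ideal.span (range f)) = ideal.span J_gens"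
      by (rule Gin_eq_J[OF f(1)])
  qed
qed

theorem proposition2p2:
  fixes J :: "(5, 'k::{alg_closed_field, field_char_0}) mpoly set"
  defines "J \<equiv> ideal.span
    {x1^2, x1*x2, x2^2, x1*x3, x2*x3, x3^3, x3^2*x4, x1*x4^2, x2*x4^2, x3*x4^2, x4^3,
     x3^2*x5^2, x1*x4*x5^2, x2*x4*x5^2, x3*x4*x5^2, x4^2*x5^2,
     x5^4*x1, x5^4*x2, x5^4*x3, x5^4*x4, x5^6}"
  shows "holds_generically (\<lambda>i::5. 2)
      (\<lambda>f :: 5 \<Rightarrow> (5, 'k) mpoly. Gin (ideal.span (range f)) = J) \<and>
    (\<forall>f :: 5 \<Rightarrow> (5, 'k) mpoly.
      regular_sequence f \<and> (\<forall>i. homogeneous 2 (f i)) \<and> (\<forall>i. f i \<in> polys_in {i..}) \<longrightarrow>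
      Gin (ideal.span (range f)) = J)"
proof -
  have J: "J = ideal.span J_gens" unfolding J_def J_gens_def ..
  show ?thesis
    unfolding J
  proof (intro conjI allI impI)
    show "holds_generically (\<lambda>i::5. 2) (\<lambda>f :: 5 \<Rightarrow> (5, 'k) mpoly. Gin (ideal.span (range f)) = ideal.span J_gens)"
      by (rule Gin_eq_J_generic)
    fix f :: "5 \<Rightarrow> (5, 'k) mpoly"
    assume "regular_sequence f \<and> (\<forall>i. homogeneous 2 (f i)) \<and> (\<forall>i. f i \<in> polys_in {i..})"
    then have reg: "regular_sequence f" and f: "\<And>i. homogeneous 2 (f i)" "\<And>i. f i \<in> polys_in {i..}" by simp_all
    obtain A where "invertible A" "std_spanning (ideal.span (range (\<lambda>i. lin_change A (f i))))"
      using triangular_forms_std_spanning[OF f regular_triangular_square_coefficient[OF f reg]] by blast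
    then show "Gin (ideal.span (range f)) = ideal.span J_gens" by (rule Gin_eq_J[OF f(1)])
  qed
qed

end
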